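(* Let $m$ be an odd integer (positive or negative). Then for any natural number $k\ge1$, \begin{align*} \sum_{n=1}^{\infty}\frac{d_k(n)}{n^{2m+1}}\Psi_{(2\pi)^k,k}(n)&=\frac{1}{(k-1)!}\frac{d^{k-1}}{ds^{k-1}}\left(\zeta^k(2m+1+s)\zeta^k(s)\Gamma^k(s+1)\cos^{k-1}\left(\frac{\pi s}{2}\right)(2\pi)^{-ks}\right)\bigg|_{s=0}\\ &\quad+2^{2km-k}\pi^{2km+2k-1}\sum_{n=0}^{m+1}(-1)^{n+1}\frac{B^k_{2m-2n+2}B^k_{2n}}{\left((2m-2n+2)!\,(2n)!\right)^k}. \end{align*} In particular, at $k=1$ this identity reduces to Lerch's identity $$\zeta(2m+1)+2\sum_{n=1}^\infty\frac{1}{n^{2m+1}(e^{2\pi n}-1)}=2^{2m}\pi^{2m+1}\sum_{j=0}^{m+1}\frac{(-1)^{j+1}B_{2j}B_{2m+2-2j}}{(2j)!\,(2m+2-2j)!}.$$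
   Context: $\zeta$ is the (analytically continued) Riemann zeta function, $\Gamma$ the Gamma function, $B_n$ the $n$-th Bernoulli number, and $f^k(s)$ denotes $(f(s))^k$; likewise $B_n^k=(B_n)^k$. A finite sum from $0$ to $m+1$ with $m+1<0$ is empty, i.e. equal to $0$. $d_k(n)$ is the Piltz divisor function: the number of ordered $k$-tuples of positive integers with product $n$ (so $\sum_{n\ge1} d_k(n)n^{-s}=\zeta^k(s)$ for $\mathrm{Re}(s)>1$). For $\rho>0$, $x>0$ and a natural number $k$, $$\Psi_{\rho,k}(x):=\frac{\pi^{k/2-1}}{2^{k-1}}\sum_{j=1}^\infty d_k(j)\,G^{k+1,0}_{0,2k}\left(\begin{matrix}\text{---}\\ (0)_k,\tfrac12;(\tfrac12)_{k-1}\end{matrix}\ \bigg|\ \frac{\rho^2j^2x^2}{2^{2k}}\right),$$ where $(a)_r$ means the parameter $a$ repeated $r$ times and the Meijer $G$-function occurring here is, for $z>0$ and any $\mu<0$, $$G^{k+1,0}_{0,2k}\left(\begin{matrix}\text{---}\\ (0)_k,\tfrac12;(\tfrac12)_{k-1}\end{matrix}\ \bigg|\ z\right)=\frac{1}{2\pi i}\int_{\mu-i\infty}^{\mu+i\infty}\frac{\Gamma(-s)^k\,\Gamma(\tfrac12-s)}{\Gamma(\tfrac12+s)^{k-1}}\,z^s\,ds.$$ *)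

theory Defs
  imports
    "HOL-Analysis.Analysis"
    "HOL-Computational_Algebra.Formal_Power_Series"
begin

(* The identity theorem makes f unique once its value at the pole 1 is fixed. That value is a
   dummy. *)
definition zeta :: "complex \<Rightarrow> complex" where
  "zeta = (THE f. f holomorphic_on (- {1}) \<and>
                  (\<forall>s. Re s > 1 \<longrightarrow> (\<lambda>n. 1 / of_nat (Suc n) powr s) sums f s) \<and>
                  f 1 = 0)"

(* Generating function X / (exp X - 1), so the convention is B_1 = -1/2. *)
definition bernoulli :: "nat \<Rightarrow> real" where
  "bernoulli n = fact n * fps_nth (fps_X / (fps_exp 1 - 1)) n"

definition piltz_divisor :: "nat \<Rightarrow> nat \<Rightarrow> nat" where
  "piltz_divisor k n = card {xs :: nat list. length xs = k \<and> (\<forall>x\<in>set xs. x > 0) \<and> prod_list xs = n}"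

(* The Mellin-Barnes integral over the line Re s = mu, parametrised by s = mu + i t, ds = i dt.
   At a pole of Gamma (1/2 + s) the quotient is 0, which is the value of the entire function
   1 / Gamma there, since Gamma is 0 at its poles and division by 0 gives 0. *)
definition meijer_G :: "real \<Rightarrow> nat \<Rightarrow> real \<Rightarrow> complex" where
  "meijer_G \<mu> k z = 1 / (2 * of_real pi * \<i>) *
     (\<integral>t. (let s = Complex \<mu> t in
           Gamma (- s) ^ k * Gamma (1/2 - s) / Gamma (1/2 + s) ^ (k - 1) * of_real z powr s) * \<i> \<partial>lborel)"

(* Psi_{rho,k}(x), with the Meijer G-function evaluated on the line Re s = mu, mu < 0. *)
definition Psi :: "real \<Rightarrow> real \<Rightarrow> nat \<Rightarrow> real \<Rightarrow> complex" where
  "Psi \<mu> \<rho> k x = of_real (pi powr (real k / 2 - 1) / 2 ^ (k - 1)) *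
     (\<Sum>j. of_nat (piltz_divisor k (Suc j)) *
           meijer_G \<mu> k (\<rho>\<^sup>2 * (real (Suc j))\<^sup>2 * x\<^sup>2 / 2 ^ (2 * k)))"

end

theory Submission
  imports Defs "HOL-Complex_Analysis.Complex_Analysis"
begin

text \<open>
  Substituting \<open>w = - 2 * s\<close> and using the duplication and reflection formulas of the Gamma function,
  the Meijer G-function becomes the Mellin integral of \<open>Gamma w ^ k * cos (pi * w / 2) ^ (k - 1)\<close>,
  and summing over both indices turns the left-hand side into the integral over a line
  \<open>Re w = c\<close> far to the right of this kernel times
  \<open>zeta w ^ k * zeta (2 * m + 1 + w) ^ k * (2 * pi) powr (- k * w)\<close>. By the functional equation the integrand is
  \<open>(zeta (1 - w) / 2) ^ k * zeta (2 * m + 1 + w) ^ k / cos (pi * w / 2)\<close>, which for odd \<open>m\<close> changes sign under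
  \<open>w \<mapsto> - 2 * m - w\<close>. Hence shifting the line to \<open>Re w = - 2 * m - c\<close> expresses twice the
  left-hand side as a sum of residues: those at \<open>0\<close> and \<open>- 2 * m\<close> are equal and give the
  derivative, and the simple poles at the odd integers between \<open>- 2 * m - 1\<close> and \<open>1\<close> give the
  Bernoulli sum (the trivial zeros of zeta cancel all others). Lerch's identity is the case \<open>k = 1\<close>, where the
  Mellin integral of \<open>Gamma\<close> is \<open>exp (- x)\<close>.
\<close>

section \<open>Growth in vertical strips and contour shifts\<close>

text \<open>All estimates track one number, the exponential rate in \<open>Im w\<close>, up to an
  arbitrarily small slack: polynomial factors have rate 0, Gamma has rate -pi/2, the cosine pi/2.
  The \<open>k\<close> Gamma factors and \<open>k - 1\<close> cosines of the kernel leave -pi/2 for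
  every \<open>k\<close>, so line integrals converge absolutely and horizontal sides of contours
  vanish; in the reflected form the whole decay comes from 1 / cos. Since \<open>zeta\<close> is
  given only by its characterising property, a continuation has to be built before any line can be
  moved: trapezoid sums reach \<open>Re s > -1\<close>, the functional equation is proved on the
  overlap -1 < Re s < 0, and its right-hand side then supplies the rest of the plane. The vertical
  line is Re w = 2M + 2 with M at least |m|: an even abscissa misses the poles of 1 / cos, its
  mirror image is again even, and both Dirichlet series converge on it. An odd \<open>m\<close> is
  nonzero, so the poles at 0 and -2m stay apart; their equal residues leave one derivative after
  halving.\<close>

text \<open>The slack \<open>\<epsilon>\<close> makes polynomial factors count as rate 0, and
  \<open>1 \<le> \<bar>Im z\<bar>\<close> keeps the poles of Gamma, zeta and 1 / cos, all of them
  real, out of the estimate.\<close>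

definition exp_growth :: "real \<Rightarrow> real \<Rightarrow> real \<Rightarrow> (complex \<Rightarrow> complex) \<Rightarrow> bool" where
  "exp_growth a b r f \<longleftrightarrow> (\<forall>\<epsilon>>0. \<exists>C. \<forall>z. a \<le> Re z \<longrightarrow> Re z \<le> b \<longrightarrow> 1 \<le> \<bar>Im z\<bar> \<longrightarrow>
     norm (f z) \<le> C * exp ((r + \<epsilon>) * \<bar>Im z\<bar>))"

lemma exp_growthI:
  assumes "\<And>\<epsilon>. \<epsilon> > 0 \<Longrightarrow> \<exists>C. \<forall>z. a \<le> Re z \<longrightarrow> Re z \<le> b \<longrightarrow> 1 \<le> \<bar>Im z\<bar> \<longrightarrow>
     norm (f z) \<le> C * exp ((r + \<epsilon>) * \<bar>Im z\<bar>)"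
  shows "exp_growth a b r f"
  using assms unfolding exp_growth_def by blast

lemma exp_growthE:
  assumes "exp_growth a b r f" "\<epsilon> > 0"
  obtains C where "C \<ge> 0"
    "\<And>z. a \<le> Re z \<Longrightarrow> Re z \<le> b \<Longrightarrow> 1 \<le> \<bar>Im z\<bar> \<Longrightarrow> norm (f z) \<le> C * exp ((r + \<epsilon>) * \<bar>Im z\<bar>)"
proof -
  obtain C where C: "\<And>z. a \<le> Re z \<Longrightarrow> Re z \<le> b \<Longrightarrow> 1 \<le> \<bar>Im z\<bar> \<Longrightarrow>
      norm (f z) \<le> C * exp ((r + \<epsilon>) * \<bar>Im z\<bar>)"
    using assms unfolding exp_growth_def by blast
  have "norm (f z) \<le> max 0 C * exp ((r + \<epsilon>) * \<bar>Im z\<bar>)"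
    if "a \<le> Re z" "Re z \<le> b" "1 \<le> \<bar>Im z\<bar>" for z
    by (rule order_trans[OF C[OF that]]) (intro mult_right_mono, auto)
  then show ?thesis by (intro that[of "max 0 C"]) auto
qed

lemma exp_growth_mult:
  assumes "exp_growth a b r f" "exp_growth a b s g"
  shows "exp_growth a b (r + s) (\<lambda>z. f z * g z)"
proof (rule exp_growthI, goal_cases)
  case (1 \<epsilon>)
  then have e: "\<epsilon> / 2 > 0" by simp
  from exp_growthE[OF assms(1) e] obtain C where C: "C \<ge> 0"
    "\<And>z. a \<le> Re z \<Longrightarrow> Re z \<le> b \<Longrightarrow> 1 \<le> \<bar>Im z\<bar> \<Longrightarrow> norm (f z) \<le> C * exp ((r + \<epsilon>/2) * \<bar>Im z\<bar>)" by blast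
  from exp_growthE[OF assms(2) e] obtain D where D: "D \<ge> 0"
    "\<And>z. a \<le> Re z \<Longrightarrow> Re z \<le> b \<Longrightarrow> 1 \<le> \<bar>Im z\<bar> \<Longrightarrow> norm (g z) \<le> D * exp ((s + \<epsilon>/2) * \<bar>Im z\<bar>)" by blast
  have "norm (f z * g z) \<le> (C * D) * exp ((r + s + \<epsilon>) * \<bar>Im z\<bar>)"
    if z: "a \<le> Re z" "Re z \<le> b" "1 \<le> \<bar>Im z\<bar>" for z
  proof -
    have "norm (f z * g z) \<le> (C * exp ((r + \<epsilon>/2) * \<bar>Im z\<bar>)) * (D * exp ((s + \<epsilon>/2) * \<bar>Im z\<bar>))"
      unfolding norm_mult using C D z by (intro mult_mono) auto
    also have "\<dots> = (C * D) * exp ((r + \<epsilon>/2) * \<bar>Im z\<bar> + (s + \<epsilon>/2) * \<bar>Im z\<bar>)"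
      by (simp add: exp_add)
    also have "(r + \<epsilon>/2) * \<bar>Im z\<bar> + (s + \<epsilon>/2) * \<bar>Im z\<bar> = (r + s + \<epsilon>) * \<bar>Im z\<bar>"
      by (simp add: algebra_simps)
    finally show ?thesis .
  qed
  then show ?case by blast
qed

lemma exp_growth_add:
  assumes "exp_growth a b r f" "exp_growth a b r g"
  shows "exp_growth a b r (\<lambda>z. f z + g z)"
proof (rule exp_growthI, goal_cases)
  case e: (1 \<epsilon>)
  from exp_growthE[OF assms(1) e] obtain C where C: "C \<ge> 0"
    "\<And>z. a \<le> Re z \<Longrightarrow> Re z \<le> b \<Longrightarrow> 1 \<le> \<bar>Im z\<bar> \<Longrightarrow> norm (f z) \<le> C * exp ((r + \<epsilon>) * \<bar>Im z\<bar>)" by blast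
  from exp_growthE[OF assms(2) e] obtain D where D: "D \<ge> 0"
    "\<And>z. a \<le> Re z \<Longrightarrow> Re z \<le> b \<Longrightarrow> 1 \<le> \<bar>Im z\<bar> \<Longrightarrow> norm (g z) \<le> D * exp ((r + \<epsilon>) * \<bar>Im z\<bar>)" by blast
  have "norm (f z + g z) \<le> (C + D) * exp ((r + \<epsilon>) * \<bar>Im z\<bar>)"
    if z: "a \<le> Re z" "Re z \<le> b" "1 \<le> \<bar>Im z\<bar>" for z
    using C(2)[OF z] D(2)[OF z] norm_triangle_ineq[of "f z" "g z"] by (simp add: distrib_right)
  then show ?case by blast
qed

lemma exp_growth_mono_norm:
  assumes "exp_growth a b r g"
    "\<And>z. a \<le> Re z \<Longrightarrow> Re z \<le> b \<Longrightarrow> 1 \<le> \<bar>Im z\<bar> \<Longrightarrow> norm (f z) \<le> norm (g z)"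
  shows "exp_growth a b r f"
  using assms unfolding exp_growth_def by (meson order_trans)

lemma exp_growth_subset:
  assumes "exp_growth a b r f" "a \<le> a'" "b' \<le> b"
  shows "exp_growth a' b' r f"
  using assms unfolding exp_growth_def by (meson order_trans)

lemma exp_growth_split:
  assumes "exp_growth a b r f" "exp_growth b c r f"
  shows "exp_growth a c r f"
proof (rule exp_growthI, goal_cases)
  case e: (1 \<epsilon>)
  from exp_growthE[OF assms(1) e] obtain C where C: "C \<ge> 0"
    "\<And>z. a \<le> Re z \<Longrightarrow> Re z \<le> b \<Longrightarrow> 1 \<le> \<bar>Im z\<bar> \<Longrightarrow> norm (f z) \<le> C * exp ((r + \<epsilon>) * \<bar>Im z\<bar>)" by blast
  from exp_growthE[OF assms(2) e] obtain D where D: "D \<ge> 0"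
    "\<And>z. b \<le> Re z \<Longrightarrow> Re z \<le> c \<Longrightarrow> 1 \<le> \<bar>Im z\<bar> \<Longrightarrow> norm (f z) \<le> D * exp ((r + \<epsilon>) * \<bar>Im z\<bar>)" by blast
  have "norm (f z) \<le> (C + D) * exp ((r + \<epsilon>) * \<bar>Im z\<bar>)"
    if z: "a \<le> Re z" "Re z \<le> c" "1 \<le> \<bar>Im z\<bar>" for z
  proof -
    have "0 \<le> C * exp ((r + \<epsilon>) * \<bar>Im z\<bar>)" "0 \<le> D * exp ((r + \<epsilon>) * \<bar>Im z\<bar>)" using C(1) D(1) by auto
    then show ?thesis using C(2)[of z] D(2)[of z] z by (cases "Re z \<le> b") (auto simp: distrib_right)
  qed
  then show ?case by blast
qed

lemma exp_growth_bounded: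
  assumes "\<And>z. a \<le> Re z \<Longrightarrow> Re z \<le> b \<Longrightarrow> 1 \<le> \<bar>Im z\<bar> \<Longrightarrow> norm (f z) \<le> C * exp (r * \<bar>Im z\<bar>)"
  shows "exp_growth a b r f"
proof (rule exp_growthI, goal_cases)
  case e: (1 \<epsilon>)
  have "norm (f z) \<le> max 0 C * exp ((r + \<epsilon>) * \<bar>Im z\<bar>)"
    if z: "a \<le> Re z" "Re z \<le> b" "1 \<le> \<bar>Im z\<bar>" for z
  proof -
    have "C * exp (r * \<bar>Im z\<bar>) \<le> max 0 C * exp ((r + \<epsilon>) * \<bar>Im z\<bar>)"
      using e by (intro mult_mono) (auto simp: distrib_right)
    then show ?thesis using assms[OF z] by simp
  qed
  then show ?case by blast
qed

lemma exp_growth_const: "exp_growth a b 0 (\<lambda>z. c)"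
  by (rule exp_growth_bounded[of _ _ _ "norm c"]) simp

lemma exp_growth_ident: "exp_growth a b 0 (\<lambda>z. z)"
proof (rule exp_growthI, goal_cases)
  case e: (1 \<epsilon>)
  \<comment> \<open>The coefficient \<open>1 / \<epsilon>\<close> comes from
    \<open>\<epsilon> * t \<le> exp (\<epsilon> * t)\<close>, the inequality that gives linear
    growth rate 0.\<close>
  have "norm z \<le> (\<bar>a\<bar> + \<bar>b\<bar> + 1 / \<epsilon>) * exp ((0 + \<epsilon>) * \<bar>Im z\<bar>)"
    if z: "a \<le> Re z" "Re z \<le> b" "1 \<le> \<bar>Im z\<bar>" for z
  proof -
    have "norm z \<le> \<bar>Re z\<bar> + \<bar>Im z\<bar>" by (rule cmod_le)
    also have "\<dots> \<le> (\<bar>a\<bar> + \<bar>b\<bar>) * 1 + 1 / \<epsilon> * (\<epsilon> * \<bar>Im z\<bar>)" using z e by auto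
    also have "\<dots> \<le> (\<bar>a\<bar> + \<bar>b\<bar>) * exp (\<epsilon> * \<bar>Im z\<bar>) + 1 / \<epsilon> * exp (\<epsilon> * \<bar>Im z\<bar>)"
    proof (intro add_mono mult_left_mono)
      show "\<epsilon> * \<bar>Im z\<bar> \<le> exp (\<epsilon> * \<bar>Im z\<bar>)" using exp_ge_add_one_self[of "\<epsilon> * \<bar>Im z\<bar>"] by linarith
    qed (use e in auto)
    finally show ?thesis by (simp add: distrib_right)
  qed
  then show ?case by blast
qed

lemma exp_growth_power:
  assumes "exp_growth a b r f"
  shows "exp_growth a b (real n * r) (\<lambda>z. f z ^ n)"
proof (induction n)
  case 0
  show ?case using exp_growth_const[of a b 1] by simp
next
  case (Suc n)
  from exp_growth_mult[OF assms Suc] show ?case by (simp add: algebra_simps)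
qed

lemma exp_growth_reflect:
  assumes "exp_growth a b r f"
  shows "exp_growth (d - b) (d - a) r (\<lambda>z. f (of_real d - z))"
proof (rule exp_growthI, goal_cases)
  case e: (1 \<epsilon>)
  from exp_growthE[OF assms(1) e] obtain C where C: 
    "\<And>z. a \<le> Re z \<Longrightarrow> Re z \<le> b \<Longrightarrow> 1 \<le> \<bar>Im z\<bar> \<Longrightarrow> norm (f z) \<le> C * exp ((r + \<epsilon>) * \<bar>Im z\<bar>)" by blast
  show ?case
    using C[of "of_real d - z" for z] by (intro exI[of _ C]) auto
qed

lemma exp_growth_shift:
  assumes "exp_growth a b r f"
  shows "exp_growth (a - d) (b - d) r (\<lambda>z. f (of_real d + z))"
proof (rule exp_growthI, goal_cases)
  case e: (1 \<epsilon>)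
  from exp_growthE[OF assms(1) e] obtain C where C: 
    "\<And>z. a \<le> Re z \<Longrightarrow> Re z \<le> b \<Longrightarrow> 1 \<le> \<bar>Im z\<bar> \<Longrightarrow> norm (f z) \<le> C * exp ((r + \<epsilon>) * \<bar>Im z\<bar>)" by blast
  show ?case
    using C[of "of_real d + z" for z] by (intro exI[of _ C]) auto
qed

section \<open>Absolute convergence on vertical lines and the residue theorem for strips\<close>

lemma continuous_on_Complex_line: "continuous_on A (\<lambda>t. Complex c t)"
  by (auto simp: Complex_eq intro!: continuous_intros)

lemma integrable_exp_neg_abs:
  assumes "r < 0"
  shows "integrable lborel (\<lambda>t::real. exp (r * \<bar>t\<bar>))"
proof -
  have "set_integrable lborel {0..} (\<lambda>t::real. exp (r * t))"
  proof -
    have "((\<lambda>x. exp (- (-r) * x)) has_integral exp (- (-r) * 0) / (-r)) {0..}"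
      by (rule has_integral_exp_minus_to_infinity) (use assms in auto)
    then have "(\<lambda>x. exp (r * x)) integrable_on {0..}" by (auto simp: integrable_on_def)
    then have "(\<lambda>x. exp (r * x)) absolutely_integrable_on {0..}"
      by (intro nonnegative_absolutely_integrable_1) auto
    then show ?thesis
      unfolding absolutely_integrable_on_def set_integrable_def
      by (subst (asm) integrable_completion) auto
  qed
  then have 1: "integrable lborel (\<lambda>t::real. indicator {0..} t * exp (r * t))"
    by (simp add: set_integrable_def)
  have 2: "integrable lborel (\<lambda>t::real. indicator {0..} (-t) * exp (r * (-t)))"
    using lborel_integrable_real_affine[OF 1, of "-1" 0] by simp
  show ?thesis
    by (rule Bochner_Integration.integrable_bound[OF Bochner_Integration.integrable_add[OF 1 2]])
       (auto simp: indicator_def abs_if)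
qed

lemma exp_growth_line_integrable:
  assumes "exp_growth a b r f" "r < 0" "a \<le> c" "c \<le> b"
    "continuous_on UNIV (\<lambda>t. f (Complex c t))"
  shows "integrable lborel (\<lambda>t. f (Complex c t))"
proof -
  \<comment> \<open>With this slack the rate becomes \<open>r / 2\<close>, which is still
    negative.\<close>
  have e: "- r / 2 > 0" using assms by simp
  from exp_growthE[OF assms(1) e] obtain C where C: "C \<ge> 0"
    "\<And>z. a \<le> Re z \<Longrightarrow> Re z \<le> b \<Longrightarrow> 1 \<le> \<bar>Im z\<bar> \<Longrightarrow> norm (f z) \<le> C * exp ((r + - r/2) * \<bar>Im z\<bar>)" by blast
  have "compact ((\<lambda>t. f (Complex c t)) ` {-1..1})"
    by (intro compact_continuous_image continuous_on_subset[OF assms(5)]) auto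
  then obtain D where D: "\<And>t. t \<in> {-1..1} \<Longrightarrow> norm (f (Complex c t)) \<le> D"
    by (meson compact_imp_bounded bounded_iff imageI)
  have D0: "D \<ge> 0" using D[of 0] norm_ge_zero[of "f (Complex c 0)"] by (auto simp del: norm_ge_zero)
  \<comment> \<open>For \<open>\<bar>t\<bar> \<le> 1\<close> the weight is at least
    \<open>exp (r / 2)\<close>; the factor \<open>exp (- r/2)\<close> makes up for that
    loss.\<close>
  have bd: "norm (f (Complex c t)) \<le> (C + D * exp (- r/2)) * exp (r / 2 * \<bar>t\<bar>)" for t
  proof (cases "\<bar>t\<bar> \<le> 1")
    case True
    have "norm (f (Complex c t)) \<le> D" using True by (intro D) (unfold atLeastAtMost_iff, linarith)
    also have "D = D * exp (- r/2) * exp (r / 2 * 1)" by (simp flip: exp_add)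
    also have "\<dots> \<le> (C + D * exp (- r/2)) * exp (r / 2 * \<bar>t\<bar>)"
      using True assms(2) C(1) D0 by (intro mult_mono) (auto simp: mult_left_le)
    finally show ?thesis .
  next
    case False
    have "norm (f (Complex c t)) \<le> C * exp (r / 2 * \<bar>t\<bar>)"
      using C(2)[of "Complex c t"] False assms by auto
    also have "\<dots> \<le> (C + D * exp (- r/2)) * exp (r / 2 * \<bar>t\<bar>)"
      using D0 by (intro mult_right_mono) auto
    finally show ?thesis .
  qed
  show ?thesis
  proof (rule Bochner_Integration.integrable_bound)
    show "integrable lborel (\<lambda>t. (C + D * exp (- r/2)) * exp (r / 2 * \<bar>t\<bar>))"
      using assms by (intro integrable_mult_right integrable_exp_neg_abs) auto
    show "(\<lambda>t. f (Complex c t)) \<in> borel_measurable lborel"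
      using borel_measurable_continuous_onI[OF assms(5)] by simp
    show "AE x in lborel. norm (f (Complex c x)) \<le> norm ((C + D * exp (- r/2)) * exp (r / 2 * \<bar>x\<bar>))"
      by (intro AE_I2 order_trans[OF bd]) (simp only: real_norm_def abs_ge_self)
  qed
qed

text \<open>Residue theorem on rectangles of growing height; the negative rate kills the horizontal
  sides. The integrals run over the height t with dz = i dt, hence 2 pi instead of 2 pi i. The wider
  strip from \<open>a'\<close> to \<open>b'\<close> is an open domain containing both lines.\<close>

lemma contour_shift:
  assumes "a' < a" "a < b" "b < b'" "finite S" "\<And>z. z \<in> S \<Longrightarrow> a < Re z \<and> Re z < b"
    and holo: "f holomorphic_on {z. a' < Re z \<and> Re z < b'} - S"
    and growth: "exp_growth a b r f" "r < 0"
  shows "integrable lborel (\<lambda>t. f (Complex a t))" "integrable lborel (\<lambda>t. f (Complex b t))"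
    "(\<integral>t. f (Complex b t) \<partial>lborel) - (\<integral>t. f (Complex a t) \<partial>lborel) =
       2 * pi * (\<Sum>z\<in>S. residue f z)"
proof -
  let ?I = "\<lambda>c. \<integral>t. f (Complex c t) \<partial>lborel"
  define A where "A = {z. a' < Re z \<and> Re z < b'}"
  have A: "open A" "convex A"
  proof -
    have "A = {z. a' < Re z} \<inter> {z. Re z < b'}" by (auto simp: A_def)
    then show "open A" "convex A"
      by (auto intro!: open_Int open_halfspace_Re_gt open_halfspace_Re_lt convex_Int
          convex_halfspace_Re_gt convex_halfspace_Re_lt)
  qed
  have cont: "continuous_on (A - S) f" using holo A_def holomorphic_on_imp_continuous_on by blast
  have cont_a: "continuous_on UNIV (\<lambda>t. f (Complex a t))"
    by (rule continuous_on_compose2[OF cont continuous_on_Complex_line])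
       (use assms in \<open>force simp: A_def\<close>)
  have cont_b: "continuous_on UNIV (\<lambda>t. f (Complex b t))"
    by (rule continuous_on_compose2[OF cont continuous_on_Complex_line])
       (use assms in \<open>force simp: A_def\<close>)
  show int_a: "integrable lborel (\<lambda>t. f (Complex a t))"
    by (rule exp_growth_line_integrable[OF growth]) (use assms cont_a in auto)
  show int_b: "integrable lborel (\<lambda>t. f (Complex b t))"
    by (rule exp_growth_line_integrable[OF growth]) (use assms cont_b in auto)
  define V where "V c n = integral {- real n..real n} (\<lambda>t. f (Complex c t))" for c n
  have V_lim: "V c \<longlonglongrightarrow> ?I c"
    if "integrable lborel (\<lambda>t. f (Complex c t))" "continuous_on UNIV (\<lambda>t. f (Complex c t))" for c
  proof -
    have "V c = (\<lambda>n. \<integral>t. indicator {- real n..real n} t *\<^sub>R f (Complex c t) \<partial>lborel)"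
    proof
      fix n
      have "set_integrable lborel {- real n..real n} (\<lambda>t. f (Complex c t))"
        by (intro borel_integrable_atLeastAtMost' continuous_on_subset[OF that(2)]) auto
      from set_borel_integral_eq_integral(2)[OF this]
      show "V c n = (\<integral>t. indicator {- real n..real n} t *\<^sub>R f (Complex c t) \<partial>lborel)"
        by (simp add: V_def set_lebesgue_integral_def)
    qed
    also have "\<dots> \<longlonglongrightarrow> ?I c"
    proof (rule integral_dominated_convergence[where w = "\<lambda>t. norm (f (Complex c t))"])
      show "AE x in lborel. (\<lambda>i. indicator {- real i..real i} x *\<^sub>R f (Complex c x)) \<longlonglongrightarrow> f (Complex c x)"
      proof (rule AE_I2)
        fix x :: real
        have "eventually (\<lambda>i. indicator {- real i..real i} x *\<^sub>R f (Complex c x) = f (Complex c x)) sequentially"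
          using eventually_ge_at_top[of "nat \<lceil>\<bar>x\<bar>\<rceil>"]
          by eventually_elim (auto simp: indicator_def)
        then show "(\<lambda>i. indicator {- real i..real i} x *\<^sub>R f (Complex c x)) \<longlonglongrightarrow> f (Complex c x)"
          by (rule tendsto_eventually)
      qed
      show "AE x in lborel. norm (indicator {- real i..real i} x *\<^sub>R f (Complex c x)) \<le> norm (f (Complex c x))" for i
        by (rule AE_I2) (auto simp: indicator_def)
    qed (use that in \<open>auto intro!: borel_measurable_continuous_onI\<close>)
    finally show ?thesis .
  qed
  have fin_im: "eventually (\<lambda>n::nat. \<forall>z\<in>S. \<bar>Im z\<bar> < real n) sequentially"
    using assms(4) by (intro eventually_ball_finite ballI) (auto intro: filterlim_at_top_dense[THEN iffD1, rule_format, OF filterlim_real_sequentially])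
  \<comment> \<open>\<open>Ht\<close> and \<open>Hb\<close> are the horizontal sides at heights n
    and -n; the vertical sides are \<open>\<i>\<close> times the truncated line integrals
    \<open>V\<close>.\<close>
  define R where "R n = rectpath (Complex a (- real n)) (Complex b (real n))" for n
  define Ht where "Ht n = contour_integral (linepath (Complex b (real n)) (Complex a (real n))) f" for n
  define Hb where "Hb n = contour_integral (linepath (Complex a (- real n)) (Complex b (- real n))) f" for n
  have e: "- r / 2 > 0" using assms by simp
  from exp_growthE[OF growth(1) e] obtain C where C: "C \<ge> 0"
    "\<And>z. a \<le> Re z \<Longrightarrow> Re z \<le> b \<Longrightarrow> 1 \<le> \<bar>Im z\<bar> \<Longrightarrow> norm (f z) \<le> C * exp ((r + - r/2) * \<bar>Im z\<bar>)" by blast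
  have ev: "eventually (\<lambda>n. \<i> * V b n - \<i> * V a n + Ht n + Hb n = 2 * pi * \<i> * (\<Sum>z\<in>S. residue f z)
     \<and> norm (Ht n) \<le> C * exp (r / 2 * real n) * (b - a) \<and> norm (Hb n) \<le> C * exp (r / 2 * real n) * (b - a)) sequentially"
    using fin_im eventually_gt_at_top[of 0]
  proof eventually_elim
    case (elim n)
    have sub: "path_image (R n) \<subseteq> A - S"
      using elim assms by (subst R_def, subst path_image_rectpath) (force simp: A_def)+
    have lp: "f contour_integrable_on linepath p q" if "closed_segment p q \<subseteq> A - S" for p q
      by (intro contour_integrable_continuous_linepath continuous_on_subset[OF cont] that)
    have lp_b: "f contour_integrable_on linepath (Complex a (- real n)) (Complex b (- real n))"
      and lp_t: "f contour_integrable_on linepath (Complex b (real n)) (Complex a (real n))"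
      by (rule lp, use elim assms in \<open>force simp: A_def closed_segment_same_Im closed_segment_eq_real_ivl\<close>)+
    have lp_r: "f contour_integrable_on linepath (Complex b (- real n)) (Complex b (real n))"
      and lp_l: "f contour_integrable_on linepath (Complex a (real n)) (Complex a (- real n))"
      by (rule lp, use elim assms in \<open>force simp: A_def closed_segment_same_Re closed_segment_eq_real_ivl\<close>)+
    have "contour_integral (R n) f = Hb n + (contour_integral (linepath (Complex b (- real n)) (Complex b (real n))) f
        + (Ht n + contour_integral (linepath (Complex a (real n)) (Complex a (- real n))) f))"
      unfolding R_def rectpath_def Let_def Hb_def Ht_def
      using lp_b lp_t lp_r lp_l
      by (simp add: contour_integral_join contour_integrable_joinI)
    also have "contour_integral (linepath (Complex b (- real n)) (Complex b (real n))) f = \<i> * V b n"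
      unfolding V_def using elim by (intro contour_integral_linepath_same_Re) auto
    also have "contour_integral (linepath (Complex a (real n)) (Complex a (- real n))) f
        = - contour_integral (linepath (Complex a (- real n)) (Complex a (real n))) f"
      by (subst contour_integral_reversepath[symmetric]) auto
    also have "contour_integral (linepath (Complex a (- real n)) (Complex a (real n))) f = \<i> * V a n"
      unfolding V_def using elim by (intro contour_integral_linepath_same_Re) auto
    finally have 1: "contour_integral (R n) f = \<i> * V b n - \<i> * V a n + Ht n + Hb n" by simp
    have "contour_integral (R n) f = 2 * pi * \<i> * (\<Sum>p\<in>S. winding_number (R n) p * residue f p)"
    proof (rule Residue_theorem[OF A(1) convex_connected[OF A(2)] assms(4)])
      show "\<forall>z. z \<notin> A \<longrightarrow> winding_number (R n) z = 0"
      proof (intro allI impI)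
        fix z assume "z \<notin> A"
        then show "winding_number (R n) z = 0"
          unfolding R_def using elim assms
          by (intro winding_number_rectpath_outside) (auto simp: A_def in_cbox_complex_iff)
      qed
    qed (use sub holo in \<open>auto simp: R_def A_def\<close>)
    also have "(\<Sum>p\<in>S. winding_number (R n) p * residue f p) = (\<Sum>p\<in>S. residue f p)"
    proof (intro sum.cong refl)
      fix p assume "p \<in> S"
      then have "winding_number (R n) p = 1"
        unfolding R_def using elim assms
        by (intro winding_number_rectpath) (force simp: in_box_complex_iff abs_less_iff)
      then show "winding_number (R n) p * residue f p = residue f p" by simp
    qed
    finally have 2: "contour_integral (R n) f = 2 * pi * \<i> * (\<Sum>p\<in>S. residue f p)" .
    have hb: "norm (contour_integral (linepath p q) f) \<le> C * exp (r / 2 * real n) * (b - a)"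
      if "f contour_integrable_on linepath p q" "norm (q - p) = b - a"
        "\<And>z. z \<in> closed_segment p q \<Longrightarrow> a \<le> Re z \<and> Re z \<le> b \<and> \<bar>Im z\<bar> = real n" for p q
      unfolding that(2)[symmetric]
      by (rule contour_integral_bound_linepath[OF that(1)]) (use C that(3) elim in force)+
    have "norm (Ht n) \<le> C * exp (r / 2 * real n) * (b - a)" "norm (Hb n) \<le> C * exp (r / 2 * real n) * (b - a)"
      unfolding Ht_def Hb_def using assms(2)
      by (intro hb lp_t lp_b; force simp: closed_segment_same_Im closed_segment_eq_real_ivl cmod_def)+
    then show ?case using 1 2 by simp
  qed
  have lim0: "(\<lambda>n. C * exp (r / 2 * real n) * (b - a)) \<longlonglongrightarrow> 0"
  proof -
    have "(\<lambda>n. exp (r/2) ^ n) \<longlonglongrightarrow> 0"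
      by (rule LIMSEQ_power_zero) (use growth in auto)
    then have "(\<lambda>n. exp (r / 2 * real n)) \<longlonglongrightarrow> 0" by (simp only: exp_of_nat2_mult)
    then have "(\<lambda>n. C * exp (r / 2 * real n) * (b - a)) \<longlonglongrightarrow> C * 0 * (b - a)"
      by (intro tendsto_mult tendsto_const)
    then show ?thesis by simp
  qed
  have Ht0: "Ht \<longlonglongrightarrow> 0"
    by (rule Lim_null_comparison[OF _ lim0]) (use ev in eventually_elim, auto)
  have Hb0: "Hb \<longlonglongrightarrow> 0"
    by (rule Lim_null_comparison[OF _ lim0]) (use ev in eventually_elim, auto)
  have "(\<lambda>n. \<i> * V b n - \<i> * V a n + Ht n + Hb n) \<longlonglongrightarrow>
     \<i> * ?I b - \<i> * ?I a + 0 + 0"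
    by (intro tendsto_intros V_lim Ht0 Hb0 int_a int_b cont_a cont_b)
  moreover have "(\<lambda>n. \<i> * V b n - \<i> * V a n + Ht n + Hb n) \<longlonglongrightarrow> 2 * pi * \<i> * (\<Sum>z\<in>S. residue f z)"
    by (rule tendsto_eventually) (use ev in eventually_elim, auto)
  ultimately have "\<i> * ?I b - \<i> * ?I a + 0 + 0 =
      2 * pi * \<i> * (\<Sum>z\<in>S. residue f z)"
    by (rule LIMSEQ_unique)
  then have "\<i> * (?I b - ?I a) =
      \<i> * (2 * pi * (\<Sum>z\<in>S. residue f z))" by (simp add: algebra_simps)
  then show "?I b - ?I a = 2 * pi * (\<Sum>z\<in>S. residue f z)"
    by simp
qed

section \<open>Decay of the Gamma function on vertical lines\<close>

lemma not_nonpos_IntsI: "Re z > 0 \<Longrightarrow> z \<notin> \<int>\<^sub>\<le>\<^sub>0"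
  by (auto elim!: nonpos_Ints_cases)

text \<open>|Gamma (x + iy)| / Gamma x increases with x: its product form has the factors (x + j) /
  |x + j + iy|, each increasing in x, and the powers of n cancel in the ratio. The inequality is
  this monotonicity cross-multiplied.\<close>

lemma norm_Gamma_series_ratio_le:
  assumes "0 < x" "x \<le> x'"
  shows "norm (Gamma_series (Complex x y) n) * Gamma_series x' n \<le> norm (Gamma_series (Complex x' y) n) * Gamma_series x n"
proof -
  have pos: "pochhammer c (n+1) > 0" if "c > 0" for c :: real using that by (rule pochhammer_pos)
  have npoch: "norm (pochhammer (Complex c y) (n+1)) = (\<Prod>i<n+1. norm (Complex (c + real i) y))" for c
    unfolding pochhammer_prod prod_norm[symmetric]
    by (intro prod.cong) (auto simp: atLeast0LessThan intro!: arg_cong[of _ _ norm] complex_eqI)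
  have rpoch: "pochhammer c (n+1) = (\<Prod>i<n+1. c + real i)" for c :: real
    unfolding pochhammer_prod by (intro prod.cong) (auto simp: atLeast0LessThan)
  have nexp: "norm (exp (Complex c y * of_real (ln (of_nat n)))) = exp (c * ln (of_nat n))" for c
    by (simp add: norm_exp_eq_Re)
  have key: "norm (pochhammer (Complex x' y) (n+1)) * pochhammer x (n+1) \<le> norm (pochhammer (Complex x y) (n+1)) * pochhammer x' (n+1)"
    unfolding npoch rpoch prod.distrib[symmetric]
  proof (rule prod_mono, intro conjI)
    fix i
    define p q where "p = x + real i" and "q = x' + real i"
    have pq: "0 < p" "p \<le> q" using assms by (auto simp: p_def q_def)
    have "sqrt (q\<^sup>2 + y\<^sup>2) * p = sqrt ((q\<^sup>2 + y\<^sup>2) * p\<^sup>2)" using pq by (simp add: real_sqrt_mult)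
    also have "\<dots> \<le> sqrt ((p\<^sup>2 + y\<^sup>2) * q\<^sup>2)"
    proof (rule real_sqrt_le_mono)
      have "p\<^sup>2 \<le> q\<^sup>2" using pq by (intro power_mono) auto
      then have "y\<^sup>2 * p\<^sup>2 \<le> y\<^sup>2 * q\<^sup>2" by (intro mult_left_mono) auto
      then show "(q\<^sup>2 + y\<^sup>2) * p\<^sup>2 \<le> (p\<^sup>2 + y\<^sup>2) * q\<^sup>2" by (simp add: algebra_simps)
    qed
    also have "\<dots> = sqrt (p\<^sup>2 + y\<^sup>2) * q" using pq by (simp add: real_sqrt_mult)
    finally show "norm (Complex (x' + real i) y) * (x + real i) \<le> norm (Complex (x + real i) y) * (x' + real i)"
      by (simp add: cmod_def p_def q_def)
    show "0 \<le> norm (Complex (x' + real i) y) * (x + real i)" using assms by simp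
  qed
  have nz: "norm (pochhammer (Complex c y) (n+1)) > 0" if "c > 0" for c
  proof -
    have "Complex (c + real i) y \<noteq> 0" for i using that by (auto simp: complex_eq_iff)
    then show ?thesis unfolding npoch by (intro prod_pos) auto
  qed
  define E E' where "E = exp (x * ln (real n))" and "E' = exp (x' * ln (real n))"
  have "norm (Gamma_series (Complex x y) n) * Gamma_series x' n =
      (fact n)^2 * E * E' * (1 / (norm (pochhammer (Complex x y) (n+1)) * pochhammer x' (n+1)))"
    unfolding Gamma_series_def norm_divide norm_mult nexp E_def E'_def
    by (simp add: power2_eq_square)
  also have "\<dots> \<le> (fact n)^2 * E * E' * (1 / (norm (pochhammer (Complex x' y) (n+1)) * pochhammer x (n+1)))"
    using key nz[of x'] pos[of x] nz[of x] pos[of x'] assms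
    by (intro mult_left_mono divide_left_mono) (auto simp: E_def E'_def)
  also have "\<dots> = norm (Gamma_series (Complex x' y) n) * Gamma_series x n"
    unfolding Gamma_series_def norm_divide norm_mult nexp E_def E'_def
    by (simp add: power2_eq_square)
  finally show ?thesis .
qed

text \<open>Carries a decay estimate from one vertical line to all lines to its left with positive
  abscissa.\<close>

lemma norm_Gamma_ratio_le:
  assumes "0 < x" "x \<le> x'"
  shows "norm (Gamma (Complex x y)) * Gamma x' \<le> norm (Gamma (Complex x' y)) * Gamma x"
proof (rule LIMSEQ_le)
  show "(\<lambda>n. norm (Gamma_series (Complex x y) n) * Gamma_series x' n) \<longlonglongrightarrow> norm (Gamma (Complex x y)) * Gamma x'"
    by (intro tendsto_intros)
  show "(\<lambda>n. norm (Gamma_series (Complex x' y) n) * Gamma_series x n) \<longlonglongrightarrow> norm (Gamma (Complex x' y)) * Gamma x"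
    by (intro tendsto_intros)
  show "\<exists>N. \<forall>n\<ge>N. norm (Gamma_series (Complex x y) n) * Gamma_series x' n \<le> norm (Gamma_series (Complex x' y) n) * Gamma_series x n"
    using norm_Gamma_series_ratio_le[OF assms] by auto
qed

text \<open>From 4 |sin z|^2 = exp (2 Im z) + exp (- 2 Im z) - 2 cos (2 Re z) and cos \<le>
  1.\<close>

lemma norm_sin_ge_sinh: "norm (sin z) \<ge> sinh \<bar>Im z\<bar>"
proof (rule power2_le_imp_le)
  have "sinh \<bar>Im z\<bar> ^ 2 = (exp (2 * Im z) + inverse (exp (2 * Im z)) - 2) / 4"
  proof -
    define e where "e = exp (Im z)"
    have e: "e > 0" by (simp add: e_def)
    have "sinh \<bar>Im z\<bar> ^ 2 = ((e - inverse e) / 2)\<^sup>2"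
      by (cases "Im z \<ge> 0") (auto simp: sinh_def e_def exp_minus power2_commute power_divide)
    also have "\<dots> = (e\<^sup>2 + inverse (e\<^sup>2) - 2) / 4"
      using e by (simp add: field_simps power2_eq_square)
    also have "e\<^sup>2 = exp (2 * Im z)" by (simp add: e_def exp_double)
    finally show ?thesis .
  qed
  also have "\<dots> \<le> norm (sin z) ^ 2"
    unfolding norm_sin_squared by (intro divide_right_mono add_mono diff_left_mono) auto
  finally show "(sinh \<bar>Im z\<bar>)\<^sup>2 \<le> (norm (sin z))\<^sup>2" .
qed simp

lemma norm_cos_ge_sinh: "norm (cos z) \<ge> sinh \<bar>Im z\<bar>"
  using norm_sin_ge_sinh[of "pi / 2 - z"] by (simp add: sin_diff)

lemma norm_cos_le_exp_Im: "norm (cos z) \<le> exp \<bar>Im z\<bar>"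
proof -
  have "norm (cos z) \<le> (exp (- Im z) + exp (Im z)) / 2"
    unfolding cos_exp_eq using norm_triangle_ineq[of "exp (\<i> * z)" "exp (- (\<i> * z))"]
    by (simp add: norm_divide)
  also have "\<dots> \<le> (exp \<bar>Im z\<bar> + exp \<bar>Im z\<bar>) / 2"
    by (intro divide_right_mono add_mono) auto
  finally show ?thesis by simp
qed

lemma sinh_ge_exp_quarter:
  assumes "t \<ge> (1::real)" shows "sinh t \<ge> exp t / 4"
proof -
  have "exp (-t) \<le> exp t / 2"
  proof -
    have "2 \<le> exp (t + t)" using exp_ge_add_one_self[of "t+t"] assms by linarith
    then have "2 * exp (-t) \<le> exp (t + t) * exp (-t)" by (intro mult_right_mono) auto
    also have "\<dots> = exp t" by (simp flip: exp_add)
    finally show ?thesis by simp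
  qed
  then show ?thesis by (simp add: sinh_def)
qed

lemma exp_growth_cos_half_pi: "exp_growth a b (pi / 2) (\<lambda>z. cos (of_real pi * z / 2))"
proof (rule exp_growth_bounded)
  fix z :: complex
  show "norm (cos (of_real pi * z / 2)) \<le> 1 * exp (pi / 2 * \<bar>Im z\<bar>)"
    using norm_cos_le_exp_Im[of "of_real pi * z / 2"] by (simp add: abs_mult)
qed

lemma exp_growth_inverse_cos_half_pi: "exp_growth a b (- (pi / 2)) (\<lambda>z. 1 / cos (of_real pi * z / 2))"
proof (rule exp_growth_bounded)
  fix z :: complex assume "1 \<le> \<bar>Im z\<bar>"
  then have "pi / 2 * \<bar>Im z\<bar> \<ge> 1 * 1" using pi_ge_two by (intro mult_mono) auto
  then have "exp (pi / 2 * \<bar>Im z\<bar>) / 4 \<le> sinh (pi / 2 * \<bar>Im z\<bar>)" by (intro sinh_ge_exp_quarter) auto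
  also have "\<dots> \<le> norm (cos (of_real pi * z / 2))"
    using norm_cos_ge_sinh[of "of_real pi * z / 2"] by (simp add: abs_mult)
  finally have "1 / norm (cos (of_real pi * z / 2)) \<le> 1 / (exp (pi / 2 * \<bar>Im z\<bar>) / 4)"
    by (intro divide_left_mono mult_pos_pos) (auto intro: less_le_trans[rotated])
  then show "norm (1 / cos (of_real pi * z / 2)) \<le> 4 * exp (- (pi / 2) * \<bar>Im z\<bar>)"
    by (simp add: norm_divide exp_minus field_simps)
qed

text \<open>Gamma z = Gamma (z + 1) / z, and the division only shrinks the norm because |z| is at
  least |Im z|, hence at least 1.\<close>

lemma exp_growth_Gamma_shift:
  assumes "exp_growth (a + 1) (b + 1) r Gamma"
  shows "exp_growth a b r Gamma"
proof (rule exp_growth_mono_norm)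
  show "exp_growth a b r (\<lambda>z. Gamma (of_real 1 + z))"
    using exp_growth_shift[OF assms, of 1] by simp
  fix z :: complex assume z: "1 \<le> \<bar>Im z\<bar>"
  then have "z \<notin> \<int>\<^sub>\<le>\<^sub>0" by (auto elim!: nonpos_Ints_cases)
  then have "Gamma (of_real 1 + z) = z * Gamma z" using Gamma_plus1[of z] by (simp add: add.commute)
  moreover have "1 \<le> norm z" using z abs_Im_le_cmod[of z] by linarith
  then have "1 * norm (Gamma z) \<le> norm z * norm (Gamma z)" by (intro mult_right_mono) auto
  ultimately show "norm (Gamma z) \<le> norm (Gamma (of_real 1 + z))" by (simp add: norm_mult)
qed

text \<open>On Re z = 1/2 the reflected point 1 - z is the conjugate of z, so the reflection formula
  gives |Gamma z|^2 exactly, as pi / sin (pi z). This is the only place where the rate -pi/2 of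
  Gamma is computed.\<close>

lemma norm_Gamma_half:
  assumes "Re z = 1 / 2" "1 \<le> \<bar>Im z\<bar>"
  shows "norm (Gamma z) \<le> sqrt (4 * pi) * exp (- (pi / 2) * \<bar>Im z\<bar>)"
proof (rule power2_le_imp_le)
  have "1 - z = cnj z" using assms by (auto simp: complex_eq_iff)
  then have "Gamma z * cnj (Gamma z) = of_real pi / sin (of_real pi * z)"
    using Gamma_reflection_complex[of z] by (simp add: cnj_Gamma)
  then have "complex_of_real (norm (Gamma z) ^ 2) = of_real pi / sin (of_real pi * z)"
    by (simp only: complex_norm_square)
  then have "norm (complex_of_real (norm (Gamma z) ^ 2)) = pi / norm (sin (of_real pi * z))"
    by (simp add: norm_divide)
  then have "norm (Gamma z) ^ 2 = pi / norm (sin (of_real pi * z))" by (simp only: norm_of_real) simp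
  also have "\<dots> \<le> pi / (exp (pi * \<bar>Im z\<bar>) / 4)"
  proof -
    have "pi * \<bar>Im z\<bar> \<ge> 1 * 1" using assms pi_ge_two by (intro mult_mono) auto
    then have "exp (pi * \<bar>Im z\<bar>) / 4 \<le> sinh (pi * \<bar>Im z\<bar>)" by (intro sinh_ge_exp_quarter) auto
    also have "\<dots> \<le> norm (sin (of_real pi * z))"
      using norm_sin_ge_sinh[of "of_real pi * z"] by (simp add: abs_mult)
    finally show ?thesis by (intro divide_left_mono mult_pos_pos) (auto intro: less_le_trans[rotated])
  qed
  also have "\<dots> = (sqrt (4 * pi) * exp (- (pi / 2) * \<bar>Im z\<bar>))\<^sup>2"
    by (simp add: power_mult_distrib exp_minus field_simps flip: exp_of_nat_mult)
  finally show "(norm (Gamma z))\<^sup>2 \<le> (sqrt (4 * pi) * exp (- (pi / 2) * \<bar>Im z\<bar>))\<^sup>2" .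
qed simp

lemma exp_growth_Gamma_half_plus_nat: "exp_growth (1/2 + real n) (1/2 + real n) (- (pi / 2)) Gamma"
proof (induction n)
  case (Suc n)
  have "exp_growth (1/2 + real n) (1/2 + real n) (0 + - (pi / 2)) (\<lambda>z. z * Gamma z)"
    by (intro exp_growth_mult exp_growth_ident Suc)
  then have "exp_growth (1/2 + real n) (1/2 + real n) (- (pi / 2)) (\<lambda>z. Gamma (z + 1))"
  proof (rule exp_growth_mono_norm[OF back_subst[where P = "\<lambda>r. exp_growth _ _ r _"]])
    fix z :: complex assume z: "1 \<le> \<bar>Im z\<bar>"
    then have "z \<notin> \<int>\<^sub>\<le>\<^sub>0" by (auto elim!: nonpos_Ints_cases)
    then show "norm (Gamma (z + 1)) \<le> norm (z * Gamma z)" by (simp add: Gamma_plus1)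
  qed simp
  from exp_growth_shift[OF this, of "-1"] show ?case by (simp add: add_ac)
qed (rule exp_growth_bounded, use norm_Gamma_half in force)

text \<open>The rate known at abscissa 1/2 travels right in unit steps (each costs a factor of rate
  0), then left over all positive abscissas by the ratio bound, and finally past the imaginary axis
  by \<open>exp_growth_Gamma_shift\<close>.\<close>

lemma exp_growth_Gamma: "exp_growth a b (- (pi / 2)) Gamma"
proof -
  have pos: "exp_growth c d (- (pi / 2)) Gamma" if c: "c > 0" for c d
  proof -
    \<comment> \<open>The comparison line must lie to the right of the whole strip, as the ratio
      bound works leftwards.\<close>
    obtain n :: nat where n: "real n \<ge> d" using real_arch_simple by blast
    define x' where "x' = 1/2 + real n"
    have x': "x' > 0" "d \<le> x'" using n by (auto simp: x'_def)
    have "compact (Gamma ` {c..d})" 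
      by (intro compact_continuous_image continuous_intros) (use c in \<open>auto elim!: nonpos_Ints_cases\<close>)
    then obtain D where D: "\<And>x. x \<in> {c..d} \<Longrightarrow> norm (Gamma x) \<le> D"
      by (meson compact_imp_bounded bounded_iff imageI)
    show ?thesis
    proof (rule exp_growthI, goal_cases)
      case e: (1 \<epsilon>)
      from exp_growthE[OF exp_growth_Gamma_half_plus_nat[of n] e] obtain C where C: "C \<ge> 0"
        "\<And>z. x' \<le> Re z \<Longrightarrow> Re z \<le> x' \<Longrightarrow> 1 \<le> \<bar>Im z\<bar> \<Longrightarrow>
           norm (Gamma z) \<le> C * exp ((- (pi / 2) + \<epsilon>) * \<bar>Im z\<bar>)" unfolding x'_def by blast
      have "norm (Gamma z) \<le> (C * D / Gamma x') * exp ((- (pi / 2) + \<epsilon>) * \<bar>Im z\<bar>)"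
        if z: "c \<le> Re z" "Re z \<le> d" "1 \<le> \<bar>Im z\<bar>" for z
      proof -
        have G: "Gamma x' > 0" using x' by (intro Gamma_real_pos)
        have "norm (Gamma (Complex (Re z) (Im z))) * Gamma x' \<le> norm (Gamma (Complex x' (Im z))) * Gamma (Re z)"
          using z c x' by (intro norm_Gamma_ratio_le) auto
        also have "\<dots> \<le> (C * exp ((- (pi / 2) + \<epsilon>) * \<bar>Im z\<bar>)) * D"
          using C(2)[of "Complex x' (Im z)"] C(1) z D[of "Re z"] c
          by (intro mult_mono) (auto intro: order_trans[OF abs_ge_self] less_imp_le[OF Gamma_real_pos])
        finally show ?thesis using G by (simp add: field_simps)
      qed
      then show ?case by blast
    qed
  qed
  have shifted: "exp_growth (a + real n) (b + real n) (- (pi / 2)) Gamma \<Longrightarrow> exp_growth a b (- (pi / 2)) Gamma" for n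
  proof (induction n)
    case (Suc n)
    have "exp_growth (a + real n) (b + real n) (- (pi / 2)) Gamma"
      by (rule exp_growth_Gamma_shift) (use Suc.prems in \<open>simp add: add_ac\<close>)
    then show ?case by (rule Suc.IH)
  qed simp
  obtain n :: nat where n: "real n > - a" using reals_Archimedean2 by blast
  show ?thesis by (rule shifted[of n], rule pos) (use n in simp)
qed

lemma exp_growth_powr:
  assumes "x > 0"
  shows "exp_growth a b 0 (\<lambda>z. of_real x powr (- z))"
proof (rule exp_growth_bounded)
  fix z :: complex assume z: "a \<le> Re z" "Re z \<le> b"
  have "norm (of_real x powr (- z)) = exp (- Re z * ln x)"
    using assms by (simp add: norm_powr_real_powr powr_def)
  also have "\<dots> \<le> exp (\<bar>Re z\<bar> * \<bar>ln x\<bar>)"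
    using abs_ge_self[of "- Re z * ln x"] by (simp add: abs_mult)
  also have "\<dots> \<le> exp ((\<bar>a\<bar> + \<bar>b\<bar>) * \<bar>ln x\<bar>)"
    using z by (simp add: mult_right_mono)
  finally show "norm (of_real x powr (- z)) \<le> exp ((\<bar>a\<bar> + \<bar>b\<bar>) * \<bar>ln x\<bar>) * exp (0 * \<bar>Im z\<bar>)"
    by simp
qed

section \<open>The zeta function and its functional equation\<close>

text \<open>The error of the trapezoid rule for the integral of \<open>x powr (-s)\<close> over \<open>[n, n + 1]\<close>; with
  \<open>0 powr z = 0\<close> the term \<open>n = 0\<close> is \<open>1/2 + 1/(s - 1)\<close>.\<close>

definition zeta_term :: "nat \<Rightarrow> complex \<Rightarrow> complex" where
  "zeta_term n s = (of_nat n powr (- s) + of_nat (Suc n) powr (- s)) / 2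
     - (of_nat (Suc n) powr (1 - s) - of_nat n powr (1 - s)) / (1 - s)"

text \<open>The continuation of the Dirichlet series to the half-plane \<open>Re s > -1\<close>
  without 1, where it coincides with \<open>zeta\<close>.\<close>

definition zeta_half :: "complex \<Rightarrow> complex" where
  "zeta_half s = (\<Sum>n. zeta_term n s)"

lemma zeta_term_0: "s \<noteq> 1 \<Longrightarrow> zeta_term 0 s = 1 / 2 + 1 / (s - 1)"
  by (simp add: zeta_term_def divide_simps) (simp add: algebra_simps)

text \<open>The trapezoid error is controlled by the second derivative s (s + 1) x^(-s-2) of x^(-s);
  for \<open>Re s \<ge> -2\<close> its norm is largest at the left end. The index starts at 1
  because that derivative is singular at 0.\<close>

lemma norm_zeta_term_Suc_le:
  assumes "s \<noteq> 1" "Re s \<ge> -2"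
  shows "norm (zeta_term (Suc n) s) \<le> norm s * norm (s + 1) * real (Suc n) powr (- Re s - 2)"
proof -
  define N where "N = Suc n"
  define S :: "complex set" where "S = closed_segment 0 1"
  define B where "B = norm s * norm (s + 1) * real N powr (- Re s - 2)"
  have N: "real N > 0" by (simp add: N_def)
  have S: "convex S" "0 \<in> S" "1 \<in> S" by (auto simp: S_def)
  have S_real: "\<exists>u\<in>{0..1}. z = complex_of_real u" if "z \<in> S" for z
  proof -
    from that obtain u where "0 \<le> u" "u \<le> 1" "z = of_real u" 
      by (auto simp: S_def closed_segment_def scaleR_conv_of_real)
    then show ?thesis by auto
  qed
  have ok: "of_nat N + z \<notin> \<real>\<^sub>\<le>\<^sub>0" if "z \<in> S" for z
    using S_real[OF that] N by (auto simp: complex_nonpos_Reals_iff)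
  have nS: "norm z \<le> 1" if "z \<in> S" for z using S_real[OF that] by auto
  \<comment> \<open>\<open>h z\<close> is the error on the interval from N to N + z and
    \<open>h1\<close> its derivative. Both vanish at 0 and the derivative of \<open>h1\<close> is
    z/2 times the second derivative, so two mean value estimates along the unit segment
    suffice.\<close>
  define h1 where "h1 = (\<lambda>z. (of_nat N powr (- s) - (of_nat N + z) powr (- s)) / 2 
      + z / 2 * (- s * (of_nat N + z) powr (- s - 1)))"
  define h where "h = (\<lambda>z. z / 2 * (of_nat N powr (- s) + (of_nat N + z) powr (- s)) -
       ((of_nat N + z) powr (1 - s) - of_nat N powr (1 - s)) / (1 - s))"
  have d1: "(h1 has_field_derivative z / 2 * (s * (s + 1) * (of_nat N + z) powr (- s - 2))) (at z within S)"
    if "z \<in> S" for z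
    unfolding h1_def using ok[OF that] 
    by (auto intro!: derivative_eq_intros simp: field_simps)
  have d0: "(h has_field_derivative h1 z) (at z within S)" if "z \<in> S" for z
    unfolding h_def h1_def using ok[OF that] assms(1)
    by (auto intro!: derivative_eq_intros simp: divide_simps) ((simp add: algebra_simps)+)?
  have B0: "B \<ge> 0" by (simp add: B_def)
  have bd1: "norm (z / 2 * (s * (s + 1) * (of_nat N + z) powr (- s - 2))) \<le> B" if z: "z \<in> S" for z
  proof -
    obtain u where u: "u \<in> {0..1}" "z = complex_of_real u" using S_real[OF z] by auto
    have eq: "of_nat N + z = complex_of_real (real N + u)" using u by simp
    have "norm ((of_nat N + z) powr (- s - 2)) = (real N + u) powr (- Re s - 2)"
      unfolding eq using u N by (subst norm_powr_real_powr) auto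
    also have "\<dots> \<le> real N powr (- Re s - 2)"
      using u N assms by (intro powr_mono2') auto
    finally have "norm (s * (s + 1) * (of_nat N + z) powr (- s - 2)) \<le> B"
      unfolding norm_mult B_def by (intro mult_left_mono) auto
    moreover have "norm (z / 2) \<le> 1" using nS[OF z] by (simp add: norm_divide)
    ultimately have "norm (z / 2) * norm (s * (s + 1) * (of_nat N + z) powr (- s - 2)) \<le> 1 * B"
      by (intro mult_mono) (use B0 in auto)
    then show ?thesis by (simp only: norm_mult mult_1)
  qed
  have bd0: "norm (h1 z) \<le> B" if z: "z \<in> S" for z
  proof -
    have "norm (h1 z - h1 0) \<le> B * norm (z - 0)"
      by (rule field_differentiable_bound[OF S(1) d1 bd1 z S(2)])
    also have "\<dots> \<le> B * 1" using nS[OF z] B0 by (intro mult_left_mono) auto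
    finally show ?thesis by (simp add: h1_def)
  qed
  have "norm (h 1 - h 0) \<le> B * norm (1 - 0 :: complex)"
    by (rule field_differentiable_bound[OF S(1) d0 bd0 S(3) S(2)])
  moreover have "h 1 - h 0 = zeta_term N s"
    by (simp add: h_def zeta_term_def add.commute)
  ultimately show ?thesis by (simp add: B_def N_def)
qed

lemma summable_Suc_powr: "x < -1 \<Longrightarrow> summable (\<lambda>n. real (Suc n) powr x)"
  using summable_Suc_iff[of "\<lambda>n. real n powr x"] summable_real_powr_iff[of x] by simp

lemma summable_zeta_term:
  assumes "Re s > -1" "s \<noteq> 1"
  shows "summable (\<lambda>n. zeta_term n s)"
proof -
  have "summable (\<lambda>n. norm s * norm (s + 1) * real (Suc n) powr (- Re s - 2))"
    by (intro summable_mult summable_Suc_powr) (use assms in auto)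
  then have "summable (\<lambda>n. zeta_term (Suc n) s)"
    by (rule summable_comparison_test'[where N = 0]) (use assms in \<open>intro norm_zeta_term_Suc_le; simp\<close>)
  then show ?thesis using summable_Suc_iff[of "\<lambda>n. zeta_term n s"] by blast
qed

lemma zeta_term_holomorphic: "1 \<notin> A \<Longrightarrow> zeta_term n holomorphic_on A"
  unfolding zeta_term_def by (cases n) (auto intro!: holomorphic_intros)

lemma zeta_half_holomorphic: "zeta_half holomorphic_on {s. Re s > -1} - {1}"
proof (rule holomorphic_uniform_sequence)
  have "{s. Re s > -1} - {1 :: complex} = {s. Re s > -1} \<inter> - {1}" by auto
  then show op: "open ({s. Re s > -1} - {1 :: complex})"
    by (auto intro!: open_Int open_halfspace_Re_gt)
  show "(\<lambda>s. \<Sum>n<N. zeta_term n s) holomorphic_on {s. Re s > -1} - {1}" for N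
    by (intro holomorphic_on_sum zeta_term_holomorphic) auto
  fix z :: complex assume z: "z \<in> {s. Re s > -1} - {1}"
  \<comment> \<open>Half the distance to the boundary line Re s = -1: on a disc with
    \<open>Re w > -1 + \<delta>\<close> the terms are dominated by multiples of
    \<open>real n powr (-1 - \<delta>)\<close>.\<close>
  define \<delta> where "\<delta> = (Re z + 1) / 2"
  have \<delta>: "\<delta> > 0" "Re z > -1 + \<delta>" using z by (auto simp: \<delta>_def field_simps)
  have "open ({s. Re s > -1 + \<delta>} - {1 :: complex})"
  proof -
    have "{s. Re s > -1 + \<delta>} - {1 :: complex} = {s. Re s > -1 + \<delta>} \<inter> - {1}" by auto
    then show ?thesis by (auto intro!: open_Int open_halfspace_Re_gt)
  qed
  then obtain d where d: "d > 0" "cball z d \<subseteq> {s. Re s > -1 + \<delta>} - {1}"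
    using z \<delta> unfolding open_contains_cball by (elim ballE[of _ _ z]) auto
  define M where "M = norm z + d"
  have M0: "M \<ge> 0" using d by (simp add: M_def)
  have M: "norm w \<le> M" if "w \<in> cball z d" for w
    using that norm_triangle_ineq2[of w z] by (simp add: M_def dist_norm norm_minus_commute)
  have "uniform_limit (cball z d) (\<lambda>N s. \<Sum>n<N. zeta_term n s) (\<lambda>s. \<Sum>n. zeta_term n s) sequentially"
  proof (rule Weierstrass_m_test_ev)
    show "\<forall>\<^sub>F n in sequentially. \<forall>x\<in>cball z d. norm (zeta_term n x) \<le> M * (M + 1) * real n powr (-1 - \<delta>)"
      using eventually_gt_at_top[of 0]
    proof eventually_elim
      case (elim n)
      show ?case
      proof
        fix w assume w: "w \<in> cball z d"
        then have w': "Re w > -1 + \<delta>" "w \<noteq> 1" using d by auto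
        obtain m where m: "n = Suc m" using elim by (cases n) auto
        have "norm (zeta_term n w) \<le> norm w * norm (w + 1) * real n powr (- Re w - 2)"
          unfolding m by (rule norm_zeta_term_Suc_le) (use w' \<delta> in auto)
        also have "\<dots> \<le> M * (M + 1) * real n powr (-1 - \<delta>)"
          using M[OF w] M0 norm_triangle_ineq[of w 1] w' elim
          by (intro mult_mono powr_mono) auto
        finally show "norm (zeta_term n w) \<le> M * (M + 1) * real n powr (-1 - \<delta>)" .
      qed
    qed
    show "summable (\<lambda>n. M * (M + 1) * real n powr (-1 - \<delta>))"
      using \<delta> by (intro summable_mult) (auto simp: summable_real_powr_iff)
  qed
  then show "\<exists>d>0. cball z d \<subseteq> {s. - 1 < Re s} - {1} \<and>
     uniform_limit (cball z d) (\<lambda>N s. \<Sum>n<N. zeta_term n s) zeta_half sequentially"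
    using d \<delta> by (intro exI[of _ d]) (auto simp: zeta_half_def[abs_def] subset_iff)
qed

lemma sums_zeta_half:
  assumes "Re s > 1"
  shows "(\<lambda>n. 1 / of_nat (Suc n) powr s) sums zeta_half s"
proof -
  have s1: "s \<noteq> 1" using assms by auto
  \<comment> \<open>Trapezoid terms telescope to the partial sum up to two boundary terms, which
    tend to 0 for Re s > 1. The start N = 0 is correct because \<open>0 powr z = 0\<close>.\<close>
  have tele: "(\<Sum>n<N. zeta_term n s) + of_nat N powr (- s) / 2 + of_nat N powr (1 - s) / (1 - s) =
     (\<Sum>n<N. 1 / of_nat (Suc n) powr s)" for N
  proof (induction N)
    case (Suc N)
    have "(\<Sum>n<Suc N. zeta_term n s) + of_nat (Suc N) powr (- s) / 2 + of_nat (Suc N) powr (1 - s) / (1 - s) =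
      ((\<Sum>n<N. zeta_term n s) + of_nat N powr (- s) / 2 + of_nat N powr (1 - s) / (1 - s)) + of_nat (Suc N) powr (- s)"
      unfolding sum.lessThan_Suc zeta_term_def add_divide_distrib diff_divide_distrib by (simp del: of_nat_Suc)
    also have "\<dots> = (\<Sum>n<Suc N. 1 / of_nat (Suc n) powr s)"
      unfolding Suc.IH sum.lessThan_Suc by (simp only: powr_minus_divide)
    finally show ?case .
  qed simp
  have lim: "(\<lambda>n. complex_of_real (real n) powr w) \<longlonglongrightarrow> 0" if "Re w < 0" for w
  proof (rule tendsto_norm_zero_cancel)
    have "((\<lambda>x. x powr Re w) \<longlongrightarrow> 0) at_top" using that by (rule tendsto_neg_powr) (rule filterlim_ident)
    then have "(\<lambda>n. real n powr Re w) \<longlonglongrightarrow> 0" by (rule filterlim_compose) (rule filterlim_real_sequentially)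
    then show "(\<lambda>n. norm (complex_of_real (real n) powr w)) \<longlonglongrightarrow> 0" by (simp add: norm_powr_real_powr)
  qed
  have "(\<lambda>N. (\<Sum>n<N. zeta_term n s) + of_nat N powr (- s) / 2 + of_nat N powr (1 - s) / (1 - s)) \<longlonglongrightarrow>
     zeta_half s + 0 / 2 + 0 / (1 - s)"
    unfolding zeta_half_def using lim[of "-s"] lim[of "1-s"] assms s1
    by (intro tendsto_intros summable_LIMSEQ summable_zeta_term) auto
  then show ?thesis unfolding sums_def tele by simp
qed

text \<open>For Re s \<ge> -1/2 the errors from n = 1 on add up to at most |s| |s + 1| times the sum
  of n^(-3/2), which is polynomial. The constant 2 covers the term n = 0, as |s - 1| \<ge>
  1.\<close>

lemma exp_growth_zeta_half: "exp_growth (-1/2) b 0 zeta_half"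
proof -
  define C where "C = (\<Sum>n. real (Suc n) powr (-3/2))"
  have sC: "summable (\<lambda>n. real (Suc n) powr (-3/2))" by (intro summable_Suc_powr) auto
  have "exp_growth (-1/2) b 0 (\<lambda>s. of_real (2 + C * (norm s * norm (s + 1))))"
  proof -
    have g: "exp_growth (-1/2) b 0 (\<lambda>s. of_real C * (of_real (norm s) * of_real (norm (s + 1))))"
      using exp_growth_mult[OF exp_growth_const[of _ _ "of_real C"]
       exp_growth_mult[OF exp_growth_mono_norm[OF exp_growth_ident, of _ _ "\<lambda>z. of_real (norm z)"] 
       exp_growth_mono_norm[OF exp_growth_add[OF exp_growth_ident exp_growth_const[of _ _ 1]], of _ _ "\<lambda>z. of_real (norm (z + 1))"]], simplified]
      by simp
    from exp_growth_add[OF exp_growth_const[of _ _ 2] this] show ?thesis by simp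
  qed
  then show ?thesis
  proof (rule exp_growth_mono_norm)
    fix s :: complex assume s: "-1/2 \<le> Re s" "1 \<le> \<bar>Im s\<bar>"
    have s1: "s \<noteq> 1" using s by auto
    have b: "norm (zeta_term (Suc n) s) \<le> norm s * norm (s + 1) * real (Suc n) powr (-3/2)" for n
    proof (rule order_trans[OF norm_zeta_term_Suc_le])
      show "norm s * norm (s + 1) * real (Suc n) powr (- Re s - 2) \<le> norm s * norm (s + 1) * real (Suc n) powr (-3/2)"
      proof (intro mult_left_mono powr_mono)
        show "- Re s - 2 \<le> - 3 / 2" using s(1) by (simp add: field_simps)
      qed auto
    qed (use s s1 in auto)
    have sm: "summable (\<lambda>n. norm (zeta_term (Suc n) s))"
      by (rule summable_comparison_test'[OF summable_mult[OF sC], where N = 0]) (use b in auto)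
    have "zeta_half s = zeta_term 0 s + (\<Sum>n. zeta_term (Suc n) s)"
      unfolding zeta_half_def using s s1 suminf_split_head[OF summable_zeta_term[of s]] by simp
    then have "norm (zeta_half s) \<le> norm (zeta_term 0 s) + norm (\<Sum>n. zeta_term (Suc n) s)"
      by (simp add: norm_triangle_ineq)
    also have "norm (\<Sum>n. zeta_term (Suc n) s) \<le> (\<Sum>n. norm (zeta_term (Suc n) s))"
      by (rule summable_norm[OF sm])
    also have "\<dots> \<le> (\<Sum>n. norm s * norm (s + 1) * real (Suc n) powr (-3/2))"
      by (intro suminf_le b sm summable_mult sC)
    also have "\<dots> = C * (norm s * norm (s + 1))"
      unfolding C_def by (subst suminf_mult[OF sC]) simp
    also have "norm (zeta_term 0 s) \<le> 2"
    proof -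
      have "1 \<le> norm (s - 1)" using s abs_Im_le_cmod[of "s - 1"] by simp
      then have "norm (1 / (s - 1)) \<le> 1" by (auto simp: norm_divide divide_le_eq)
      then show ?thesis unfolding zeta_term_0[OF s1]
        using norm_triangle_ineq[of "1/2" "1/(s-1)"] by simp
    qed
    finally have "norm (zeta_half s) \<le> 2 + C * (norm s * norm (s + 1))" by simp
    then show "norm (zeta_half s) \<le> norm (complex_of_real (2 + C * (norm s * norm (s + 1))))"
      by (simp only: norm_of_real abs_ge_self order_trans[OF _ abs_ge_self])
  qed
qed

text \<open>The trapezoid rule is exact for the constant function, so only the term n = 0 survives,
  with value 1/2 - 1.\<close>

lemma zeta_half_0: "zeta_half 0 = -1/2"
proof -
  have "zeta_term (Suc n) 0 = 0" for n
  proof -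
    have "of_nat (Suc n) \<noteq> (0 :: complex)" "of_nat (Suc (Suc n)) \<noteq> (0 :: complex)"
      by (simp_all del: of_nat_Suc)
    then show ?thesis by (simp add: zeta_term_def)
  qed
  then have "zeta_term n 0 = 0" if "n \<notin> {0}" for n using that by (cases n) auto
  then have "zeta_half 0 = sum (\<lambda>n. zeta_term n 0) {0}"
    unfolding zeta_half_def by (intro suminf_finite) auto
  then show ?thesis by (simp add: zeta_term_0)
qed

section \<open>Partial fractions of cot and coth\<close>

text \<open>Logarithmic derivative of the reflection formula of Gamma. The series of the two Digamma
  values then subtract to the partial fractions of cot.\<close>

lemma Digamma_reflection_complex:
  fixes z :: complex
  assumes "z \<notin> \<int>"
  shows "Digamma (1 - z) - Digamma z = of_real pi * cot (of_real pi * z)"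
proof -
  have z: "z \<notin> \<int>\<^sub>\<le>\<^sub>0" "1 - z \<notin> \<int>\<^sub>\<le>\<^sub>0"
    using assms nonpos_Ints_subset_Ints Ints_diff[OF Ints_1, of "1 - z"] by auto
  have s: "sin (of_real pi * z) \<noteq> 0"
    using assms by (auto simp: sin_eq_0 mult.commute)
  have "((\<lambda>w. Gamma w * Gamma (1 - w)) has_field_derivative
      Gamma z * Gamma (1 - z) * (Digamma z - Digamma (1 - z))) (at z)"
    using z by (auto intro!: derivative_eq_intros simp: algebra_simps)
  moreover have "((\<lambda>w. of_real pi / sin (of_real pi * w)) has_field_derivative
      - (of_real pi * (of_real pi * cos (of_real pi * z))) / (sin (of_real pi * z))\<^sup>2) (at z)"
    using s by (auto intro!: derivative_eq_intros simp: power2_eq_square)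
  ultimately have eq: "Gamma z * Gamma (1 - z) * (Digamma z - Digamma (1 - z)) =
      - (of_real pi * (of_real pi * cos (of_real pi * z))) / (sin (of_real pi * z))\<^sup>2"
    unfolding Gamma_reflection_complex by (rule DERIV_unique)
  have "Digamma (1 - z) - Digamma z =
      - (sin (of_real pi * z) / of_real pi) * (of_real pi / sin (of_real pi * z) * (Digamma z - Digamma (1 - z)))"
    using s by simp
  also have "\<dots> = - (sin (of_real pi * z) / of_real pi) *
      (- (of_real pi * (of_real pi * cos (of_real pi * z))) / (sin (of_real pi * z))\<^sup>2)"
    using eq unfolding Gamma_reflection_complex by (simp only:)
  also have "\<dots> = of_real pi * cot (of_real pi * z)"
    using s by (simp add: cot_def power2_eq_square)
  finally show ?thesis .
qed

lemma cot_partial_fractions: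
  fixes z :: complex
  assumes "z \<notin> \<int>"
  shows "(\<lambda>n. 1 / (of_nat (Suc n) + z) - 1 / (of_nat (Suc n) - z)) sums
     (of_real pi * cot (of_real pi * z) - 1 / z)"
proof -
  have z: "z \<noteq> 0" "1 + z \<noteq> 0" "1 - z \<noteq> 0" 
    using assms Ints_minus[OF Ints_1] by (auto simp: add_eq_0_iff)
  have "(\<lambda>n. (inverse (of_nat (Suc n)) - inverse ((1 - z) + of_nat n)) - (inverse (of_nat (Suc n)) - inverse ((1 + z) + of_nat n)))
     sums ((\<Sum>n. inverse (of_nat (Suc n)) - inverse ((1 - z) + of_nat n)) - (\<Sum>n. inverse (of_nat (Suc n)) - inverse ((1 + z) + of_nat n)))"
    by (intro sums_diff summable_sums summable_Digamma z)
  also have "((\<Sum>n. inverse (of_nat (Suc n)) - inverse ((1 - z) + of_nat n)) - (\<Sum>n. inverse (of_nat (Suc n)) - inverse ((1 + z) + of_nat n)))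
     = Digamma (1 - z) - Digamma (z + 1)"
    by (simp add: Digamma_def add.commute)
  also have "\<dots> = of_real pi * cot (of_real pi * z) - 1 / z"
    using Digamma_plus1[OF z(1)] Digamma_reflection_complex[OF assms] by (simp add: algebra_simps)
  finally show ?thesis by (simp add: inverse_eq_divide algebra_simps)
qed

lemma cot_ii_half:
  fixes x :: complex
  assumes "exp x \<noteq> 1"
  shows "cot (\<i> * x / 2) = - \<i> * ((1 + exp (-x)) / (1 - exp (-x)))"
proof -
  define E where "E = exp (x / 2)"
  have E: "E \<noteq> 0" "exp x = E * E" by (auto simp: E_def simp flip: exp_add)
  have e: "exp (\<i> * (\<i> * x / 2)) = 1 / E" "exp (- (\<i> * (\<i> * x / 2))) = E" "exp (-x) = 1 / (E * E)"
    using E(2) by (auto simp: E_def exp_minus inverse_eq_divide simp flip: mult.assoc)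
  have "E * E \<noteq> 1" using assms E by simp
  then show ?thesis
    unfolding cot_def sin_exp_eq cos_exp_eq e using E(1) by (simp add: divide_simps) (auto simp: algebra_simps)
qed

lemma coth_partial_fractions_complex:
  fixes x :: complex
  assumes "\<i> * x / (2 * of_real pi) \<notin> \<int>"
  shows "(\<lambda>n. 2 * x / (x\<^sup>2 + (2 * of_real pi * of_nat (Suc n))\<^sup>2)) sums
     ((1 + exp (-x)) / (2 * (1 - exp (-x))) - 1 / x)"
proof -
  \<comment> \<open>Quarter turn from cot to coth: pi z = i x / 2. The hypothesis says that
    \<open>x\<close> is not one of the points 2 pi i n.\<close>
  define z where "z = \<i> * x / (2 * of_real pi)"
  have x: "x \<noteq> 0" using assms by auto
  have "exp x \<noteq> 1"
  proof
    assume "exp x = 1"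
    then obtain n :: int where "Re x = 0" "Im x = of_int (2 * n) * pi" by (auto simp: exp_eq_1)
    then have "x = \<i> * of_int (2 * n) * of_real pi" by (auto simp: complex_eq_iff)
    then have "\<i> * x / (2 * of_real pi) = of_int (- n)" by (simp add: field_simps)
    then show False using assms by (metis Ints_of_int)
  qed
  have trm: "\<i> / (2 * of_real pi) * (1 / (of_nat (Suc n) + z) - 1 / (of_nat (Suc n) - z)) =
     2 * x / (x\<^sup>2 + (2 * of_real pi * of_nat (Suc n))\<^sup>2)" for n
  proof -
    define N where "N = complex_of_nat (Suc n)"
    have nz: "N + z \<noteq> 0" "N - z \<noteq> 0"
      using assms[folded z_def] Ints_minus[of z] by (auto simp: N_def add_eq_0_iff2 simp del: of_nat_Suc)
        (metis Ints_of_nat minus_minus Ints_minus)+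
    have "1 / (N + z) - 1 / (N - z) = - 2 * z / ((N + z) * (N - z))"
      using nz by (simp add: field_simps)
    also have "(N + z) * (N - z) = (x\<^sup>2 + (2 * of_real pi * N)\<^sup>2) / (2 * of_real pi)\<^sup>2"
      by (simp add: z_def power2_eq_square field_simps)
    also have "\<i> / (2 * of_real pi) * (- 2 * z / ((x\<^sup>2 + (2 * of_real pi * N)\<^sup>2) / (2 * of_real pi)\<^sup>2))
      = 2 * x / (x\<^sup>2 + (2 * of_real pi * N)\<^sup>2)"
      by (simp add: z_def power2_eq_square field_simps)
    finally show ?thesis by (simp only: N_def)
  qed
  have "of_real pi * z = \<i> * x / 2" by (simp add: z_def)
  then have c: "cot (of_real pi * z) = - \<i> * ((1 + exp (-x)) / (1 - exp (-x)))"
    using cot_ii_half[OF \<open>exp x \<noteq> 1\<close>] by (simp only:)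
  have z1: "1 / z = - \<i> * (2 * of_real pi / x)" using x by (simp add: z_def field_simps)
  have alg: "\<i> / (2 * of_real pi) * (of_real pi * (- \<i> * R) - - \<i> * (2 * of_real pi / x)) = R / 2 - 1 / x" for R
    using x by (simp add: field_simps)
  have "\<i> / (2 * of_real pi) * (of_real pi * cot (of_real pi * z) - 1 / z) =
     (1 + exp (-x)) / (2 * (1 - exp (-x))) - 1 / x"
    unfolding c z1 alg by simp
  with sums_mult[OF cot_partial_fractions[OF assms[folded z_def]], of "\<i> / (2 * of_real pi)"] show ?thesis
    unfolding trm by (simp only:)
qed

lemma coth_partial_fractions:
  fixes x :: real
  assumes "x > 0"
  shows "(\<lambda>n. 2 * x / (x\<^sup>2 + (2 * pi * real (Suc n))\<^sup>2)) sums
     ((1 + exp (-x)) / (2 * (1 - exp (-x))) - 1 / x)"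
proof -
  have "\<i> * of_real x / (2 * of_real pi) = \<i> * complex_of_real (x / (2 * pi))" by simp
  then have "\<i> * of_real x / (2 * of_real pi) \<notin> (\<int> :: complex set)"
    using assms by (auto simp: complex_is_Int_iff)
  from coth_partial_fractions_complex[OF this]
  have "(\<lambda>n. complex_of_real (2 * x / (x\<^sup>2 + (2 * pi * real (Suc n))\<^sup>2))) sums
     of_real ((1 + exp (-x)) / (2 * (1 - exp (-x))) - 1 / x)"
    by (simp add: exp_of_real[symmetric] del: exp_of_real)
  then show ?thesis by (simp only: sums_of_real_iff)
qed

section \<open>Mellin integrals over the half-line\<close>

lemma nn_integral_powr_exp:
  assumes "r > 0" "c > (0::real)"
  shows "(\<integral>\<^sup>+x. ennreal (indicator {0..} x * (x powr (r - 1) * exp (- c * x))) \<partial>lborel) = ennreal (Gamma r / c powr r)"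
proof -
  let ?f = "\<lambda>x. indicator {0..} x * (x powr (r - 1) * exp (- c * x))"
  have "ennreal (Gamma r) = (\<integral>\<^sup>+t. ennreal (indicator {0..} t * t powr (r - 1) / exp t) \<partial>lborel)"
    by (rule Gamma_conv_nn_integral_real[OF assms(1)])
  also have "\<dots> = ennreal \<bar>c\<bar> * (\<integral>\<^sup>+x. ennreal (indicator {0..} (0 + c * x) * (0 + c * x) powr (r - 1) / exp (0 + c * x)) \<partial>lborel)"
    by (rule nn_integral_real_affine) (use assms in auto)
  also have "\<dots> = (\<integral>\<^sup>+x. ennreal c * ennreal (indicator {0..} (0 + c * x) * (0 + c * x) powr (r - 1) / exp (0 + c * x)) \<partial>lborel)"
    using assms by (subst nn_integral_cmult) auto
  also have "\<dots> = (\<integral>\<^sup>+x. ennreal (c powr r) * ennreal (?f x) \<partial>lborel)"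
  proof (intro nn_integral_cong)
    fix x :: real
    have "c * (c powr (r - 1)) = c powr r" using assms by (simp add: powr_diff)
    then show "ennreal c * ennreal (indicator {0..} (0 + c * x) * (0 + c * x) powr (r - 1) / exp (0 + c * x)) =
       ennreal (c powr r) * ennreal (?f x)"
      using assms by (auto simp: ennreal_mult[symmetric] indicator_def zero_le_mult_iff powr_mult exp_minus field_simps)
  qed
  also have "\<dots> = ennreal (c powr r) * (\<integral>\<^sup>+x. ennreal (?f x) \<partial>lborel)"
    by (rule nn_integral_cmult) auto
  finally have "ennreal (1 / c powr r) * ennreal (Gamma r) = ennreal (1 / c powr r) * (ennreal (c powr r) * (\<integral>\<^sup>+x. ennreal (?f x) \<partial>lborel))"
    by simp
  also have "\<dots> = ennreal (1 / c powr r * c powr r) * (\<integral>\<^sup>+x. ennreal (?f x) \<partial>lborel)"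
    by (subst ennreal_mult) (auto simp: mult.assoc)
  also have "1 / c powr r * c powr r = 1" using assms by simp
  finally show ?thesis using assms by (simp add: ennreal_mult[symmetric] Gamma_real_pos less_imp_le)
qed

text \<open>Write 1 / (y + c) as the integral of exp (- (y + c) t) over t > 0 and exchange the
  order; the two resulting Gamma integrals give the product. Nonnegative integrals make the exchange
  a pure Tonelli argument.\<close>

lemma nn_integral_powr_over_add:
  assumes "0 < b" "b < 1" "0 < (c::real)"
  shows "(\<integral>\<^sup>+y. ennreal (indicator {0..} y * (y powr (b - 1) / (y + c))) \<partial>lborel) =
    ennreal (Gamma b * Gamma (1 - b) * c powr (b - 1))"
proof -
  let ?K = "\<lambda>y t. indicator {0..} y * indicator {0..} t * (y powr (b - 1) * exp (- (y + c) * t))"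
  have "(\<integral>\<^sup>+y. ennreal (indicator {0..} y * (y powr (b - 1) / (y + c))) \<partial>lborel) =
    (\<integral>\<^sup>+y. (\<integral>\<^sup>+t. ennreal (?K y t) \<partial>lborel) \<partial>lborel)"
  proof (intro nn_integral_cong)
    fix y :: real
    show "ennreal (indicator {0..} y * (y powr (b - 1) / (y + c))) =
      (\<integral>\<^sup>+t. ennreal (?K y t) \<partial>lborel)"
    proof (cases "y \<ge> 0")
      case True
      have "(\<integral>\<^sup>+t. ennreal (?K y t) \<partial>lborel)
        = (\<integral>\<^sup>+t. ennreal (y powr (b - 1)) * ennreal (indicator {0..} t * (t powr (1 - 1) * exp (- (y + c) * t))) \<partial>lborel)"
      proof (intro nn_integral_cong_AE, use AE_lborel_singleton[of 0] in eventually_elim)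
        case (elim t)
        then show ?case using True by (auto simp: ennreal_mult[symmetric] indicator_def powr_def)
      qed
      also have "\<dots> = ennreal (y powr (b - 1)) * ennreal (Gamma 1 / (y + c) powr 1)"
        by (subst nn_integral_cmult, simp, subst nn_integral_powr_exp) (use True assms in auto)
      finally show ?thesis using True assms by (simp add: ennreal_mult[symmetric])
    qed simp
  qed
  also have "\<dots> = (\<integral>\<^sup>+t. (\<integral>\<^sup>+y. ennreal (?K y t) \<partial>lborel) \<partial>lborel)"
    by (rule lborel_pair.Fubini'[symmetric]) measurable
  also have "\<dots> = (\<integral>\<^sup>+t. ennreal (Gamma b) * ennreal (indicator {0..} t * (t powr (1 - b - 1) * exp (- c * t))) \<partial>lborel)"
  proof (intro nn_integral_cong_AE, use AE_lborel_singleton[of 0] in eventually_elim)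
    case (elim t)
    show ?case
    proof (cases "t > 0")
      case True
      have "(\<integral>\<^sup>+y. ennreal (?K y t) \<partial>lborel)
        = (\<integral>\<^sup>+y. ennreal (exp (- c * t)) * ennreal (indicator {0..} y * (y powr (b - 1) * exp (- t * y))) \<partial>lborel)"
        using True by (intro nn_integral_cong) (auto simp: ennreal_mult[symmetric] indicator_def algebra_simps exp_add exp_diff exp_minus field_simps)
      also have "\<dots> = ennreal (exp (- c * t)) * ennreal (Gamma b / t powr b)"
        by (subst nn_integral_cmult, simp, subst nn_integral_powr_exp) (use True assms in auto)
      finally show ?thesis using True assms
        by (simp add: ennreal_mult[symmetric] powr_minus field_simps Gamma_real_pos less_imp_le)
    qed (use elim in auto)
  qed
  also have "\<dots> = ennreal (Gamma b) * ennreal (Gamma (1 - b) / c powr (1 - b))"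
    by (subst nn_integral_cmult, simp, subst nn_integral_powr_exp) (use assms in auto)
  also have "\<dots> = ennreal (Gamma b * Gamma (1 - b) * c powr (b - 1))"
    using assms powr_minus_divide[of c "1 - b"] by (simp add: ennreal_mult[symmetric] Gamma_real_pos less_imp_le)
  finally show ?thesis .
qed

lemma Gamma_reflection_real: "Gamma b * Gamma (1 - b) = pi / sin (pi * b)" for b :: real
proof -
  have "complex_of_real (Gamma b * Gamma (1 - b)) = complex_of_real (pi / sin (pi * b))"
    using Gamma_reflection_complex[of "of_real b"]
    by (simp add: Gamma_complex_of_real[symmetric] sin_of_real[symmetric] del: sin_of_real)
  then show ?thesis by (simp only: of_real_eq_iff)
qed

lemma nn_integral_powr_over_square_add:
  assumes "-1 < s" "s < 1" "0 < (a::real)"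
  shows "(\<integral>\<^sup>+x. ennreal (indicator {0<..} x * (x powr (s - 1) * (2 * x / (x\<^sup>2 + a\<^sup>2)))) \<partial>lborel) =
    ennreal (pi / cos (pi * s / 2) * a powr (s - 1))"
proof -
  let ?p = "\<lambda>x. x powr (s - 1) * (2 * x / (x\<^sup>2 + a\<^sup>2))"
  \<comment> \<open>Exponent after the substitution y = x^2, which absorbs 2 x dx; then sin (pi b) =
    cos (pi s / 2) in the reflection formula.\<close>
  define b where "b = (s + 1) / 2"
  have b: "0 < b" "b < 1" using assms by (auto simp: b_def)
  have b2: "2 * (b - 1) = s - 1" by (simp add: b_def field_simps)
  define V where "V = Gamma b * Gamma (1 - b) * (a\<^sup>2) powr (b - 1)"
  have V0: "V \<ge> 0" unfolding V_def using b by (intro mult_nonneg_nonneg less_imp_le[OF Gamma_real_pos]) auto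
  define f where "f = (\<lambda>y::real. y powr (b - 1) / (y + a\<^sup>2))"
  have "((\<lambda>y. indicator {0..} y * f y) has_integral V) UNIV"
    by (rule nn_integral_has_integral) 
       (use nn_integral_powr_over_add[OF b, of "a\<^sup>2"] assms V0 in \<open>auto simp: f_def V_def indicator_def\<close>)
  also have "(\<lambda>y. indicator {0..} y * f y) = (\<lambda>y. if y \<in> {0<..} then f y else 0)"
    using b by (auto simp: indicator_def fun_eq_iff f_def)
  finally have hi: "(f has_integral V) {0<..}" by (simp only: has_integral_restrict_UNIV)
  then have "f absolutely_integrable_on {0<..}"
    by (intro nonnegative_absolutely_integrable_1) (auto simp: f_def integrable_on_def)
  moreover have im: "(\<lambda>x. x\<^sup>2) ` {0<..} = {0::real<..}"
    by (auto intro!: image_eqI[of _ _ "sqrt _"])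
  ultimately have "f absolutely_integrable_on (\<lambda>x. x\<^sup>2) ` {0<..} \<and> integral ((\<lambda>x. x\<^sup>2) ` {0<..}) f = V"
    using hi by (simp add: integral_unique)
  moreover have "inj_on (\<lambda>x. x\<^sup>2) {0::real<..}" by (auto simp: inj_on_def)
  ultimately have ai: "(\<lambda>x. \<bar>2 * x\<bar> * f (x\<^sup>2)) absolutely_integrable_on {0<..} \<and> integral {0<..} (\<lambda>x. \<bar>2 * x\<bar> * f (x\<^sup>2)) = V"
    by (subst has_absolute_integral_change_of_variables_1'[where g = "\<lambda>x. x\<^sup>2" and f = f])
       (auto intro!: derivative_eq_intros)
  then have hi2: "((\<lambda>x. \<bar>2 * x\<bar> * f (x\<^sup>2)) has_integral V) {0<..}"
    using absolutely_integrable_on_def has_integral_integral set_lebesgue_integral_eq_integral(1) by metis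
  have "(\<integral>\<^sup>+x. ennreal (indicator {0<..} x * (\<bar>2 * x\<bar> * f (x\<^sup>2))) \<partial>lborel) = V"
    by (rule nn_integral_has_integral_lebesgue[OF _ hi2]) (auto simp: f_def)
  also have "(\<lambda>x. ennreal (indicator {0<..} x * (\<bar>2 * x\<bar> * f (x\<^sup>2)))) = (\<lambda>x. ennreal (indicator {0<..} x * (?p x)))"
  proof
    fix x :: real
    have "(x\<^sup>2) powr (b - 1) = x powr (s - 1)" if "x > 0"
    proof -
      have "(x\<^sup>2) powr (b - 1) = (x powr 2) powr (b - 1)" using that by (simp add: powr_numeral)
      also have "\<dots> = x powr (s - 1)" by (simp only: powr_powr b2)
      finally show ?thesis .
    qed
    then show "ennreal (indicator {0<..} x * (\<bar>2 * x\<bar> * f (x\<^sup>2))) = ennreal (indicator {0<..} x * (?p x))"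
      by (auto simp: indicator_def f_def mult_ac)
  qed
  also have "V = pi / cos (pi * s / 2) * a powr (s - 1)"
  proof -
    have "(a\<^sup>2) powr (b - 1) = (a powr 2) powr (b - 1)" using assms by (simp add: powr_numeral)
    also have "\<dots> = a powr (s - 1)" by (simp only: powr_powr b2)
    finally have "(a\<^sup>2) powr (b - 1) = a powr (s - 1)" .
    moreover have "sin (pi * b) = cos (pi * s / 2)"
      unfolding b_def by (simp add: distrib_left add_divide_distrib sin_add)
    ultimately show ?thesis unfolding V_def Gamma_reflection_real by simp
  qed
  finally show ?thesis .
qed

section \<open>The trapezoid error as an integral, and the functional equation on a real
  segment\<close>

text \<open>Peano kernel of the trapezoid rule, from two integrations by parts. Continuity is asked
  of \<open>v * h' v\<close> so that \<open>h'\<close> may blow up at 0, as it does for a power of v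
  on the interval from 0 to 1.\<close>

lemma has_integral_trapezoid_error:
  fixes H h h' h'' :: "real \<Rightarrow> real"
  assumes cont: "continuous_on {0..1} H" "continuous_on {0..1} h" "continuous_on {0..1} (\<lambda>v. v * h' v)"
    and der: "\<And>v. 0 < v \<Longrightarrow> v < 1 \<Longrightarrow> (H has_real_derivative h v) (at v)"
      "\<And>v. 0 < v \<Longrightarrow> v < 1 \<Longrightarrow> (h has_real_derivative h' v) (at v)"
      "\<And>v. 0 < v \<Longrightarrow> v < 1 \<Longrightarrow> (h' has_real_derivative h'' v) (at v)"
  shows "((\<lambda>v. v * (1 - v) / 2 * h'' v) has_integral (h 0 + h 1) / 2 - (H 1 - H 0)) {0..1}"
proof -
  define F where "F = (\<lambda>v. v * (1 - v) / 2 * h' v - (1/2 - v) * h v - H v)"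
  have "((\<lambda>v. v * (1 - v) / 2 * h'' v) has_integral F 1 - F 0) {0..1}"
  proof (rule fundamental_theorem_of_calculus_interior)
    have "continuous_on {0..1} (\<lambda>v. (1 - v) / 2 * (v * h' v) - (1/2 - v) * h v - H v)"
      by (intro cont continuous_on_diff continuous_on_divide continuous_on_mult
          continuous_on_const continuous_on_id) auto
    then show "continuous_on {0..1} F" by (simp add: F_def mult_ac)
    fix v :: real assume v: "v \<in> {0<..<1}"
    have "(F has_real_derivative ((1/2 - v) * h' v + h'' v * (v * (1 - v) / 2))
        - (- 1 * h v + h' v * (1/2 - v)) - h v) (at v)"
      unfolding F_def
    proof (intro DERIV_diff DERIV_mult der)
      show "((\<lambda>v. v * (1 - v) / 2) has_real_derivative 1/2 - v) (at v)"
        "((\<lambda>v. 1/2 - v) has_real_derivative - 1) (at v)"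
        by (auto intro!: derivative_eq_intros simp: field_simps)
    qed (use v in auto)
    then show "(F has_vector_derivative v * (1 - v) / 2 * h'' v) (at v)"
      by (simp add: has_real_derivative_iff_has_vector_derivative mult.commute)
  qed simp
  also have "F 1 - F 0 = (h 0 + h 1) / 2 - (H 1 - H 0)" by (simp add: F_def)
  finally show ?thesis .
qed

text \<open>The second derivative of x^(-s) carries the factor s (s + 1); after dividing by it the
  integrand is nonnegative, which gives the sign of the error. The range of \<open>s\<close> keeps
  the interval starting at 0 integrable.\<close>

lemma has_integral_trapezoid_powr:
  fixes s :: real and n :: nat
  assumes "-1 < s" "s < 0"
  defines "g \<equiv> (real n powr (-s) + real (Suc n) powr (-s)) / 2 - (real (Suc n) powr (1 - s) - real n powr (1 - s)) / (1 - s)"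
  shows "((\<lambda>v. v * (1 - v) / 2 * (real n + v) powr (- s - 2)) has_integral g / (s * (s + 1))) {0..1}"
proof -
  define d where "d = s * (s + 1)"
  have nz: "d \<noteq> 0" "s \<noteq> 0" "s + 1 \<noteq> 0" "1 - s \<noteq> 0" using assms by (auto simp: d_def)
  have dp: "((\<lambda>v. (real n + v) powr a) has_real_derivative a * (real n + v) powr (a - 1)) (at v)" if "v > 0" for v a
    using that by (auto intro!: derivative_eq_intros)
  have cp: "continuous_on {0..1} (\<lambda>v. (real n + v) powr a)" if "a > 0" for a
    by (rule continuous_on_powr') (use that in \<open>auto intro!: continuous_intros\<close>)
  have c1: "continuous_on {0..1} (\<lambda>v. v * (real n + v) powr (- s - 1))"
  \<comment> \<open>For n = 0 the function is v^(-s), continuous at 0 because s < 0.\<close>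
  proof (cases n)
    case 0
    have "continuous_on {0..1} (\<lambda>v::real. v powr (- s))"
      by (intro continuous_on_powr' continuous_intros) (use assms in auto)
    also have "?this \<longleftrightarrow> continuous_on {0..1} (\<lambda>v. v * (real n + v) powr (- s - 1))"
      by (intro continuous_on_cong refl) (auto simp: 0 powr_diff)
    finally show ?thesis .
  next
    case (Suc m)
    then show ?thesis by (intro continuous_on_powr continuous_intros) auto
  qed
  have "((\<lambda>v. v * (1 - v) / 2 * (real n + v) powr (- s - 2)) has_integral
      ((real n + 0) powr (- s) / d + (real n + 1) powr (- s) / d) / 2 -
      ((real n + 1) powr (1 - s) / ((1 - s) * d) - (real n + 0) powr (1 - s) / ((1 - s) * d))) {0..1}"
  proof (rule has_integral_trapezoid_error[where h' = "\<lambda>v. - ((real n + v) powr (- s - 1)) / (s + 1)"])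
    fix v :: real assume v: "0 < v" "v < 1"
    have "((\<lambda>v. (real n + v) powr (1 - s) / ((1 - s) * d)) has_real_derivative
        (1 - s) * (real n + v) powr (1 - s - 1) / ((1 - s) * d)) (at v)"
      by (intro DERIV_cdivide dp v)
    then show "((\<lambda>v. (real n + v) powr (1 - s) / ((1 - s) * d)) has_real_derivative (real n + v) powr (- s) / d) (at v)"
      using nz by simp
    have "((\<lambda>v. (real n + v) powr (- s) / d) has_real_derivative (- s) * (real n + v) powr (- s - 1) / d) (at v)"
      by (intro DERIV_cdivide dp v)
    then show "((\<lambda>v. (real n + v) powr (- s) / d) has_real_derivative - ((real n + v) powr (- s - 1)) / (s + 1)) (at v)"
      using nz by (simp add: d_def)
    have "((\<lambda>v. - ((real n + v) powr (- s - 1)) / (s + 1)) has_real_derivative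
        - ((- s - 1) * (real n + v) powr (- s - 1 - 1)) / (s + 1)) (at v)"
      by (intro DERIV_cdivide DERIV_minus dp v)
    moreover have "- ((- s - 1) * p) / (s + 1) = p" for p using nz by (simp add: divide_simps) (simp add: algebra_simps)
    moreover have "- s - 1 - 1 = - s - 2" by simp
    ultimately show "((\<lambda>v. - ((real n + v) powr (- s - 1)) / (s + 1)) has_real_derivative (real n + v) powr (- s - 2)) (at v)"
      by (simp only:)
  next
    have "continuous_on {0..1} (\<lambda>v. - (v * (real n + v) powr (- s - 1)) / (s + 1))"
      by (intro c1 continuous_on_divide continuous_on_minus continuous_on_const) (use nz in auto)
    then show "continuous_on {0..1} (\<lambda>v. v * (- ((real n + v) powr (- s - 1)) / (s + 1)))" by simp
  qed (intro cp continuous_on_divide continuous_on_const; use nz assms in simp)+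
  moreover have "(P / d + P' / d) / 2 - (Q' / ((1 - s) * d) - Q / ((1 - s) * d)) = ((P + P') / 2 - (Q' - Q) / (1 - s)) / d" for P P' Q Q'
    using nz by (simp add: divide_simps)
  ultimately show ?thesis unfolding g_def d_def[symmetric] by (simp add: add.commute)
qed

lemma has_integral_trapezoid_exp:
  fixes x :: real
  assumes "x > 0"
  shows "((\<lambda>v. v * (1 - v) / 2 * x\<^sup>2 * exp (- v * x)) has_integral (1 + exp (-x)) / 2 - (1 - exp (-x)) / x) {0..1}"
proof -
  have "((\<lambda>v. v * (1 - v) / 2 * (x\<^sup>2 * exp (- v * x))) has_integral
      (exp (- 0 * x) + exp (- 1 * x)) / 2 - (- exp (- 1 * x) / x - - exp (- 0 * x) / x)) {0..1}"
    using assms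
    by (intro has_integral_trapezoid_error[where h' = "\<lambda>v. - x * exp (- v * x)"] continuous_intros)
       (auto intro!: derivative_eq_intros simp: power2_eq_square)
  also have "(exp (- 0 * x) + exp (- 1 * x)) / 2 - (- exp (- 1 * x) / x - - exp (- 0 * x) / x) =
      (1 + exp (-x)) / 2 - (1 - exp (-x)) / x"
    by (simp add: diff_divide_distrib)
  finally show ?thesis by (simp add: mult.assoc)
qed

text \<open>Both sides compute the integral of \<open>x powr (s - 1) * (coth (x / 2) / 2 - 1 / x)\<close>: on the left
  by expanding in powers of \<open>exp (- x)\<close>, on the right by partial fractions.\<close>

lemma zeta_half_functional_equation_real:
  fixes s :: real
  assumes "-1 < s" "s < 0"
  shows "complex_of_real (Gamma s) * zeta_half (of_real s) =
    of_real (pi / cos (pi * s / 2) * (2 * pi) powr (s - 1)) * zeta_half (of_real (1 - s))"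
proof -
  let ?R = "\<lambda>n x. x powr (s - 1) * (2 * x / (x\<^sup>2 + (2 * pi * real (Suc n))\<^sup>2))"
  define g where "g = (\<lambda>n. (real n powr (-s) + real (Suc n) powr (-s)) / 2 - (real (Suc n) powr (1 - s) - real n powr (1 - s)) / (1 - s))"
  have g_cplx: "zeta_term n (of_real s) = of_real (g n)" for n
    unfolding zeta_term_def g_def
  proof -
    have p: "of_nat j powr (complex_of_real a) = of_real (real j powr a)" for j a
      using powr_of_real[of "real j" a] by simp
    show "(of_nat n powr - complex_of_real s + of_nat (Suc n) powr - complex_of_real s) / 2 -
      (of_nat (Suc n) powr (1 - complex_of_real s) - of_nat n powr (1 - complex_of_real s)) / (1 - complex_of_real s) =
      complex_of_real ((real n powr - s + real (Suc n) powr - s) / 2 - (real (Suc n) powr (1 - s) - real n powr (1 - s)) / (1 - s))"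
      using p[of n "- s"] p[of "Suc n" "- s"] p[of n "1 - s"] p[of "Suc n" "1 - s"] by (simp del: of_nat_Suc)
  qed
  have g_sum: "g sums Re (zeta_half (of_real s))" and zr: "zeta_half (of_real s) = of_real (Re (zeta_half (of_real s)))"
  proof -
    have *: "(\<lambda>n. complex_of_real (g n)) sums zeta_half (of_real s)"
      unfolding zeta_half_def g_cplx[symmetric] by (intro summable_sums summable_zeta_term) (use assms in auto)
    from sums_Re[OF this] show g: "g sums Re (zeta_half (of_real s))" by simp
    from sums_unique2[OF * sums_of_real[OF g]] show "zeta_half (of_real s) = of_real (Re (zeta_half (of_real s)))" .
  qed
  define c where "c = pi / cos (pi * s / 2)"
  have cpos: "c > 0" unfolding c_def
  proof (intro divide_pos_pos cos_gt_zero_pi)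
    have "pi * (-1) < pi * s" "pi * s < pi * 0" using assms by (intro mult_strict_left_mono; simp)+
    then show "- (pi / 2) < pi * s / 2" "pi * s / 2 < pi / 2" using pi_gt_zero by linarith+
  qed simp
  have z_sum: "(\<lambda>n. real (Suc n) powr (s - 1)) sums Re (zeta_half (of_real (1 - s)))" and
    zr': "zeta_half (of_real (1 - s)) = of_real (Re (zeta_half (of_real (1 - s))))"
  proof -
    have *: "(\<lambda>n. complex_of_real (real (Suc n) powr (s - 1))) sums zeta_half (of_real (1 - s))"
    proof -
      have "complex_of_real (real (Suc n) powr (s - 1)) = 1 / of_nat (Suc n) powr of_real (1 - s)" for n
      proof -
        have "complex_of_real (real (Suc n) powr (s - 1)) = of_nat (Suc n) powr (- of_real (1 - s))"
          by (subst powr_of_real[symmetric]) auto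
        then show ?thesis by (simp only: powr_minus_divide)
      qed
      then show ?thesis using sums_zeta_half[of "of_real (1 - s)"] assms by simp
    qed
    from sums_Re[OF this] show g: "(\<lambda>n. real (Suc n) powr (s - 1)) sums Re (zeta_half (of_real (1 - s)))" by simp
    from sums_unique2[OF * sums_of_real[OF g]] show "zeta_half (of_real (1 - s)) = of_real (Re (zeta_half (of_real (1 - s))))" .
  qed
  have r_sum: "(\<lambda>n. c * (2 * pi * real (Suc n)) powr (s - 1)) sums (c * (2 * pi) powr (s - 1) * Re (zeta_half (of_real (1 - s))))"
  proof -
    have "(2 * pi * real (Suc n)) powr (s - 1) = (2 * pi) powr (s - 1) * real (Suc n) powr (s - 1)" for n
      by (rule powr_mult)
    then show ?thesis
      using sums_mult[OF z_sum, of "c * (2 * pi) powr (s - 1)"] by (simp only: mult.assoc)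
  qed
  have ss: "s * (s + 1) < 0" using assms by (intro mult_neg_pos) auto
  \<comment> \<open>For -1 < s < 0 both \<open>Gamma s\<close> and the errors \<open>g n\<close> are
    nonpositive. Moving s (s + 1) from one to the other makes both factors nonnegative, as needed
    for \<open>ennreal\<close> integrals.\<close>
  have Gs: "Gamma (s + 2) / (s * (s + 1)) = Gamma s"
  proof -
    have "s \<notin> \<int>\<^sub>\<le>\<^sub>0" "s + 1 \<notin> \<int>\<^sub>\<le>\<^sub>0" using assms by (auto elim!: nonpos_Ints_cases)
    then have "Gamma (s + 2) = (s + 1) * (s * Gamma s)"
      using Gamma_plus1[of s] Gamma_plus1[of "s + 1"] by (simp add: add.assoc)
    then show ?thesis using ss by (simp add: field_simps)
  qed
  have l_sum: "(\<lambda>n. Gamma (s + 2) * (g n / (s * (s + 1)))) sums (Gamma s * Re (zeta_half (of_real s)))"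
    using sums_mult[OF g_sum, of "Gamma s"] unfolding Gs[symmetric] by (simp add: mult_ac)
  have g_nonneg: "g n / (s * (s + 1)) \<ge> 0" for n
    using has_integral_nonneg[OF has_integral_trapezoid_powr[OF assms, of n, folded g_def]] by (auto simp: g_def)
  \<comment> \<open>One double integral read in two ways: integrating over x first yields Gamma (s +
    2) (n + v)^(-s-2) and hence \<open>g n\<close>; integrating over v first yields the trapezoid
    error of an exponential, geometric in n.\<close>
  let ?W = "\<lambda>n x v. indicator {0<..} x * indicator {0..1} v * (v * (1 - v) / 2 * (x powr (s + 1) * exp (- (real n + v) * x)))"
  define I where "I = (\<lambda>n. \<integral>\<^sup>+x. (\<integral>\<^sup>+v. ennreal (?W n x v) \<partial>lborel) \<partial>lborel)"
  have I1: "I n = ennreal (Gamma (s + 2) * (g n / (s * (s + 1))))" for n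
  proof -
    have "I n = (\<integral>\<^sup>+v. (\<integral>\<^sup>+x. ennreal (?W n x v) \<partial>lborel) \<partial>lborel)"
      unfolding I_def by (rule lborel_pair.Fubini'[symmetric]) measurable
    also have "\<dots> = (\<integral>\<^sup>+v. ennreal (Gamma (s + 2)) * ennreal (indicator {0..1} v * (v * (1 - v) / 2 * (real n + v) powr (- s - 2))) \<partial>lborel)"
    proof (intro nn_integral_cong_AE, use AE_lborel_singleton[of 0] in eventually_elim)
      case (elim v)
      show ?case
      proof (cases "v \<in> {0..1}")
        case True
        then have v: "0 < v" "v \<le> 1" using elim by auto
        have "(\<integral>\<^sup>+x. ennreal (?W n x v) \<partial>lborel)
          = (\<integral>\<^sup>+x. ennreal (v * (1 - v) / 2) * ennreal (indicator {0..} x * (x powr (s + 2 - 1) * exp (- (real n + v) * x))) \<partial>lborel)"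
        proof (intro nn_integral_cong_AE, use AE_lborel_singleton[of 0] in eventually_elim)
          case (elim x)
          then show ?case using v by (auto simp: indicator_def ennreal_mult[symmetric] add.commute)
        qed
        also have "\<dots> = ennreal (v * (1 - v) / 2) * ennreal (Gamma (s + 2) / (real n + v) powr (s + 2))"
          by (subst nn_integral_cmult, simp, subst nn_integral_powr_exp) (use assms v in auto)
        also have "Gamma (s + 2) / (real n + v) powr (s + 2) = Gamma (s + 2) * (real n + v) powr (- s - 2)"
          using powr_minus_divide[of "real n + v" "s + 2"] by simp
        finally show ?thesis using v assms True by (simp add: ennreal_mult[symmetric] Gamma_real_pos less_imp_le mult_ac)
      qed simp
    qed
    also have "\<dots> = ennreal (Gamma (s + 2)) * (\<integral>\<^sup>+v. ennreal (indicator {0..1} v * (v * (1 - v) / 2 * (real n + v) powr (- s - 2))) \<partial>lborel)"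
      by (rule nn_integral_cmult) measurable
    also have "(\<integral>\<^sup>+v. ennreal (indicator {0..1} v * (v * (1 - v) / 2 * (real n + v) powr (- s - 2))) \<partial>lborel) = ennreal (g n / (s * (s + 1)))"
      unfolding g_def by (rule nn_integral_has_integral_lebesgue[OF _ has_integral_trapezoid_powr[OF assms]]) auto
    finally show ?thesis
      using ennreal_mult[OF less_imp_le[OF Gamma_real_pos[of "s + 2"]] g_nonneg[of n]] assms by (simp only:)
  qed
  define J where "J = (\<lambda>n. \<integral>\<^sup>+x. ennreal (indicator {0<..} x * (?R n x)) \<partial>lborel)"
  have J1: "J n = ennreal (c * (2 * pi * real (Suc n)) powr (s - 1))" for n
    unfolding J_def c_def by (rule nn_integral_powr_over_square_add) (use assms in auto)
  have meas: "(\<lambda>x. \<integral>\<^sup>+v. ennreal (?W n x v) \<partial>lborel) \<in> borel_measurable lborel" for n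
    by measurable
  have "(\<Sum>n. I n) = (\<integral>\<^sup>+x. (\<Sum>n. \<integral>\<^sup>+v. ennreal (?W n x v) \<partial>lborel) \<partial>lborel)"
    unfolding I_def by (rule nn_integral_suminf[symmetric]) (rule meas)
  also have "\<dots> = (\<integral>\<^sup>+x. (\<Sum>n. ennreal (indicator {0<..} x * (?R n x))) \<partial>lborel)"
  proof (intro nn_integral_cong)
    fix x :: real
    show "(\<Sum>n. \<integral>\<^sup>+v. ennreal (?W n x v) \<partial>lborel) =
      (\<Sum>n. ennreal (indicator {0<..} x * (?R n x)))"
    proof (cases "x > 0")
      case True
      \<comment> \<open>Summing the geometric series divides this by 1 - exp (-x), which gives coth
        (x/2) / 2 - 1/x.\<close>
      define p where "p = (1 + exp (-x)) / 2 - (1 - exp (-x)) / x"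
      have p0: "p \<ge> 0" unfolding p_def
        by (rule has_integral_nonneg[OF has_integral_trapezoid_exp[OF True]]) auto
      have xp: "x powr (s + 1) = x powr (s - 1) * x\<^sup>2"
        using True powr_add[of x "s - 1" 2] by (simp add: powr_numeral add.commute)
      let ?Q = "\<lambda>v. indicator {0..1} v * (v * (1 - v) / 2 * x\<^sup>2 * exp (- v * x))"
      have inner: "(\<integral>\<^sup>+v. ennreal (?W n x v) \<partial>lborel)
        = ennreal (x powr (s - 1) * p * exp (- x) ^ n)" for n
      proof -
        have "(\<integral>\<^sup>+v. ennreal (?W n x v) \<partial>lborel)
         = (\<integral>\<^sup>+v. ennreal (x powr (s - 1) * exp (- x) ^ n) * ennreal (?Q v) \<partial>lborel)"
        proof (intro nn_integral_cong)
          fix v :: real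
          have "exp (- (real n + v) * x) = exp (- x) ^ n * exp (- v * x)"
            by (simp add: exp_of_nat_mult[symmetric] exp_add[symmetric] algebra_simps)
          then show "ennreal (?W n x v) =
            ennreal (x powr (s - 1) * exp (- x) ^ n) * ennreal (?Q v)"
            using True by (auto simp: indicator_def ennreal_mult[symmetric] xp mult_ac)
        qed
        also have "\<dots> = ennreal (x powr (s - 1) * exp (- x) ^ n) * (\<integral>\<^sup>+v. ennreal (?Q v) \<partial>lborel)"
          by (rule nn_integral_cmult) measurable
        also have "(\<integral>\<^sup>+v. ennreal (?Q v) \<partial>lborel) = ennreal p"
          unfolding p_def by (rule nn_integral_has_integral_lebesgue[OF _ has_integral_trapezoid_exp[OF True]]) auto
        finally show ?thesis using p0 by (simp add: ennreal_mult[symmetric] mult_ac)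
      qed
      have "(\<lambda>n. x powr (s - 1) * p * exp (- x) ^ n) sums (x powr (s - 1) * p * (1 / (1 - exp (-x))))"
        using True by (intro sums_mult geometric_sums) auto
      then have "(\<Sum>n. ennreal (x powr (s - 1) * p * exp (- x) ^ n)) = ennreal (x powr (s - 1) * p * (1 / (1 - exp (-x))))"
        using p0 by (intro suminf_ennreal_eq) auto
      also have "p * (1 / (1 - exp (-x))) = (1 + exp (-x)) / (2 * (1 - exp (-x))) - 1 / x"
        using True by (simp add: p_def field_simps)
      then have "x powr (s - 1) * p * (1 / (1 - exp (-x))) = x powr (s - 1) * ((1 + exp (-x)) / (2 * (1 - exp (-x))) - 1 / x)"
        by (simp only: mult.assoc)
      also have "ennreal (x powr (s - 1) * ((1 + exp (-x)) / (2 * (1 - exp (-x))) - 1 / x)) =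
         (\<Sum>n. ennreal (?R n x))"
        using True by (intro suminf_ennreal_eq[symmetric] sums_mult coth_partial_fractions) auto
      finally show ?thesis unfolding inner using True by simp
    qed simp
  qed
  also have "\<dots> = (\<Sum>n. J n)"
    unfolding J_def by (rule nn_integral_suminf) measurable
  finally have "(\<Sum>n. ennreal (Gamma (s + 2) * (g n / (s * (s + 1))))) = (\<Sum>n. ennreal (c * (2 * pi * real (Suc n)) powr (s - 1)))"
    unfolding I1 J1 .
  also have "(\<Sum>n. ennreal (Gamma (s + 2) * (g n / (s * (s + 1))))) = ennreal (Gamma s * Re (zeta_half (of_real s)))"
    using l_sum g_nonneg assms by (intro suminf_ennreal_eq mult_nonneg_nonneg) (auto intro!: less_imp_le[OF Gamma_real_pos])
  also have "(\<Sum>n. ennreal (c * (2 * pi * real (Suc n)) powr (s - 1))) = ennreal (c * (2 * pi) powr (s - 1) * Re (zeta_half (of_real (1 - s))))"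
    using r_sum cpos by (intro suminf_ennreal_eq mult_nonneg_nonneg) auto
  finally have "Gamma s * Re (zeta_half (of_real s)) = c * (2 * pi) powr (s - 1) * Re (zeta_half (of_real (1 - s)))"
  proof (subst (asm) ennreal_inj)
    show "0 \<le> Gamma s * Re (zeta_half (of_real s))"
      by (rule sums_le[OF _ sums_zero l_sum]) 
         (use g_nonneg assms in \<open>auto intro!: mult_nonneg_nonneg less_imp_le[OF Gamma_real_pos] simp del: times_divide_eq_right\<close>)
    show "0 \<le> c * (2 * pi) powr (s - 1) * Re (zeta_half (of_real (1 - s)))"
      by (rule sums_le[OF _ sums_zero r_sum]) (use cpos in auto)
  qed
  then have "complex_of_real (Gamma s * Re (zeta_half (of_real s))) = of_real (c * (2 * pi) powr (s - 1) * Re (zeta_half (of_real (1 - s))))"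
    by simp
  then show ?thesis unfolding c_def zr[symmetric] zr'[symmetric] of_real_mult by simp
qed

section \<open>Continuation to the whole plane and uniqueness\<close>

text \<open>Identity theorem from the real segment between -1 and 0. The cosine is multiplied out so
  that both sides are visibly holomorphic in the strip.\<close>

lemma zeta_half_functional_equation:
  assumes "-1 < Re s" "Re s < 0"
  shows "Gamma s * zeta_half s * cos (of_real pi * s / 2) =
    of_real pi * (2 * of_real pi) powr (s - 1) * zeta_half (1 - s)"
proof -
  define A where "A = {s. -1 < Re s \<and> Re s < 0}"
  have A: "open A" "convex A"
  proof -
    have "A = {z. -1 < Re z} \<inter> {z. Re z < 0}" by (auto simp: A_def)
    then show "open A" "convex A"
      by (auto intro!: open_Int open_halfspace_Re_gt open_halfspace_Re_lt convex_Int
          convex_halfspace_Re_gt convex_halfspace_Re_lt)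
  qed
  define f where "f = (\<lambda>s. Gamma s * zeta_half s * cos (of_real pi * s / 2) -
    of_real pi * (2 * of_real pi) powr (s - 1) * zeta_half (1 - s))"
  have "f s = 0"
  proof (rule analytic_continuation[of f A "of_real ` {-1<..<0}" "of_real (-1/2)"])
    have "zeta_half holomorphic_on A"
      by (rule holomorphic_on_subset[OF zeta_half_holomorphic]) (auto simp: A_def)
    moreover have "(zeta_half \<circ> (\<lambda>s. 1 - s)) holomorphic_on A"
      by (rule holomorphic_on_compose_gen[OF _ zeta_half_holomorphic])
         (auto simp: A_def intro!: holomorphic_intros)
    then have "(\<lambda>s. zeta_half (1 - s)) holomorphic_on A" by (simp add: o_def)
    ultimately show "f holomorphic_on A"
      unfolding f_def by (intro holomorphic_intros) (auto simp: A_def elim!: nonpos_Ints_cases')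
    show "of_real ` {-1<..<0} \<subseteq> A" by (auto simp: A_def)
    show "of_real (-1/2) \<in> A" by (simp add: A_def)
    have "(-1/2::real) islimpt {-1<..<0}" by (intro open_imp_islimpt) auto
    then show "(of_real (-1/2) :: complex) islimpt of_real ` {-1<..<0}"
      by (rule islimpt_isCont_image) (intro continuous_intros, auto simp: eventually_at_filter complex_eq_iff intro!: always_eventually)
    show "f z = 0" if z: "z \<in> of_real ` {-1<..<0}" for z
    proof -
      obtain x where x: "z = of_real x" "-1 < x" "x < 0" using z by auto
      have "pi * (-1) < pi * x" "pi * x < pi * 0" using x by (intro mult_strict_left_mono; simp)+
      then have "cos (pi * x / 2) > 0" using pi_gt_zero by (intro cos_gt_zero_pi; linarith)
      then have c: "cos (complex_of_real pi * of_real x / 2) \<noteq> 0"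
        using cos_of_real[of "pi * x / 2", where 'a = complex] by simp
      have "complex_of_real (Gamma x) * zeta_half (of_real x) =
         of_real pi / cos (of_real pi * of_real x / 2) * (2 * of_real pi) powr (of_real x - 1) * zeta_half (1 - of_real x)"
        using zeta_half_functional_equation_real[OF x(2,3)]
          powr_of_real[of "2 * pi" "x - 1"] cos_of_real[of "pi * x / 2", where 'a = complex] by simp
      then show ?thesis unfolding f_def x using c by (simp add: Gamma_complex_of_real field_simps)
    qed
    show "s \<in> A" using assms by (simp add: A_def)
  qed (use A convex_connected in auto)
  then show ?thesis by (simp add: f_def)
qed

text \<open>The functional equation solved for zeta s. For Re s < 0 the point 1 - s has real part
  above 1, so neither Gamma nor \<open>zeta_half\<close> is singular there.\<close>

definition zeta_left :: "complex \<Rightarrow> complex" where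
  "zeta_left s = 2 * (2 * of_real pi) powr (s - 1) * sin (of_real pi * s / 2) * Gamma (1 - s) * zeta_half (1 - s)"

lemma zeta_half_eq_zeta_left:
  assumes "-1 < Re s" "Re s < 0"
  shows "zeta_half s = zeta_left s"
proof -
  define S C where "S = sin (of_real pi * s / 2)" and "C = cos (of_real pi * s / 2)"
  have ns: "s \<notin> \<int>" using assms by (auto elim!: Ints_cases)
  have sd: "sin (of_real pi * s) = 2 * S * C"
    using sin_double[of "of_real pi * s / 2"] by (simp add: S_def C_def)
  have "sin (of_real pi * s) \<noteq> 0" using ns by (auto simp: sin_eq_0 mult.commute)
  then have nz: "S \<noteq> 0" "C \<noteq> 0" unfolding sd by auto
  have "of_real pi / (2 * S) * zeta_half s = Gamma s * Gamma (1 - s) * C * zeta_half s"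
    unfolding Gamma_reflection_complex sd using nz by simp
  also have "\<dots> = Gamma (1 - s) * (Gamma s * zeta_half s * C)" by simp
  also have "\<dots> = Gamma (1 - s) * (of_real pi * (2 * of_real pi) powr (s - 1) * zeta_half (1 - s))"
    unfolding C_def zeta_half_functional_equation[OF assms] ..
  also have "\<dots> = of_real pi / (2 * S) * zeta_left s"
    unfolding zeta_left_def S_def[symmetric] using nz by simp
  finally show ?thesis using nz by simp
qed

lemma zeta_left_holomorphic: "zeta_left holomorphic_on {s. Re s < 0}"
proof -
  have "(zeta_half \<circ> (\<lambda>s. 1 - s)) holomorphic_on {s. Re s < 0}"
    by (rule holomorphic_on_compose_gen[OF _ zeta_half_holomorphic])
       (auto intro!: holomorphic_intros)
  then have "(\<lambda>s. zeta_half (1 - s)) holomorphic_on {s. Re s < 0}" by (simp add: o_def)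
  then show ?thesis
    unfolding zeta_left_def by (intro holomorphic_intros) (auto intro!: not_nonpos_IntsI)
qed

text \<open>The two pieces agree on the overlap -1 < Re s < 0; the value at 1 is the dummy
  prescribed in the definition of \<open>zeta\<close>.\<close>

definition zeta_ext :: "complex \<Rightarrow> complex" where
  "zeta_ext s = (if s = 1 then 0 else if Re s > -1 then zeta_half s else zeta_left s)"

lemma zeta_ext_holomorphic: "zeta_ext holomorphic_on - {1}"
proof -
  have "zeta_ext holomorphic_on ({s. Re s > -1} - {1})"
    by (rule holomorphic_transform[OF zeta_half_holomorphic]) (auto simp: zeta_ext_def)
  moreover have "zeta_ext holomorphic_on {s. Re s < 0}"
    by (rule holomorphic_transform[OF zeta_left_holomorphic])
       (auto simp: zeta_ext_def zeta_half_eq_zeta_left)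
  moreover have "open ({s. Re s > -1} - {1 :: complex})"
    by (intro open_Diff open_halfspace_Re_gt) auto
  ultimately have "zeta_ext holomorphic_on (({s. Re s > -1} - {1}) \<union> {s. Re s < 0})"
    by (intro holomorphic_on_Un open_halfspace_Re_lt)
  then show ?thesis by (rule holomorphic_on_subset) auto
qed

lemma connected_minus_finite: "finite S \<Longrightarrow> connected (- S :: complex set)"
  using connected_open_delete_finite[of "UNIV :: complex set" S] connected_UNIV by (simp add: Compl_eq_Diff_UNIV)

text \<open>Existence is the gluing. For uniqueness, the plane without 1 is connected, so agreement
  on Re s > 1 spreads to all of it, and the dummy settles the point 1.\<close>

lemma zeta_eq_zeta_ext: "zeta = zeta_ext"
  unfolding zeta_def
proof (rule the_equality)
  show "zeta_ext holomorphic_on - {1} \<and>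
    (\<forall>s. Re s > 1 \<longrightarrow> (\<lambda>n. 1 / of_nat (Suc n) powr s) sums zeta_ext s) \<and> zeta_ext 1 = 0"
    using zeta_ext_holomorphic sums_zeta_half by (auto simp: zeta_ext_def)
next
  fix f assume f: "f holomorphic_on - {1} \<and>
    (\<forall>s. Re s > 1 \<longrightarrow> (\<lambda>n. 1 / of_nat (Suc n) powr s) sums f s) \<and> f 1 = 0"
  show "f = zeta_ext"
  proof
    fix s
    show "f s = zeta_ext s"
    proof (cases "s = 1")
      case False
      show ?thesis
      proof (rule analytic_continuation_open[of "{s. Re s > 1}" "- {1}" f zeta_ext])
        have "2 \<in> {s. Re s > 1}" by simp
        then show "{s. Re s > 1} \<noteq> {}" by blast
        show "f z = zeta_ext z" if "z \<in> {s. Re s > 1}" for z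
        proof -
          have "(\<lambda>n. 1 / of_nat (Suc n) powr z) sums f z" using f that by auto
          moreover have "(\<lambda>n. 1 / of_nat (Suc n) powr z) sums zeta_ext z"
            using that sums_zeta_half[of z] by (auto simp: zeta_ext_def)
          ultimately show ?thesis by (rule sums_unique2)
        qed
      qed (use f zeta_ext_holomorphic False in \<open>auto intro!: connected_minus_finite open_halfspace_Re_gt\<close>)
    qed (use f in \<open>simp add: zeta_ext_def\<close>)
  qed
qed

lemma zeta_holomorphic: "zeta holomorphic_on - {1}"
  unfolding zeta_eq_zeta_ext by (rule zeta_ext_holomorphic)

lemma zeta_holomorphic' [holomorphic_intros]:
  assumes "f holomorphic_on A" "\<And>z. z \<in> A \<Longrightarrow> f z \<noteq> 1"
  shows "(\<lambda>z. zeta (f z)) holomorphic_on A"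
proof -
  have "f ` A \<subseteq> - {1}" using assms(2) by auto
  from holomorphic_on_compose_gen[OF assms(1) zeta_holomorphic this] show ?thesis by (simp add: o_def)
qed

lemma zeta_eq_zeta_half: "Re s > -1 \<Longrightarrow> s \<noteq> 1 \<Longrightarrow> zeta s = zeta_half s"
  by (simp add: zeta_eq_zeta_ext zeta_ext_def)

lemma sums_zeta: "Re s > 1 \<Longrightarrow> (\<lambda>n. 1 / of_nat (Suc n) powr s) sums zeta s"
  using sums_zeta_half[of s] by (subst zeta_eq_zeta_half) auto

lemma zeta_0: "zeta 0 = -1/2"
  by (simp add: zeta_eq_zeta_half zeta_half_0)

lemma zeta_reflect_right:
  assumes "Re w > 1"
  shows "zeta (1 - w) = 2 * (2 * of_real pi) powr (- w) * cos (of_real pi * w / 2) * Gamma w * zeta w"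
proof -
  have "zeta (1 - w) = zeta_left (1 - w)"
    using assms zeta_half_eq_zeta_left[of "1 - w"] by (auto simp: zeta_eq_zeta_ext zeta_ext_def)
  also have "sin (of_real pi * (1 - w) / 2) = cos (of_real pi * w / 2)"
  proof -
    have "of_real pi * (1 - w) / 2 = of_real (pi / 2) - of_real pi * w / 2"
      by (simp add: right_diff_distrib diff_divide_distrib)
    then show ?thesis by (simp only: sin_diff sin_of_real cos_of_real sin_pi_half cos_pi_half) simp
  qed
  then have "zeta_left (1 - w) = 2 * (2 * of_real pi) powr (- w) * cos (of_real pi * w / 2) * Gamma w * zeta w"
  proof -
    have "w \<noteq> 1" using assms by auto
    then have "zeta w = zeta_half w" using assms by (intro zeta_eq_zeta_half) auto
    then show ?thesis using \<open>sin _ = _\<close> by (simp add: zeta_left_def)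
  qed
  finally show ?thesis .
qed

text \<open>With the entire function \<open>rGamma\<close> in place of Gamma, both sides are
  holomorphic off 0 and 1, and the identity spreads from Re w > 1 to this connected set.\<close>

lemma zeta_reflect:
  assumes "w \<noteq> 0" "w \<noteq> 1"
  shows "zeta (1 - w) * rGamma w = 2 * (2 * of_real pi) powr (- w) * cos (of_real pi * w / 2) * zeta w"
proof (rule analytic_continuation_open[of "{s. Re s > 1}" "- {0, 1}" "\<lambda>w. zeta (1 - w) * rGamma w"
      "\<lambda>w. 2 * (2 * of_real pi) powr (- w) * cos (of_real pi * w / 2) * zeta w"])
  have "2 \<in> {s. Re s > 1}" by simp
  then show "{s. Re s > 1} \<noteq> {}" by blast
  show "zeta (1 - z) * rGamma z = 2 * (2 * of_real pi) powr (- z) * cos (of_real pi * z / 2) * zeta z"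
    if "z \<in> {s. Re s > 1}" for z
  proof -
    have "z \<notin> \<int>\<^sub>\<le>\<^sub>0" using that by (auto elim!: nonpos_Ints_cases)
    then show ?thesis using that by (simp add: zeta_reflect_right rGamma_inverse_Gamma Gamma_eq_zero_iff)
  qed
  show "open {s. 1 < Re s}" by (rule open_halfspace_Re_gt)
  show "connected (- {0, 1 :: complex})" by (rule connected_minus_finite) simp
qed (use assms in \<open>auto intro!: holomorphic_intros\<close>)

lemma cos_odd_half_pi: "cos (of_real pi * of_int (1 - 2 * n) / 2 :: complex) = 0"
proof -
  have "of_real pi * of_int (1 - 2 * n) / 2 = complex_of_real (pi / 2 - real_of_int n * pi)"
    by (simp add: algebra_simps diff_divide_distrib)
  moreover have "cos (pi / 2 - real_of_int n * pi) = sin (real_of_int n * pi)" by (simp add: cos_diff)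
  ultimately show ?thesis by (simp only: cos_of_real) (simp add: sin_zero_iff_int2)
qed

text \<open>The trivial zeros: at w = 1 - 2n, an odd integer above 1, the cosine in the functional
  equation vanishes.\<close>

lemma zeta_even_neg:
  assumes "n < 0"
  shows "zeta (of_int (2 * n)) = 0"
  using zeta_reflect_right[of "of_int (1 - 2 * n)"] cos_odd_half_pi[of n] assms by simp

text \<open>To the left of -1/2 the functional equation applies, and there the rate pi/2 of the
  cosine cancels the rate -pi/2 of Gamma.\<close>

lemma exp_growth_zeta: "exp_growth a b 0 zeta"
proof (rule exp_growth_split[of _ "-1/2"])
  have half: "exp_growth (-1/2) c 0 zeta" for c
  proof (rule exp_growth_mono_norm[OF exp_growth_zeta_half])
    fix z :: complex assume "- 1 / 2 \<le> Re z" "1 \<le> \<bar>Im z\<bar>"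
    then have "Re z > -1" "z \<noteq> 1" by auto
    then show "norm (zeta z) \<le> norm (zeta_half z)" by (simp add: zeta_eq_zeta_half)
  qed
  show "exp_growth (-1/2) b 0 zeta" by (rule half)
  have "exp_growth (3/2) (1 - a) ((0 + 0 + pi / 2 + - (pi / 2)) + 0)
     (\<lambda>w. 2 * of_real (2 * pi) powr (- w) * cos (of_real pi * w / 2) * Gamma w * zeta w)"
    by (intro exp_growth_mult exp_growth_const exp_growth_powr exp_growth_cos_half_pi exp_growth_Gamma
       exp_growth_subset[OF half]) auto
  then have "exp_growth (3/2) (1 - a) 0 (\<lambda>w. zeta (1 - w))"
  proof (rule exp_growth_mono_norm[OF back_subst[where P = "\<lambda>r. exp_growth _ _ r _"]])
    fix w :: complex assume "3/2 \<le> Re w"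
    then show "norm (zeta (1 - w)) \<le> norm (2 * of_real (2 * pi) powr (- w) *
        cos (of_real pi * w / 2) * Gamma w * zeta w)"
      by (simp add: zeta_reflect_right)
  qed simp
  from exp_growth_reflect[OF this, of 1] show "exp_growth a (-1/2) 0 zeta" by simp
qed

section \<open>Values of zeta at even integers\<close>

lemma sums_zeta_nat:
  assumes "m \<ge> 2"
  shows "(\<lambda>n. 1 / of_nat (Suc n) ^ m) sums zeta (of_nat m)"
proof -
  have "of_nat (Suc n) powr (of_nat m :: complex) = of_nat (Suc n) ^ m" for n
    by (subst powr_nat) (auto simp del: of_nat_Suc)
  then show ?thesis using sums_zeta[of "of_nat m"] assms by simp
qed

text \<open>Each partial fraction of coth is a geometric series in (x / (2 pi n))^2; collecting a
  fixed power over all n produces an even zeta value.\<close>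

lemma sums_coth_power_series:
  fixes x :: complex
  assumes "x \<noteq> 0" "norm x < 1"
  shows "(\<lambda>l. 2 * (-1) ^ l * zeta (of_nat (2 * l + 2)) / (2 * of_real pi) ^ (2 * l + 2) * x ^ (2 * l + 2)) sums
     (x * (1 + exp (-x)) / (2 * (1 - exp (-x))) - 1)"
proof -
  let ?T = "x * (1 + exp (-x)) / (2 * (1 - exp (-x))) - 1"
  define y where "y = x / (2 * of_real pi)"
  define r where "r = norm y ^ 2"
  have ny: "norm y < 1"
  proof -
    have "norm y = norm x / (2 * pi)" by (simp add: y_def norm_divide norm_mult)
    also have "\<dots> < 1" using assms pi_gt3 by simp
    finally show ?thesis .
  qed
  have r: "0 \<le> r" "r < 1" using ny by (auto simp: r_def power_less_one_iff)
  have nint: "\<i> * x / (2 * of_real pi) \<notin> \<int>"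
  proof
    assume "\<i> * x / (2 * of_real pi) \<in> \<int>"
    then obtain m where m: "\<i> * x / (2 * of_real pi) = of_int m" by (auto elim: Ints_cases)
    then have "norm (\<i> * x / (2 * of_real pi)) = real_of_int \<bar>m\<bar>" by simp
    moreover have "norm (\<i> * x / (2 * of_real pi)) = norm y" by (simp add: y_def norm_mult norm_divide)
    ultimately have "m = 0" using ny by linarith
    then show False using m assms by simp
  qed
  define u where "u = (\<lambda>n. (y / of_nat (Suc n))\<^sup>2)"
  have nu: "norm (u n) = r * (1 / real (Suc n) ^ 2)" for n
    by (simp add: u_def r_def norm_power norm_divide power_divide del: of_nat_Suc)
  have nu_le: "norm (u n) \<le> r" for n
    unfolding nu using r by (intro mult_left_le) (auto simp: divide_le_eq)
  have u1: "norm (1 + u n) \<ge> 1 - r" for n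
    using norm_triangle_ineq2[of 1 "- u n"] nu_le[of n] by simp
  have u1': "1 + u n \<noteq> 0" for n using u1[of n] r by auto
  have T: "(\<lambda>n. 2 * u n / (1 + u n)) sums ?T"
  proof -
    have "x * (2 * x / (x\<^sup>2 + (2 * of_real pi * of_nat (Suc n))\<^sup>2)) = 2 * u n / (1 + u n)" for n
    proof -
      define N where "N = complex_of_nat (Suc n)"
      have N: "N \<noteq> 0" by (simp add: N_def del: of_nat_Suc)
      have un: "u n = x\<^sup>2 / (2 * of_real pi * N)\<^sup>2"
        by (simp add: u_def y_def N_def power_divide power_mult_distrib del: of_nat_Suc)
      have nz: "(2 * of_real pi * N)\<^sup>2 \<noteq> 0" using N by simp
      have "2 * (a / b) / (1 + a / b) = 2 * a / (a + b)" if "b \<noteq> 0" for a b :: complex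
        using that by (simp add: divide_simps add.commute)
      from this[OF nz, of "x\<^sup>2"] show ?thesis unfolding un N_def[symmetric] by (simp add: power2_eq_square)
    qed
    moreover have "x * ((1 + exp (-x)) / (2 * (1 - exp (-x))) - 1 / x) = x * (1 + exp (-x)) / (2 * (1 - exp (-x))) - 1"
      using assms by (simp add: right_diff_distrib)
    ultimately show ?thesis
      using sums_mult[OF coth_partial_fractions_complex[OF nint], of x] by (simp only:)
  qed
  define c where "c = (\<lambda>l. 2 * (-1) ^ l * zeta (of_nat (2 * l + 2)) / (2 * of_real pi) ^ (2 * l + 2) * x ^ (2 * l + 2))"
  have c_sums: "(\<lambda>n. 2 * (-1) ^ l * u n ^ (l + 1)) sums c l" for l
  proof -
    have "u n ^ (l + 1) = y ^ (2 * l + 2) * (1 / of_nat (Suc n) ^ (2 * l + 2))" for n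
      unfolding u_def power_mult[symmetric] by (simp add: power_divide del: of_nat_Suc)
    moreover have "c l = 2 * (-1) ^ l * (y ^ (2 * l + 2) * zeta (of_nat (2 * l + 2)))"
      by (simp add: c_def y_def power_divide)
    ultimately show ?thesis
      by (simp only:) (intro sums_mult sums_zeta_nat, simp)
  qed
  \<comment> \<open>A finite geometric sum with exact remainder: the order of summation is exchanged
    for finitely many powers, and the remainder, at most \<open>r ^ L * K\<close> after summing over
    n, disappears as L grows.\<close>
  have fin: "(\<Sum>l<L. 2 * (-1) ^ l * u n ^ (l + 1)) = 2 * u n / (1 + u n) - 2 * (-1) ^ L * u n ^ (L + 1) / (1 + u n)" for n L
  proof (induction L)
    case (Suc L)
    have "2 * (-1) ^ L * u n ^ (L + 1) - 2 * (-1) ^ L * u n ^ (L + 1) / (1 + u n) = - (2 * (-1) ^ Suc L * u n ^ (Suc L + 1) / (1 + u n))"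
      using u1'[of n] by (simp add: divide_simps) (simp add: algebra_simps)
    then show ?case unfolding sum.lessThan_Suc Suc.IH by (simp add: algebra_simps)
  qed simp
  define K where "K = (\<Sum>n. 2 / (1 - r) * (1 / real (Suc n) ^ 2))"
  have sK: "summable (\<lambda>n. 2 / (1 - r) * (1 / real (Suc n) ^ 2))"
    using inverse_squares_sums by (intro summable_mult) (simp add: sums_iff add.commute)
  have bound: "norm (?T - (\<Sum>l<L. c l)) \<le> r ^ L * K" for L
  proof -
    have R: "(\<lambda>n. 2 * u n / (1 + u n) - (\<Sum>l<L. 2 * (-1) ^ l * u n ^ (l + 1))) sums
        (?T - (\<Sum>l<L. c l))"
      by (intro sums_diff T sums_sum c_sums)
    have b: "norm (2 * u n / (1 + u n) - (\<Sum>l<L. 2 * (-1) ^ l * u n ^ (l + 1))) \<le> r ^ L * (2 / (1 - r) * (1 / real (Suc n) ^ 2))" for n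
    proof -
      have "norm (2 * u n / (1 + u n) - (\<Sum>l<L. 2 * (-1) ^ l * u n ^ (l + 1))) = 2 * (norm (u n) ^ L * norm (u n)) / norm (1 + u n)"
        unfolding fin by (simp add: norm_mult norm_divide norm_power)
      also have "\<dots> \<le> 2 * (r ^ L * (r * (1 / real (Suc n) ^ 2))) / (1 - r)"
        using nu_le[of n] u1[of n] r nu[of n]
        by (intro frac_le mult_left_mono mult_mono power_mono) (auto simp del: of_nat_Suc)
      also have "\<dots> \<le> 2 * (r ^ L * (1 * (1 / real (Suc n) ^ 2))) / (1 - r)"
        using r by (intro divide_right_mono mult_left_mono mult_right_mono) auto
      finally show ?thesis by (simp add: mult_ac)
    qed
    have "norm (?T - (\<Sum>l<L. c l)) \<le> (\<Sum>n. r ^ L * (2 / (1 - r) * (1 / real (Suc n) ^ 2)))"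
      using R b by (intro norm_sums_le[OF R summable_sums] summable_mult sK) auto
    also have "\<dots> = r ^ L * K" unfolding K_def by (rule suminf_mult[OF sK])
    finally show ?thesis .
  qed
  have "(\<lambda>L. ?T - (\<Sum>l<L. c l)) \<longlonglongrightarrow> 0"
  proof (rule Lim_null_comparison[OF always_eventually[OF allI[OF bound]]])
    have "(\<lambda>L. r ^ L * K) \<longlonglongrightarrow> 0 * K" using r by (intro tendsto_mult tendsto_const LIMSEQ_realpow_zero)
    then show "(\<lambda>L. r ^ L * K) \<longlonglongrightarrow> 0" by simp
  qed
  then have "(\<lambda>L. ?T - (?T - (\<Sum>l<L. c l)))
     \<longlonglongrightarrow> ?T - 0"
    by (intro tendsto_diff tendsto_const)
  then show ?thesis unfolding sums_def c_def[symmetric] by simp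
qed

lemma exp_neq_1_if_norm_less_1:
  fixes x :: complex
  assumes "x \<noteq> 0" "norm x < 1"
  shows "exp x \<noteq> 1"
proof
  assume "exp x = 1"
  then obtain n :: int where n: "Re x = 0" "Im x = of_int (2 * n) * pi" by (auto simp: exp_eq_1)
  have "\<bar>Im x\<bar> < 1" using abs_Im_le_cmod[of x] assms by linarith
  then have "\<bar>of_int (2 * n)\<bar> * pi < 1" using n by (simp add: abs_mult)
  moreover have "n \<noteq> 0" using n assms by (auto simp: complex_eq_iff)
  then have "1 * 1 \<le> \<bar>of_int (2 * n)\<bar> * pi" using pi_ge_two by (intro mult_mono) auto
  ultimately show False by simp
qed

text \<open>Taylor coefficients of x / (exp x - 1) expressed through zeta values; comparing them
  with \<open>bernoulli n / fact n\<close> evaluates zeta at even integers.\<close>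

definition bernoulli_coeff :: "nat \<Rightarrow> complex" where
  "bernoulli_coeff n = (if n = 0 then 1 else if n = 1 then -1/2 else if even n then
     2 * (-1) ^ (n div 2 - 1) * zeta (of_nat n) / (2 * of_real pi) ^ n else 0)"

lemma sums_bernoulli_coeff:
  fixes x :: complex
  assumes "norm x < 1"
  shows "(\<lambda>n. bernoulli_coeff n * x ^ n) sums (if x = 0 then 1 else x / (exp x - 1))"
proof (cases "x = 0")
  case True
  then show ?thesis using powser_sums_zero[of bernoulli_coeff] by (simp add: bernoulli_coeff_def)
next
  case False
  define A where "A = (\<lambda>n. if even n \<and> n \<ge> 2 then 2 * (-1) ^ (n div 2 - 1) * zeta (of_nat n) / (2 * of_real pi) ^ n * x ^ n else 0)"
  define q where "q = exp (-x)"
  have "(\<lambda>l. A (2 * l + 2)) sums (x * (1 + q) / (2 * (1 - q)) - 1) \<longleftrightarrow> A sums (x * (1 + q) / (2 * (1 - q)) - 1)"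
  proof (rule sums_mono_reindex)
    show "strict_mono (\<lambda>l::nat. 2 * l + 2)" by (auto simp: strict_mono_def)
    fix n :: nat assume n: "n \<notin> range (\<lambda>l. 2 * l + 2)"
    have "n = 2 * (n div 2 - 1) + 2" if "even n" "n \<ge> 2" using that by (auto elim!: evenE)
    then show "A n = 0" using n by (auto simp: A_def)
  qed
  then have "A sums (x * (1 + q) / (2 * (1 - q)) - 1)"
    using sums_coth_power_series[OF False assms] by (simp add: A_def q_def)
  then have "(\<lambda>n. A n + ((if n = 0 then 1 else 0) + (if n = 1 then - x / 2 else 0))) sums
      ((x * (1 + q) / (2 * (1 - q)) - 1) + (1 + (- x / 2)))"
    by (intro sums_add sums_single)
  moreover have "A n + ((if n = 0 then 1 else 0) + (if n = 1 then - x / 2 else 0)) = bernoulli_coeff n * x ^ n" for n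
    by (auto simp: A_def bernoulli_coeff_def)
  moreover have "(x * (1 + q) / (2 * (1 - q)) - 1) + (1 + (- x / 2)) = x / (exp x - 1)"
  proof -
    show ?thesis using exp_neq_1_if_norm_less_1[OF False assms]
      by (simp add: q_def exp_minus divide_simps) (simp add: algebra_simps)
  qed
  ultimately show ?thesis using False by simp
qed

text \<open>Two power series that both give \<open>fps_X\<close> when multiplied by
  \<open>fps_exp 1 - 1\<close>. That factor is nonzero and the ring has no zero divisors, so they
  coincide.\<close>

lemma bernoulli_coeff_eq: "bernoulli_coeff n = of_real (bernoulli n / fact n)"
proof -
  define A where "A = Abs_fps bernoulli_coeff"
  have rad: "fps_conv_radius A \<ge> ereal (1 / 2)"
  proof -
    have "summable (\<lambda>n. bernoulli_coeff n * (1 / 2) ^ n)"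
      using sums_bernoulli_coeff[of "1/2"] by (auto simp: sums_iff)
    from conv_radius_geI[OF this] show ?thesis by (simp add: fps_conv_radius_def A_def)
  qed
  have evA: "eval_fps A x * (exp x - 1) = x" if "norm x < 1 / 2" for x
  proof -
    have "eval_fps A x = (if x = 0 then 1 else x / (exp x - 1))"
      unfolding eval_fps_def A_def fps_nth_Abs_fps using sums_bernoulli_coeff[of x] that by (simp add: sums_iff)
    moreover have "exp x \<noteq> 1" if "x \<noteq> 0"
      using exp_neq_1_if_norm_less_1[OF that] \<open>norm x < 1 / 2\<close> by simp
    ultimately show ?thesis by auto
  qed
  have "A * (fps_exp 1 - 1) = fps_X"
  proof (rule eval_fps_eqD)
    have r0: "fps_conv_radius A > 0" using rad by (rule less_le_trans[rotated]) simp
    have r1: "fps_conv_radius (fps_exp 1 - 1 :: complex fps) = \<infinity>"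
      using fps_conv_radius_diff[of "fps_exp 1" "1 :: complex fps"] by simp
    show "fps_conv_radius (A * (fps_exp 1 - 1)) > 0"
      using fps_conv_radius_mult[of A "fps_exp 1 - 1"] r0 r1 by (simp add: min_def split: if_splits)
    have "eventually (\<lambda>z. z \<in> ball 0 (1/2)) (nhds (0::complex))" by (intro eventually_nhds_in_open) auto
    then show "eventually (\<lambda>z. eval_fps (A * (fps_exp 1 - 1)) z = eval_fps fps_X z) (nhds 0)"
    proof eventually_elim
      case (elim z)
      then have nz: "norm z < 1/2" by simp
      then have "ereal (norm z) < ereal (1/2)" by simp
      then have "ereal (norm z) < fps_conv_radius A" using rad by (rule less_le_trans)
      then have "eval_fps (A * (fps_exp 1 - 1)) z = eval_fps A z * (exp z - 1)"
        using r1 by (simp add: eval_fps_mult eval_fps_diff)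
      then show ?case using evA[OF nz] by simp
    qed
  qed simp
  define B :: "real fps" where "B = fps_X / (fps_exp 1 - 1)"
  have nz: "fps_exp 1 - 1 \<noteq> (0 :: 'a :: field_char_0 fps)"
  proof
    assume "fps_exp 1 - 1 = (0 :: 'a fps)"
    then have "fps_nth (fps_exp 1 - 1) 1 = (0 :: 'a)" by simp
    then show False by simp
  qed
  have "B * (fps_exp 1 - 1) = fps_X"
  proof -
    have "subdegree (fps_exp 1 - 1 :: real fps) = 1" by (rule subdegreeI) auto
    then have "(fps_exp 1 - 1 :: real fps) dvd fps_X" using nz by (subst fps_dvd_iff) auto
    then show ?thesis unfolding B_def by (rule dvd_div_mult_self)
  qed
  \<comment> \<open>The real quotient defining \<open>bernoulli\<close>, moved to complex
    coefficients so that both solutions live in one ring.\<close>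
  define C where "C = Abs_fps (\<lambda>n. complex_of_real (fps_nth B n))"
  have "C * (fps_exp 1 - 1) = fps_X"
  proof (rule fps_ext)
    fix n
    have "fps_nth (C * (fps_exp 1 - 1)) n = of_real (fps_nth (B * (fps_exp 1 - 1)) n)"
      unfolding fps_mult_nth C_def by (simp add: of_real_sum) (intro sum.cong refl, auto)
    also have "\<dots> = fps_nth fps_X n" unfolding \<open>B * (fps_exp 1 - 1) = fps_X\<close> by (simp add: fps_X_def)
    finally show "fps_nth (C * (fps_exp 1 - 1)) n = fps_nth fps_X n" .
  qed
  then have "A * (fps_exp 1 - 1) = C * (fps_exp 1 - 1)" using \<open>A * _ = _\<close> by simp
  then have "A = C" using nz by (simp only: mult_cancel_right) simp
  then have "fps_nth A n = fps_nth C n" by simp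
  then show ?thesis by (simp add: A_def C_def B_def bernoulli_def)
qed

text \<open>The case n = 0 is included, with zeta 0 = -1/2 and B_0 = 1: it is what the two end terms
  of the Bernoulli sum evaluate.\<close>

lemma zeta_even:
  "zeta (of_nat (2 * n)) = of_real ((-1) ^ (n + 1) * bernoulli (2 * n) * (2 * pi) ^ (2 * n) / (2 * fact (2 * n)))"
proof (cases n)
  case 0
  have "bernoulli 0 = 1" using bernoulli_coeff_eq[of 0] by (simp add: bernoulli_coeff_def)
  then show ?thesis using zeta_0 0 by simp
next
  case (Suc l)
  define p where "p = (2 * complex_of_real pi) ^ (2 * n)"
  have p: "p \<noteq> 0" by (simp add: p_def)
  have "2 * (-1) ^ l * zeta (of_nat (2 * n)) / p = of_real (bernoulli (2 * n) / fact (2 * n))"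
    using bernoulli_coeff_eq[of "2 * n"] Suc by (simp add: bernoulli_coeff_def p_def)
  then have "2 * zeta (of_nat (2 * n)) = (-1) ^ l * (of_real (bernoulli (2 * n) / fact (2 * n)) * p)"
  proof -
    have "(-1) ^ l * (-1) ^ l = (1 :: complex)" by (simp flip: power_mult_distrib)
    then have "2 * zeta (of_nat (2 * n)) = (-1) ^ l * ((2 * (-1) ^ l * zeta (of_nat (2 * n)) / p) * p)"
      using p by (simp add: mult.assoc[symmetric])
    then show ?thesis unfolding \<open>2 * (-1) ^ l * _ / p = _\<close> .
  qed
  then have "zeta (of_nat (2 * n)) = (-1) ^ l * (of_real (bernoulli (2 * n) / fact (2 * n)) * p) / 2"
    by (simp add: field_simps)
  then show ?thesis unfolding Suc by (simp add: p_def Suc)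
qed

section \<open>Dirichlet series of the Piltz divisor function\<close>

text \<open>The fibres of \<open>prod_list\<close> on these tuples are counted by
  \<open>piltz_divisor\<close>; summing over all tuples instead gives a k-fold product.\<close>

definition factor_lists :: "nat \<Rightarrow> nat list set" where
  "factor_lists k = {xs. length xs = k \<and> (\<forall>x\<in>set xs. x > 0)}"

lemma factor_lists_Suc: "factor_lists (Suc k) = (\<lambda>(x, xs). x # xs) ` ({0<..} \<times> factor_lists k)"
  by (auto simp: factor_lists_def length_Suc_conv image_iff)

lemma finite_factor_lists_prod: 
  assumes "n > 0"
  shows "finite {xs \<in> factor_lists k. prod_list xs = n}"
proof (rule finite_subset)
  show "{xs \<in> factor_lists k. prod_list xs = n} \<subseteq> {xs. set xs \<subseteq> {..n} \<and> length xs = k}"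
  proof
    fix xs assume "xs \<in> {xs \<in> factor_lists k. prod_list xs = n}"
    then have xs: "length xs = k" "prod_list xs = n" by (auto simp: factor_lists_def)
    have "x \<le> n" if "x \<in> set xs" for x
    proof (rule dvd_imp_le[OF _ assms])
      from that have "x dvd prod_list xs" by (induction xs) auto
      then show "x dvd n" by (simp only: xs(2))
    qed
    then show "xs \<in> {xs. set xs \<subseteq> {..n} \<and> length xs = k}" using xs(1) by auto
  qed
  show "finite {xs. set xs \<subseteq> {..n} \<and> length xs = k}" by (rule finite_lists_length_eq) simp
qed

lemma prod_list_pos: "xs \<in> factor_lists k \<Longrightarrow> prod_list xs > 0"
  by (rule gr0I) (auto simp: factor_lists_def prod_list_zero_iff)

text \<open>Unordered summability of complex families is absolute, so the product family is summable
  and Fubini applies.\<close>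

lemma has_sum_product_banach:
  fixes f g :: "_ \<Rightarrow> complex"
  assumes "(f has_sum a) A" "(g has_sum b) B"
  shows "((\<lambda>(x, y). f x * g y) has_sum (a * b)) (A \<times> B)"
proof -
  have f: "(\<lambda>x. norm (f x)) summable_on A" and g: "(\<lambda>x. norm (g x)) summable_on B"
    using assms summable_on_iff_abs_summable_on_complex by (auto simp: summable_on_def)
  have abs: "(\<lambda>z. norm (case z of (x, y) \<Rightarrow> f x * g y)) summable_on A \<times> B"
    unfolding Infinite_Sum.abs_summable_on_Sigma_iff
  proof (intro conjI ballI)
    show "(\<lambda>y. norm (case (x, y) of (x, y) \<Rightarrow> f x * g y)) summable_on B" for x
      using summable_on_cmult_right[OF g, of "norm (f x)"] by (simp add: norm_mult)
    have "(\<lambda>x. norm (f x) * infsum (\<lambda>y. norm (g y)) B) summable_on A"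
      using f by (rule summable_on_cmult_left)
    then show "(\<lambda>x. norm (infsum (\<lambda>y. norm (case (x, y) of (x, y) \<Rightarrow> f x * g y)) B)) summable_on A"
      unfolding summable_on_iff_abs_summable_on_real[symmetric] by (simp add: norm_mult infsum_cmult_right')
  qed
  then have s: "(\<lambda>(x, y). f x * g y) summable_on A \<times> B"
    by (subst summable_on_iff_abs_summable_on_complex)
  have "infsum (\<lambda>(x, y). f x * g y) (A \<times> B) = infsum (\<lambda>x. infsum (\<lambda>y. f x * g y) B) A"
    using infsum_Sigma_banach[OF s] by simp
  also have "\<dots> = a * b"
    using assms by (simp add: infsum_cmult_right' infsum_cmult_left' infsumI)
  finally show ?thesis using s by (metis has_sum_infsum)
qed

lemma has_sum_zeta:
  assumes "Re s > 1"
  shows "((\<lambda>n::nat. 1 / of_nat n powr s) has_sum zeta s) {0<..}"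
proof -
  have "norm (1 / of_nat (Suc n) powr s) = real (Suc n) powr (- Re s)" for n
    using norm_powr_real_powr[of "of_nat (Suc n)" s]
    by (simp add: norm_divide powr_minus_divide del: of_nat_Suc)
  then have "((\<lambda>n. 1 / of_nat (Suc n) powr s) has_sum zeta s) UNIV"
    using assms by (intro norm_summable_imp_has_sum sums_zeta) (simp_all only: summable_Suc_powr)
  moreover have "{0<..} = range Suc" by (auto simp: image_iff gr0_conv_Suc)
  ultimately show ?thesis by (simp add: has_sum_reindex o_def)
qed

lemma has_sum_factor_lists:
  assumes "Re s > 1"
  shows "((\<lambda>xs. 1 / of_nat (prod_list xs) powr s) has_sum zeta s ^ k) (factor_lists k)"
proof (induction k)
  case 0
  have "factor_lists 0 = {[]}" by (auto simp: factor_lists_def)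
  then show ?case using has_sum_finite[of "{[]}" "\<lambda>xs. 1 / of_nat (prod_list xs) powr s"] by simp
next
  case (Suc k)
  have "((\<lambda>(x, xs). 1 / of_nat x powr s * (1 / of_nat (prod_list xs) powr s)) has_sum zeta s * zeta s ^ k)
     ({0<..} \<times> factor_lists k)"
    by (rule has_sum_product_banach[OF has_sum_zeta[OF assms] Suc])
  moreover have "(\<lambda>(x, xs). 1 / of_nat x powr s * (1 / of_nat (prod_list xs) powr s)) =
     (\<lambda>xs. 1 / of_nat (prod_list xs) powr s) \<circ> (\<lambda>(x, xs). x # xs)"
    by (auto simp: fun_eq_iff powr_times_real)
  moreover have "inj_on (\<lambda>(x, xs). x # xs) ({0<..} \<times> factor_lists k)" by (auto simp: inj_on_def)
  ultimately show ?case unfolding factor_lists_Suc by (simp add: has_sum_reindex)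
qed

lemma has_sum_piltz_divisor:
  assumes "Re s > 1"
  shows "((\<lambda>n. of_nat (piltz_divisor k n) / of_nat n powr s) has_sum zeta s ^ k) {0<..}"
proof -
  \<comment> \<open>Regrouping the tuples by their product; each fibre is finite and the summand is
    constant on it.\<close>
  define Fib where "Fib = (\<lambda>n. {xs \<in> factor_lists k. prod_list xs = n})"
  have inj: "inj_on snd (Sigma {0<..} Fib)" by (auto simp: inj_on_def Fib_def)
  have "snd ` Sigma {0<..} Fib = factor_lists k"
    by (force simp: Fib_def image_iff prod_list_pos)
  then have "((\<lambda>xs. 1 / of_nat (prod_list xs) powr s) has_sum zeta s ^ k) (snd ` Sigma {0<..} Fib)"
    using has_sum_factor_lists[OF assms, of k] by simp
  then have *: "((\<lambda>xs. 1 / of_nat (prod_list xs) powr s) \<circ> snd has_sum zeta s ^ k) (Sigma {0<..} Fib)"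
    by (simp only: has_sum_reindex[OF inj])
  show ?thesis
  proof (rule has_sum_Sigma[OF _ *])
    show "uniformly_continuous_on UNIV (\<lambda>(x::complex, y). x + y)"
      by (rule isUCont_plus) 
    fix n :: nat assume n: "n \<in> {0<..}"
    have "((\<lambda>_. 1 / of_nat n powr s) has_sum of_nat (card (Fib n)) * (1 / of_nat n powr s)) (Fib n)"
      using n unfolding Fib_def by (intro has_sum_constant finite_factor_lists_prod) auto
    moreover have "card (Fib n) = piltz_divisor k n"
      by (simp add: Fib_def piltz_divisor_def factor_lists_def conj_assoc)
    ultimately show "((\<lambda>y. ((\<lambda>xs. 1 / of_nat (prod_list xs) powr s) \<circ> snd) (n, y)) has_sum
       of_nat (piltz_divisor k n) / of_nat n powr s) (Fib n)"
      by (subst has_sum_cong[of _ _ "\<lambda>_. 1 / of_nat n powr s"]) (auto simp: Fib_def)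
  qed
qed

lemma
  assumes "Re s > 1"
  shows sums_piltz_divisor: "(\<lambda>n. of_nat (piltz_divisor k (Suc n)) / of_nat (Suc n) powr s) sums zeta s ^ k"
    and summable_norm_piltz_divisor: "summable (\<lambda>n. norm (of_nat (piltz_divisor k (Suc n)) / of_nat (Suc n) powr (s :: complex)))"
proof -
  have "{0<..} = range Suc" by (auto simp: image_iff gr0_conv_Suc)
  then have *: "((\<lambda>n. of_nat (piltz_divisor k (Suc n)) / of_nat (Suc n) powr s) has_sum zeta s ^ k) UNIV"
    using has_sum_piltz_divisor[OF assms, of k] by (simp add: has_sum_reindex o_def)
  then show "(\<lambda>n. of_nat (piltz_divisor k (Suc n)) / of_nat (Suc n) powr s) sums zeta s ^ k"
    by (rule has_sum_imp_sums)
  from * have "(\<lambda>n. norm (of_nat (piltz_divisor k (Suc n)) / of_nat (Suc n) powr (s :: complex))) summable_on UNIV"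
    unfolding summable_on_iff_abs_summable_on_complex[symmetric] by (auto simp: summable_on_def)
  then obtain S where "((\<lambda>n. norm (of_nat (piltz_divisor k (Suc n)) / of_nat (Suc n) powr (s :: complex))) has_sum S) UNIV"
    by (auto simp: summable_on_def)
  from has_sum_imp_sums[OF this] show "summable (\<lambda>n. norm (of_nat (piltz_divisor k (Suc n)) / of_nat (Suc n) powr (s :: complex)))"
    by (rule sums_summable)
qed

section \<open>The Meijer G-function as a Mellin integral\<close>

definition mellin_kernel :: "nat \<Rightarrow> complex \<Rightarrow> complex" where
  "mellin_kernel k w = Gamma w ^ k * cos (of_real pi * w / 2) ^ (k - 1)"

text \<open>This is 2 pi times the inverse Mellin transform of the kernel, since neither 1 / (2 pi
  i) nor ds = i dt is included.\<close>

definition mellin_line :: "real \<Rightarrow> nat \<Rightarrow> real \<Rightarrow> complex" where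
  "mellin_line c k x = (\<integral>t. mellin_kernel k (Complex c t) * of_real x powr (- Complex c t) \<partial>lborel)"

lemma exp_growth_mellin_kernel:
  assumes "k \<ge> 1"
  shows "exp_growth a b (- (pi / 2)) (mellin_kernel k)"
proof -
  have "exp_growth a b (real k * (- (pi / 2)) + real (k - 1) * (pi / 2)) (mellin_kernel k)"
    unfolding mellin_kernel_def
    by (intro exp_growth_mult exp_growth_power exp_growth_Gamma exp_growth_cos_half_pi)
  also have "real k * (- (pi / 2)) + real (k - 1) * (pi / 2) = - (pi / 2)"
    using assms by (cases k) (auto simp: field_simps)
  finally show ?thesis .
qed

lemma exp_growth_mult_powr:
  assumes "exp_growth a b r f" "x > 0"
  shows "exp_growth a b r (\<lambda>w. f w * of_real x powr (- w))"
  using exp_growth_mult[OF assms(1) exp_growth_powr[OF assms(2), of a b]] by simp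

lemma holomorphic_mellin_kernel [holomorphic_intros]:
  "mellin_kernel k holomorphic_on A" if "\<And>w. w \<in> A \<Longrightarrow> Re w > 0"
  unfolding mellin_kernel_def using that by (intro holomorphic_intros) (auto intro!: not_nonpos_IntsI)

lemma continuous_on_line:
  assumes "f holomorphic_on A" "\<And>t. Complex c t \<in> A"
  shows "continuous_on UNIV (\<lambda>t. f (Complex c t))"
  by (rule continuous_on_compose2[OF holomorphic_on_imp_continuous_on[OF assms(1)] continuous_on_Complex_line])
     (use assms(2) in auto)

text \<open>The kernel has no pole for Re w > 0. An arbitrary \<open>\<mu> < 0\<close> corresponds
  to the line -2 \<open>\<mu>\<close>, which may lie left of 1; this frees the choice of a line on
  which the Dirichlet series converge.\<close>

lemma mellin_line_indep:
  assumes "k \<ge> 1" "0 < c" "0 < c'" "x > 0"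
  shows "mellin_line c k x = mellin_line c' k x"
proof -
  have less: "mellin_line c k x = mellin_line c' k x" if "0 < c" "c < c'" for c c'
  proof -
    have "(\<lambda>w. mellin_kernel k w * of_real x powr (- w)) holomorphic_on {z. c / 2 < Re z \<and> Re z < c' + 1} - {}"
      using that assms by (intro holomorphic_intros) auto
    from contour_shift(3)[OF _ that(2) _ _ _ this exp_growth_mult_powr[OF exp_growth_mellin_kernel[OF assms(1)] assms(4)]]
    show ?thesis using that by (simp add: mellin_line_def)
  qed
  consider "c < c'" | "c = c'" | "c' < c" by linarith
  then show ?thesis
  proof cases
    case 1 then show ?thesis by (rule less[OF assms(2)])
  next
    case 2 then show ?thesis by simp
  next
    case 3 then show ?thesis by (rule less[OF assms(3), symmetric])
  qed
qed

lemma meijer_integrand_eq: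
  assumes "Re w > 0" "y > 0" "k \<ge> 1"
  defines "s \<equiv> - w / 2"
  shows "Gamma (- s) ^ k * Gamma (1/2 - s) / Gamma (1/2 + s) ^ (k - 1) * of_real (y\<^sup>2 / 2 ^ (2 * k)) powr s =
    of_real (2 ^ k * sqrt pi ^ k / pi ^ (k - 1)) * (mellin_kernel k w * of_real y powr (- w))"
proof -
  let ?M = "Gamma (- s) ^ k * Gamma (1/2 - s) / Gamma (1/2 + s) ^ (k - 1)" and ?Y = "of_real (y\<^sup>2 / 2 ^ (2 * k)) powr s"
  let ?u = "exp (of_nat k * ((1 - w) * of_real (ln 2)))" and ?v = "exp (of_nat k * (w * of_real (ln 2)))"
  define a b where "a = Gamma (w / 2)" and "b = Gamma (w / 2 + 1 / 2)"
  have ni: "w / 2 \<notin> \<int>\<^sub>\<le>\<^sub>0" "w / 2 + 1 / 2 \<notin> \<int>\<^sub>\<le>\<^sub>0" using assms by (auto intro!: not_nonpos_IntsI)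
  have ab: "a * b = exp ((1 - w) * of_real (ln 2)) * of_real (sqrt pi) * Gamma w"
    unfolding a_def b_def using Gamma_legendre_duplication[OF ni] by simp
  have b0: "b \<noteq> 0" using ni by (simp add: b_def Gamma_eq_zero_iff)
  have "rGamma (1/2 + s) * rGamma (1 - (1/2 + s)) = sin (of_real pi * (1/2 + s)) / of_real pi"
    by (rule rGamma_reflection_complex)
  moreover have "1 - (1/2 + s) = w / 2 + 1 / 2" by (simp add: s_def field_simps)
  moreover have "sin (of_real pi * (1/2 + s)) = cos (of_real pi * w / 2)"
  proof -
    have "of_real pi * (1/2 + s) = of_real (pi / 2) - of_real pi * w / 2"
      by (simp add: s_def distrib_left right_diff_distrib)
    then show ?thesis by (simp only: sin_diff sin_of_real cos_of_real sin_pi_half cos_pi_half) simp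
  qed
  ultimately have rG: "rGamma (1/2 + s) * inverse b = cos (of_real pi * w / 2) / of_real pi"
    by (simp add: b_def rGamma_inverse_Gamma)
  \<comment> \<open>Valid at the poles of Gamma too, where \<open>inverse (Gamma _)\<close> and
    \<open>rGamma\<close> are both 0.\<close>
  have "inverse (Gamma (1/2 + s)) = b * (rGamma (1/2 + s) * inverse b)"
    using b0 by (simp add: rGamma_inverse_Gamma)
  then have r: "inverse (Gamma (1/2 + s)) = b * cos (of_real pi * w / 2) / of_real pi"
    unfolding rG by simp
  define C where "C = cos (of_real pi * w / 2)"
  have k: "k = Suc (k - 1)" using assms by simp
  have "?M =
      a ^ k * b * (inverse (Gamma (1/2 + s))) ^ (k - 1)"
  proof -
    have "p / X ^ n = p * inverse X ^ n" for p X :: complex and n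
      by (simp add: divide_inverse power_inverse)
    moreover have "- s = w / 2" "1 / 2 - s = w / 2 + 1 / 2" by (simp_all add: s_def)
    ultimately show ?thesis by (simp only: a_def b_def)
  qed
  \<comment> \<open>Reflection turns each of the k - 1 denominators into one more factor
    \<open>b\<close>, so \<open>a\<close> and \<open>b\<close> both occur k times and duplication
    merges each pair into Gamma w.\<close>
  also have "\<dots> = (a * b) ^ k * C ^ (k - 1) / of_real pi ^ (k - 1)"
  proof -
    have "a ^ Suc n * b * (b * C / P) ^ n = (a * b) ^ Suc n * C ^ n / P ^ n" for n and P :: complex
      by (simp add: power_mult_distrib power_divide)
    from this[of "k - 1" "of_real pi"] show ?thesis unfolding r C_def[symmetric] k[symmetric] .
  qed
  also have "\<dots> = ?u * of_real (sqrt pi) ^ k / of_real pi ^ (k - 1) * mellin_kernel k w"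
    unfolding ab mellin_kernel_def C_def by (simp add: power_mult_distrib exp_of_nat_mult)
  finally have A: "?M =
      ?u * of_real (sqrt pi) ^ k / of_real pi ^ (k - 1) * mellin_kernel k w" .
  have B: "?Y = of_real y powr (- w) * ?v"
  proof -
    have "ln (y\<^sup>2 / 2 ^ (2 * k)) = 2 * ln y - 2 * real k * ln 2"
      using assms by (simp add: ln_div ln_realpow)
    moreover have "of_real Y powr s = exp (s * of_real (ln Y))" if "Y > 0" for Y
      using that by (simp add: powr_def Ln_of_real)
    moreover have "y\<^sup>2 / 2 ^ (2 * k) > 0" using assms by simp
    ultimately have "?Y = exp (s * of_real (2 * ln y - 2 * real k * ln 2))"
      by metis
    also have "s * of_real (2 * ln y - 2 * real k * ln 2) = - w * of_real (ln y) + of_nat k * (w * of_real (ln 2))"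
      by (simp add: s_def algebra_simps)
    also have "exp \<dots> = of_real y powr (- w) * ?v"
      unfolding exp_add using assms by (simp add: powr_def Ln_of_real)
    finally show ?thesis .
  qed
  have "?M * ?Y =
     ?u * ?v * 
     (of_real (sqrt pi) ^ k / of_real pi ^ (k - 1)) * (mellin_kernel k w * of_real y powr (- w))"
    unfolding A B by (simp add: mult_ac)
  \<comment> \<open>The factor 2^(k (1 - w)) from duplication meets 2^(k w) from the argument of the
    G-function, so the dependence on w cancels.\<close>
  also have "?u * ?v = (2 ^ k :: complex)"
  proof -
    have "of_nat k * ((1 - w) * of_real (ln 2)) + of_nat k * (w * of_real (ln 2)) = of_nat k * complex_of_real (ln 2)"
      by (simp add: algebra_simps)
    moreover have "exp (of_nat k * complex_of_real (ln 2)) = 2 ^ k"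
      by (simp add: exp_of_nat_mult exp_of_real)
    ultimately show ?thesis by (simp flip: exp_add)
  qed
  finally show ?thesis by simp
qed

lemma meijer_G_eq_mellin_line:
  assumes "\<mu> < 0" "y > 0" "k \<ge> 1"
  shows "meijer_G \<mu> k (y\<^sup>2 / 2 ^ (2 * k)) =
    of_real (2 ^ k * sqrt pi ^ k / pi ^ (k - 1) / (4 * pi)) * mellin_line (-2 * \<mu>) k y"
proof -
  define f :: "complex \<Rightarrow> complex" where "f = (\<lambda>s. Gamma (- s) ^ k * Gamma (1/2 - s) / Gamma (1/2 + s) ^ (k - 1) * of_real (y\<^sup>2 / 2 ^ (2 * k)) powr s)"
  define D where "D = complex_of_real (2 ^ k * sqrt pi ^ k / pi ^ (k - 1))"
  have "meijer_G \<mu> k (y\<^sup>2 / 2 ^ (2 * k)) = 1 / (2 * of_real pi * \<i>) * (\<integral>t. f (Complex \<mu> t) * \<i> \<partial>lborel)"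
    by (simp add: meijer_G_def f_def Let_def)
  also have "(\<integral>t. f (Complex \<mu> t) * \<i> \<partial>lborel) = (\<integral>t. f (Complex \<mu> t) \<partial>lborel) * \<i>"
    by (rule integral_mult_left_zero)
  \<comment> \<open>The substitution w = -2s reads t = -v/2 on the line; its Jacobian 1/2 turns 1 /
    (2 pi) into 1 / (4 pi).\<close>
  also have "(\<integral>t. f (Complex \<mu> t) \<partial>lborel) = \<bar>- 1 / 2\<bar> *\<^sub>R (\<integral>v. f (Complex \<mu> (0 + (- 1 / 2) * v)) \<partial>lborel)"
    by (rule lborel_integral_real_affine) simp
  also have "(\<lambda>v. f (Complex \<mu> (0 + (- 1 / 2) * v))) = (\<lambda>v. D * (mellin_kernel k (Complex (-2 * \<mu>) v) * of_real y powr (- Complex (-2 * \<mu>) v)))"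
  proof
    fix v
    have "Complex \<mu> (0 + (- 1 / 2) * v) = - Complex (-2 * \<mu>) v / 2" by (simp add: complex_eq_iff)
    then show "f (Complex \<mu> (0 + (- 1 / 2) * v)) = D * (mellin_kernel k (Complex (-2 * \<mu>) v) * of_real y powr (- Complex (-2 * \<mu>) v))"
      using meijer_integrand_eq[of "Complex (-2 * \<mu>) v" y k] assms by (simp add: f_def D_def)
  qed
  also have "(\<integral>v. D * (mellin_kernel k (Complex (-2 * \<mu>) v) * of_real y powr (- Complex (-2 * \<mu>) v)) \<partial>lborel) = D * mellin_line (-2 * \<mu>) k y"
    unfolding mellin_line_def by (rule integral_mult_right_zero)
  finally show ?thesis by (simp add: D_def scaleR_conv_of_real field_simps)
qed

section \<open>Summation of the divisor series under the integral\<close>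

text \<open>On a vertical line |n^(-w)| does not depend on t, so the norm of the n-th term splits as
  |g t| times a summable constant; this justifies the exchange for any integrable
  \<open>g\<close>.\<close>

lemma sums_piltz_integral:
  assumes "c > 1" and g: "integrable lborel g"
  shows "(\<lambda>n. of_nat (piltz_divisor k (Suc n)) * (\<integral>t. g t * of_nat (Suc n) powr (- Complex c t) \<partial>lborel)) sums
    (\<integral>t. g t * zeta (Complex c t) ^ k \<partial>lborel)"
proof -
  define f where "f = (\<lambda>n t. g t * (of_nat (piltz_divisor k (Suc n)) / of_nat (Suc n) powr Complex c t))"
  define d where "d = (\<lambda>n. norm (of_nat (piltz_divisor k (Suc n)) / of_nat (Suc n) powr complex_of_real c))"
  have sd: "summable d" unfolding d_def using assms by (intro summable_norm_piltz_divisor) auto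
  have nf: "norm (f n t) = norm (g t) * d n" for n t
    using norm_powr_real_powr[of "of_nat (Suc n)" "Complex c t"] norm_powr_real_powr[of "of_nat (Suc n)" "complex_of_real c"]
    by (simp add: f_def d_def norm_mult norm_divide del: of_nat_Suc)
  have meas: "f n \<in> borel_measurable lborel" for n
  proof -
    have "continuous_on UNIV (\<lambda>t. of_nat (piltz_divisor k (Suc n)) / of_nat (Suc n) powr Complex c t)"
      by (rule continuous_on_line[of "\<lambda>w. of_nat (piltz_divisor k (Suc n)) / of_nat (Suc n) powr w" UNIV])
         (auto intro!: holomorphic_intros simp del: of_nat_Suc)
    from borel_measurable_continuous_onI[OF this]
    have "(\<lambda>t. of_nat (piltz_divisor k (Suc n)) / of_nat (Suc n) powr Complex c t) \<in> borel_measurable lborel"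
      by simp
    then show ?thesis
      unfolding f_def by (rule borel_measurable_times[OF borel_measurable_integrable[OF g]])
  qed
  have int_f: "integrable lborel (f n)" for n
    by (rule Bochner_Integration.integrable_bound[OF integrable_mult_left[OF integrable_norm[OF g], of "d n"] meas])
       (auto simp: nf)
  have "(\<lambda>n. integral\<^sup>L lborel (f n)) sums (\<integral>t. (\<Sum>n. f n t) \<partial>lborel)"
  proof (rule sums_integral[OF int_f])
    show "AE t in lborel. summable (\<lambda>n. norm (f n t))"
      unfolding nf by (intro AE_I2 summable_mult sd)
    show "summable (\<lambda>n. \<integral>t. norm (f n t) \<partial>lborel)"
      unfolding nf by (simp add: sd)
  qed
  also have "(\<lambda>t. \<Sum>n. f n t) = (\<lambda>t. g t * zeta (Complex c t) ^ k)"
  proof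
    fix t
    have "(\<lambda>n. f n t) sums (g t * zeta (Complex c t) ^ k)"
      unfolding f_def using assms by (intro sums_mult sums_piltz_divisor) auto
    then show "(\<Sum>n. f n t) = g t * zeta (Complex c t) ^ k" by (simp add: sums_iff)
  qed
  also have "(\<lambda>n. integral\<^sup>L lborel (f n)) = (\<lambda>n. of_nat (piltz_divisor k (Suc n)) * (\<integral>t. g t * of_nat (Suc n) powr (- Complex c t) \<partial>lborel))"
  proof
    fix n
    have "f n = (\<lambda>t. of_nat (piltz_divisor k (Suc n)) * (g t * of_nat (Suc n) powr (- Complex c t)))"
      by (simp add: f_def fun_eq_iff powr_minus_divide del: of_nat_Suc)
    then show "integral\<^sup>L lborel (f n) = of_nat (piltz_divisor k (Suc n)) * (\<integral>t. g t * of_nat (Suc n) powr (- Complex c t) \<partial>lborel)"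
      by (simp only: integral_mult_right_zero)
  qed
  finally show ?thesis .
qed

lemma powr_mult_pos_real:
  "x > 0 \<Longrightarrow> y > 0 \<Longrightarrow> complex_of_real (x * y) powr z = of_real x powr z * of_real y powr z"
  using powr_times_real[of "of_real x" "of_real y" z] by simp

lemma integrable_mellin_kernel_zeta:
  assumes "c > 1" "x > 0" "k \<ge> 1"
  shows "integrable lborel (\<lambda>t. mellin_kernel k (Complex c t) * zeta (Complex c t) ^ l * of_real x powr (- Complex c t))"
proof -
  have hol: "(\<lambda>w. mellin_kernel k w * zeta w ^ l * of_real x powr (- w)) holomorphic_on {w. Re w > 1}"
    using assms by (intro holomorphic_intros) auto
  have gr: "exp_growth c c (- (pi / 2) + real l * 0) (\<lambda>w. mellin_kernel k w * zeta w ^ l * of_real x powr (- w))"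
    using assms by (intro exp_growth_mult_powr exp_growth_mult exp_growth_power exp_growth_zeta exp_growth_mellin_kernel)
  show ?thesis
    by (rule exp_growth_line_integrable[OF gr _ order_refl order_refl continuous_on_line[OF hol]]) (use assms in auto)
qed

lemma sums_mellin_line:
  assumes "c > 1" "y > 0" "k \<ge> 1"
  shows "(\<lambda>j. of_nat (piltz_divisor k (Suc j)) * mellin_line c k (y * real (Suc j))) sums
    (\<integral>t. mellin_kernel k (Complex c t) * zeta (Complex c t) ^ k * of_real y powr (- Complex c t) \<partial>lborel)"
proof -
  have "(\<lambda>j. of_nat (piltz_divisor k (Suc j)) * (\<integral>t. mellin_kernel k (Complex c t) * of_real y powr (- Complex c t) * of_nat (Suc j) powr (- Complex c t) \<partial>lborel)) sums
    (\<integral>t. mellin_kernel k (Complex c t) * of_real y powr (- Complex c t) * zeta (Complex c t) ^ k \<partial>lborel)"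
    using integrable_mellin_kernel_zeta[OF assms, of 0] assms by (intro sums_piltz_integral) auto
  moreover have "mellin_line c k (y * real (Suc j)) = (\<integral>t. mellin_kernel k (Complex c t) * of_real y powr (- Complex c t) * of_nat (Suc j) powr (- Complex c t) \<partial>lborel)" for j
    unfolding mellin_line_def using powr_mult_pos_real[OF assms(2), of "real (Suc j)"]
    by (simp add: mult.assoc del: of_nat_Suc)
  ultimately show ?thesis by (simp only: mult_ac)
qed

lemma sums_mellin_line_Psi:
  assumes "\<mu> < 0" "\<rho> > 0" "x > 0" "k \<ge> 1" "c > 1"
  shows "(\<lambda>j. of_nat (piltz_divisor k (Suc j)) * mellin_line c k (\<rho> * x * real (Suc j)) / (2 * of_real pi)) sums Psi \<mu> \<rho> k x"
proof -
  define D where "D = 2 ^ k * sqrt pi ^ k / pi ^ (k - 1) / (4 * pi)"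
  define E where "E = pi powr (real k / 2 - 1) / 2 ^ (k - 1)"
  have G: "meijer_G \<mu> k (\<rho>\<^sup>2 * (real (Suc j))\<^sup>2 * x\<^sup>2 / 2 ^ (2 * k)) = of_real D * mellin_line c k (\<rho> * x * real (Suc j))" for j
  proof -
    have y: "\<rho> * x * real (Suc j) > 0" using assms by simp
    have "\<rho>\<^sup>2 * (real (Suc j))\<^sup>2 * x\<^sup>2 = (\<rho> * x * real (Suc j))\<^sup>2" by (simp add: power_mult_distrib mult_ac)
    then show ?thesis
      using meijer_G_eq_mellin_line[OF assms(1) y assms(4)] mellin_line_indep[OF assms(4) _ _ y, of "-2 * \<mu>" c] assms
      by (simp add: D_def)
  qed
  \<comment> \<open>The normalisation in \<open>Psi\<close> exactly cancels the constants from
    duplication and reflection, leaving the factor of the inverse Mellin transform.\<close>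
  have ED: "D * E = 1 / (2 * pi)"
  proof -
    have "sqrt pi ^ k = pi powr (real k / 2)"
      by (simp add: powr_half_sqrt[symmetric] powr_powr flip: powr_realpow)
    moreover have "pi ^ (k - 1) = pi powr (real k - 1)"
      using assms by (simp add: powr_realpow[symmetric] of_nat_diff)
    moreover have "pi powr (real k / 2) * pi powr (real k / 2 - 1) = pi powr (real k - 1)"
      by (simp flip: powr_add)
    moreover have "(2::real) ^ k = 2 * 2 ^ (k - 1)" using assms by (cases k) auto
    ultimately show ?thesis by (simp add: D_def E_def field_simps)
  qed
  define h where "h = (\<lambda>j. of_nat (piltz_divisor k (Suc j)) * mellin_line c k (\<rho> * x * real (Suc j)))"
  have s: "summable h"
    unfolding h_def by (rule sums_summable, rule sums_mellin_line) (use assms in auto)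
  have "Psi \<mu> \<rho> k x = of_real E * (\<Sum>j. of_real D * h j)"
    unfolding Psi_def G E_def h_def by (simp add: mult_ac)
  also have "\<dots> = of_real (D * E) * suminf h"
    by (subst suminf_mult[OF s]) simp
  finally have "Psi \<mu> \<rho> k x = suminf h / (2 * of_real pi)" unfolding ED by simp
  then show ?thesis using sums_divide[OF summable_sums[OF s], of "2 * of_real pi"] by (simp add: h_def)
qed

lemma Psi_eq_integral:
  assumes "\<mu> < 0" "\<rho> > 0" "x > 0" "k \<ge> 1" "c > 1"
  shows "Psi \<mu> \<rho> k x = (\<integral>t. mellin_kernel k (Complex c t) * zeta (Complex c t) ^ k *
     of_real (\<rho> * x) powr (- Complex c t) \<partial>lborel) / (2 * of_real pi)"
proof (rule sums_unique2[OF sums_mellin_line_Psi[OF assms]])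
  show "(\<lambda>j. of_nat (piltz_divisor k (Suc j)) * mellin_line c k (\<rho> * x * real (Suc j)) / (2 * of_real pi)) sums
    ((\<integral>t. mellin_kernel k (Complex c t) * zeta (Complex c t) ^ k * of_real (\<rho> * x) powr (- Complex c t) \<partial>lborel) / (2 * of_real pi))"
    by (intro sums_divide sums_mellin_line) (use assms in auto)
qed

text \<open>The weight n^(-(2m+1)) moves the second Dirichlet series to the line c + 2m + 1; the
  hypotheses put both that line and \<open>c\<close> to the right of 1.\<close>

lemma sums_Psi:
  assumes "\<mu> < 0" "\<rho> > 0" "k \<ge> 1" "c > 1" "c + 2 * of_int m > 0"
  shows "(\<lambda>n. of_nat (piltz_divisor k (Suc n)) / of_nat (Suc n) powi (2 * m + 1) * Psi \<mu> \<rho> k (real (Suc n)))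
    sums ((\<integral>t. mellin_kernel k (Complex c t) * zeta (Complex c t) ^ k * of_real \<rho> powr (- Complex c t) *
       zeta (of_int (2 * m + 1) + Complex c t) ^ k \<partial>lborel) / (2 * of_real pi))"
proof -
  define g where "g = (\<lambda>t. mellin_kernel k (Complex c t) * zeta (Complex c t) ^ k * of_real \<rho> powr (- Complex c t))"
  define c' where "c' = c + of_int (2 * m + 1)"
  have c': "c' > 1" using assms by (simp add: c'_def)
  have cc: "Complex c' t = of_int (2 * m + 1) + Complex c t" for t by (simp add: c'_def complex_eq_iff)
  have "(\<lambda>n. of_nat (piltz_divisor k (Suc n)) * (\<integral>t. g t * of_nat (Suc n) powr (- Complex c' t) \<partial>lborel) / (2 * of_real pi)) sums
    ((\<integral>t. g t * zeta (Complex c' t) ^ k \<partial>lborel) / (2 * of_real pi))"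
    unfolding g_def using assms
    by (intro sums_divide sums_piltz_integral[OF c'] integrable_mellin_kernel_zeta) auto
  moreover have "of_nat (piltz_divisor k (Suc n)) / of_nat (Suc n) powi (2 * m + 1) * Psi \<mu> \<rho> k (real (Suc n)) =
     of_nat (piltz_divisor k (Suc n)) * (\<integral>t. g t * of_nat (Suc n) powr (- Complex c' t) \<partial>lborel) / (2 * of_real pi)" for n
  proof -
    define N where "N = complex_of_nat (Suc n)"
    have N: "N \<noteq> 0" unfolding N_def by (simp del: of_nat_Suc)
    have p: "N powr (- Complex c' t) = N powr (- Complex c t) / N powi (2 * m + 1)" for t
    proof -
      have "- Complex c' t = - Complex c t - of_int (2 * m + 1)" unfolding cc by simp
      then show ?thesis using N complex_powr_of_int[of N "2 * m + 1"] by (simp only: powr_diff) simp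
    qed
    have "Psi \<mu> \<rho> k (real (Suc n)) = (\<integral>t. g t * N powr (- Complex c t) \<partial>lborel) / (2 * of_real pi)"
      using Psi_eq_integral[OF assms(1,2) _ assms(3,4), of "real (Suc n)"] powr_mult_pos_real[OF assms(2), of "real (Suc n)"]
      by (simp add: g_def N_def mult.assoc del: of_nat_Suc)
    moreover have "(\<integral>t. g t * N powr (- Complex c' t) \<partial>lborel) = (\<integral>t. g t * N powr (- Complex c t) \<partial>lborel) / N powi (2 * m + 1)"
      unfolding p times_divide_eq_right by (rule integral_divide_zero)
    ultimately show ?thesis by (simp add: N_def)
  qed
  ultimately show ?thesis by (simp only: g_def cc)
qed

section \<open>The case k = 1: the inverse Mellin transform of Gamma\<close>

text \<open>Walking left from Re = 1/2, each unit step divides Gamma by a number of modulus at least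
  1/2 + N; these lower bounds multiply to the Pochhammer symbol, uniformly in t.\<close>

lemma norm_Gamma_left_le:
  "norm (Gamma (Complex (1/2 - real N) t)) * pochhammer (1/2) N \<le> norm (Gamma (Complex (1/2) t))"
proof (induction N)
  case (Suc N)
  define z where "z = Complex (1/2 - real (Suc N)) t"
  \<comment> \<open>The real part is half an odd integer, so the recursion of Gamma never meets a
    pole.\<close>
  have "z \<notin> \<int>\<^sub>\<le>\<^sub>0"
  proof
    assume "z \<in> \<int>\<^sub>\<le>\<^sub>0"
    then obtain n :: nat where "z = - of_nat n" by (auto elim!: nonpos_Ints_cases')
    then have "1/2 - real (Suc N) = - real n" by (simp add: z_def complex_eq_iff)
    then have "real (2 * n + 1) = real (2 * Suc N)" by simp
    then have "2 * n + 1 = 2 * Suc N" by (simp only: of_nat_eq_iff)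
    then show False by presburger
  qed
  moreover have "z + 1 = Complex (1/2 - real N) t" by (simp add: z_def complex_eq_iff)
  ultimately have G: "Gamma (Complex (1/2 - real N) t) = z * Gamma z"
    using Gamma_plus1[of z] by simp
  have "1/2 + real N \<le> norm z"
    using abs_Re_le_cmod[of z] by (simp add: z_def)
  then have "norm (Gamma z) * (pochhammer (1/2) N * (1/2 + real N)) \<le> norm (Gamma z) * (pochhammer (1/2) N * norm z)"
    by (intro mult_left_mono) (auto intro!: pochhammer_nonneg)
  also have "\<dots> = norm (Gamma (Complex (1/2 - real N) t)) * pochhammer (1/2) N"
    by (simp add: G norm_mult)
  also have "\<dots> \<le> norm (Gamma (Complex (1/2) t))" by (rule Suc.IH)
  finally show ?case by (simp add: z_def pochhammer_Suc)
qed simp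

lemma pochhammer_half_ge: "pochhammer (1/2 :: real) (Suc N) \<ge> fact N / 2"
proof (induction N)
  case (Suc N)
  have "fact (Suc N) / 2 = (fact N / 2) * (1 + real N)" by (simp add: field_simps)
  also have "\<dots> \<le> pochhammer (1/2) (Suc N) * (1/2 + real (Suc N))"
    by (intro mult_mono Suc.IH) (auto intro!: pochhammer_nonneg)
  finally show ?case by (simp only: pochhammer_Suc)
qed simp

lemma residue_Gamma_powr:
  assumes "x > 0"
  shows "residue (\<lambda>w. Gamma w * of_real x powr (- w)) (- of_nat j) = of_real ((- x) ^ j / fact j)"
proof (rule residue_simple')
  show "open (- (\<int>\<^sub>\<le>\<^sub>0 - {-of_nat j}) :: complex set)"
    by (intro open_Compl closed_subset_Ints) auto
  show "(\<lambda>w. Gamma w * of_real x powr (- w)) holomorphic_on - (\<int>\<^sub>\<le>\<^sub>0 - {-of_nat j}) - {- of_nat j}"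
    by (intro holomorphic_intros) auto
  have "((\<lambda>w. of_real x powr (- w)) \<longlongrightarrow> complex_of_real x powr (- (- of_nat j))) (at (- of_nat j))"
    using assms by (intro tendsto_intros) auto
  also have "complex_of_real x powr (- (- of_nat j)) = of_real x ^ j"
    using assms by (simp add: powr_nat)
  finally have "((\<lambda>w. Gamma w * (w + of_nat j) * of_real x powr (- w)) \<longlongrightarrow> (-1) ^ j / fact j * complex_of_real x ^ j) (at (- of_nat j))"
    by (intro tendsto_mult Gamma_residues)
  moreover have "(-1) ^ j / fact j * complex_of_real x ^ j = of_real ((- x) ^ j / fact j)"
    by (simp add: power_minus[of x] power_minus[of "complex_of_real x"])
  ultimately show "((\<lambda>w. Gamma w * complex_of_real x powr (- w) * (w - - of_nat j)) \<longlongrightarrow> of_real ((- x) ^ j / fact j)) (at (- of_nat j))"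
    by (simp add: mult_ac)
qed auto

text \<open>Moving the line to 1/2 - N collects the residues of Gamma at 0, ..., -(N - 1), the
  partial sums of exp (- x). The remaining integral decays like x^N / N!.\<close>

lemma mellin_line_1:
  assumes "c > 0" "x > 0"
  shows "mellin_line c 1 x = of_real (2 * pi * exp (- x))"
proof -
  define F where "F = (\<lambda>w. Gamma w * complex_of_real x powr (- w))"
  define V where "V = (\<lambda>N::nat. \<integral>t. F (Complex (1/2 - real N) t) \<partial>lborel)"
  have gr: "exp_growth a b (- (pi / 2)) F" for a b
    unfolding F_def by (intro exp_growth_mult_powr exp_growth_Gamma assms)
  have V0: "mellin_line c 1 x = V 0"
    using mellin_line_indep[of 1 c "1/2" x] assms by (simp add: V_def F_def mellin_line_def mellin_kernel_def)
  have shift: "V 0 - V (Suc N) = of_real (2 * pi * (\<Sum>j<Suc N. (- x) ^ j / fact j))"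
    and int_V: "integrable lborel (\<lambda>t. F (Complex (1/2 - real (Suc N)) t))" for N
  proof -
    define S where "S = (\<lambda>j::nat. - of_nat j :: complex) ` {..<Suc N}"
    have S: "finite S" "\<And>z. z \<in> S \<Longrightarrow> 1/2 - real (Suc N) < Re z \<and> Re z < 1/2"
      by (auto simp: S_def)
    \<comment> \<open>The left margin 1/4 keeps the next pole -(N + 1) outside the strip.\<close>
    have hol: "F holomorphic_on {z. 1/4 - real (Suc N) < Re z \<and> Re z < 1} - S"
    proof -
      have "w \<notin> \<int>\<^sub>\<le>\<^sub>0" if "w \<in> {z. 1/4 - real (Suc N) < Re z \<and> Re z < 1} - S" for w
      proof
        assume "w \<in> \<int>\<^sub>\<le>\<^sub>0"
        then obtain n :: nat where n: "w = - of_nat n" by (auto elim!: nonpos_Ints_cases')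
        then have "real n < real (Suc N)" using that by simp
        then show False using that n by (auto simp: S_def)
      qed
      then show ?thesis unfolding F_def by (intro holomorphic_intros) auto
    qed
    have r: "- (pi / 2) < 0" by simp
    have le: "1/4 - real (Suc N) < 1/2 - real (Suc N)" "1/2 - real (Suc N) < 1/2" "1/2 < (1::real)" by auto
    note cs = contour_shift[OF le S hol gr r]
    show "integrable lborel (\<lambda>t. F (Complex (1/2 - real (Suc N)) t))" by (rule cs(1))
    have "V 0 - V (Suc N) = 2 * pi * (\<Sum>z\<in>S. residue F z)" using cs(3) by (simp add: V_def)
    also have "(\<Sum>z\<in>S. residue F z) = (\<Sum>j<Suc N. of_real ((- x) ^ j / fact j))"
      unfolding S_def F_def using residue_Gamma_powr[OF assms(2)]
      by (subst sum.reindex) (auto simp: inj_on_def)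
    finally show "V 0 - V (Suc N) = of_real (2 * pi * (\<Sum>j<Suc N. (- x) ^ j / fact j))"
      by simp
  qed
  define K where "K = (\<integral>t. norm (Gamma (Complex (1/2) t)) \<partial>lborel)"
  have int_K: "integrable lborel (\<lambda>t. Gamma (Complex (1/2) t))"
    by (rule exp_growth_line_integrable[OF exp_growth_Gamma _ order_refl order_refl 
         continuous_on_line[of Gamma "{w. Re w > 0}"]])
       (auto intro!: holomorphic_intros dest: not_nonpos_IntsI)
  let ?bd = "\<lambda>N. K * x powr (- 1/2) * (2 * x) * (inverse (fact N) * x ^ N)"
  have bound: "norm (V (Suc N)) \<le> ?bd N" for N
  proof -
    define P where "P = pochhammer (1/2 :: real) (Suc N)"
    have P: "P > 0" "P \<ge> fact N / 2" unfolding P_def using pochhammer_half_ge by (auto intro!: pochhammer_pos)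
    have nF: "norm (F (Complex (1/2 - real (Suc N)) t)) \<le> (x powr (- 1/2) * x ^ Suc N / P) * norm (Gamma (Complex (1/2) t))" for t
    proof -
      have "norm (F (Complex (1/2 - real (Suc N)) t)) = norm (Gamma (Complex (1/2 - real (Suc N)) t)) * x powr (- (1/2 - real (Suc N)))"
        using assms by (simp add: F_def norm_mult norm_powr_real_powr)
      also have "x powr (- (1/2 - real (Suc N))) = x powr (- 1/2 + real (Suc N))" by (intro arg_cong2[of _ _ _ _ "(powr)"]) auto
      also have "\<dots> = x powr (- 1/2) * x ^ Suc N"
        using assms by (subst powr_add) (simp only: powr_realpow)
      also have "norm (Gamma (Complex (1/2 - real (Suc N)) t)) \<le> norm (Gamma (Complex (1/2) t)) / P"
        using norm_Gamma_left_le[of "Suc N" t] P by (simp add: P_def[symmetric] pos_le_divide_eq)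
      then have "norm (Gamma (Complex (1/2 - real (Suc N)) t)) * (x powr (- 1/2) * x ^ Suc N) \<le> norm (Gamma (Complex (1/2) t)) / P * (x powr (- 1/2) * x ^ Suc N)"
        using assms by (intro mult_right_mono) auto
      finally show ?thesis by (simp add: mult_ac)
    qed
    have "norm (V (Suc N)) \<le> (\<integral>t. norm (F (Complex (1/2 - real (Suc N)) t)) \<partial>lborel)"
      unfolding V_def by (rule integral_norm_bound)
    also have "\<dots> \<le> (\<integral>t. (x powr (- 1/2) * x ^ Suc N / P) * norm (Gamma (Complex (1/2) t)) \<partial>lborel)"
      by (intro integral_mono nF integrable_norm int_V integrable_mult_right int_K)
    also have "\<dots> = (x powr (- 1/2) * x ^ Suc N / P) * K" by (simp add: K_def)
    also have "\<dots> \<le> (x powr (- 1/2) * x ^ Suc N / (fact N / 2)) * K"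
      using P assms by (intro mult_right_mono divide_left_mono) (auto simp: K_def)
    finally show ?thesis by (simp add: field_simps)
  qed
  have "(\<lambda>N. V (Suc N)) \<longlonglongrightarrow> 0"
  proof (rule Lim_null_comparison[OF always_eventually[OF allI[OF bound]]])
    have "(\<lambda>N. ?bd N) \<longlonglongrightarrow> K * x powr (- 1/2) * (2 * x) * 0"
      by (intro tendsto_mult tendsto_const summable_LIMSEQ_zero summable_exp)
    then show "(\<lambda>N. ?bd N) \<longlonglongrightarrow> 0" by simp
  qed
  then have "(\<lambda>N. V 0 - V (Suc N)) \<longlonglongrightarrow> V 0 - 0" by (intro tendsto_diff tendsto_const)
  moreover have "(\<lambda>N. V 0 - V (Suc N)) \<longlonglongrightarrow> of_real (2 * pi * exp (- x))"
  proof -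
    have "(\<lambda>j. (- x) ^ j / fact j) sums exp (- x)" using exp_converges[of "- x"] by (simp add: field_simps)
    then have "(\<lambda>N. \<Sum>j<Suc N. (- x) ^ j / fact j) \<longlonglongrightarrow> exp (- x)"
      unfolding sums_def by (rule LIMSEQ_Suc)
    then show ?thesis unfolding shift by (intro tendsto_of_real tendsto_mult tendsto_const)
  qed
  ultimately have "V 0 - 0 = of_real (2 * pi * exp (- x))" by (rule LIMSEQ_unique)
  then show ?thesis using V0 by simp
qed

lemma piltz_divisor_1: "n > 0 \<Longrightarrow> piltz_divisor 1 n = 1"
proof -
  assume "n > 0"
  then have "{xs :: nat list. length xs = 1 \<and> (\<forall>x\<in>set xs. x > 0) \<and> prod_list xs = n} = {[n]}"
    by (auto simp: length_Suc_conv)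
  then show ?thesis by (simp add: piltz_divisor_def)
qed

lemma Psi_1:
  assumes "\<mu> < 0" "\<rho> > 0" "x > 0"
  shows "Psi \<mu> \<rho> 1 x = of_real (1 / (exp (\<rho> * x) - 1))"
proof (rule sums_unique2[OF sums_mellin_line_Psi[OF assms, of 1 2]])
  define q where "q = exp (- (\<rho> * x))"
  have q: "0 < q" "q < 1" using assms by (auto simp: q_def)
  have "(\<lambda>j. q * q ^ j) sums (q * (1 / (1 - q)))"
    using q by (intro sums_mult geometric_sums) auto
  moreover have "q * (1 / (1 - q)) = 1 / (exp (\<rho> * x) - 1)"
    using q assms by (simp add: q_def exp_minus field_simps)
  ultimately have "(\<lambda>j. complex_of_real (q * q ^ j)) sums of_real (1 / (exp (\<rho> * x) - 1))"
    by (simp only: sums_of_real_iff)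
  moreover have "of_nat (piltz_divisor 1 (Suc j)) * mellin_line 2 1 (\<rho> * x * real (Suc j)) / (2 * of_real pi) = complex_of_real (q * q ^ j)" for j
  proof -
    have "exp (- (\<rho> * x * real (Suc j))) = q * q ^ j"
    proof -
      have "q * q ^ j = q ^ Suc j" by simp
      also have "\<dots> = exp (real (Suc j) * - (\<rho> * x))" unfolding q_def by (rule exp_of_nat_mult[symmetric])
      finally show ?thesis by (simp add: mult_ac del: of_nat_Suc)
    qed
    then show ?thesis using mellin_line_1[of 2 "\<rho> * x * real (Suc j)"] assms piltz_divisor_1[of "Suc j"]
      by (simp del: of_nat_Suc)
  qed
  ultimately show "(\<lambda>j. of_nat (piltz_divisor 1 (Suc j)) * mellin_line 2 1 (\<rho> * x * real (Suc j)) / (2 * of_real pi)) sums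
      of_real (1 / (exp (\<rho> * x) - 1))" by (simp only:)
qed auto

section \<open>The reflected kernel and its residues\<close>

definition reflected_kernel :: "int \<Rightarrow> nat \<Rightarrow> complex \<Rightarrow> complex" where
  "reflected_kernel m k w = (zeta (1 - w) / 2) ^ k * zeta (of_int (2 * m + 1) + w) ^ k / cos (of_real pi * w / 2)"

text \<open>The function differentiated in the theorem, namely w^k times the reflected kernel: Gamma
  (s + 1) in place of Gamma s clears the pole at 0.\<close>

definition zeta_product :: "int \<Rightarrow> nat \<Rightarrow> complex \<Rightarrow> complex" where
  "zeta_product m k s = zeta (of_int (2 * m + 1) + s) ^ k * zeta s ^ k * Gamma (s + 1) ^ k *
     cos (of_real pi * s / 2) ^ (k - 1) * (2 * of_real pi) powr (- of_nat k * s)"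

text \<open>The functional equation puts one cosine into each of the k factors, and one of them
  cancels the denominator; Gamma w = Gamma (w + 1) / w accounts for the power of w.\<close>

lemma reflected_kernel_eq:
  assumes "w \<noteq> 0" "w \<noteq> 1" "w + 1 \<notin> \<int>\<^sub>\<le>\<^sub>0" "cos (of_real pi * w / 2) \<noteq> 0" "k \<ge> 1"
  shows "reflected_kernel m k w = zeta_product m k w / w ^ k"
proof -
  define C where "C = cos (of_real pi * w / 2)"
  have G: "Gamma (w + 1) \<noteq> 0" using assms by (simp add: Gamma_eq_zero_iff)
  have "zeta (1 - w) * (w * inverse (Gamma (w + 1))) = 2 * (2 * of_real pi) powr (- w) * C * zeta w"
    using zeta_reflect[OF assms(1,2)] rGamma_plus1[of w] by (simp add: C_def rGamma_inverse_Gamma)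
  then have z: "zeta (1 - w) / 2 = (2 * of_real pi) powr (- w) * C * zeta w * Gamma (w + 1) / w"
    using assms(1) G by (simp add: field_simps)
  have p: "((2 * of_real pi) powr (- w)) ^ k = (2 * of_real pi :: complex) powr (- of_nat k * w)"
    by (simp add: powr_def mult.assoc flip: exp_of_nat_mult)
  have Ck: "C ^ k / C = C ^ (k - 1)" using assms by (cases k) (auto simp: C_def)
  have "reflected_kernel m k w = (zeta (of_int (2 * m + 1) + w) ^ k * zeta w ^ k * Gamma (w + 1) ^ k * ((2 * of_real pi) powr (- w)) ^ k) * (C ^ k / C) / w ^ k"
    unfolding reflected_kernel_def C_def[symmetric] z by (simp add: power_mult_distrib power_divide mult_ac)
  also have "\<dots> = zeta_product m k w / w ^ k"
    unfolding p Ck unfolding zeta_product_def C_def by (simp add: mult_ac)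
  finally show ?thesis .
qed

lemma mellin_kernel_zeta_eq_reflected_kernel:
  assumes "Re w > 1" "cos (of_real pi * w / 2) \<noteq> 0" "k \<ge> 1"
  shows "mellin_kernel k w * zeta w ^ k * of_real ((2 * pi) ^ k) powr (- w) * zeta (of_int (2 * m + 1) + w) ^ k =
    reflected_kernel m k w"
proof -
  have w: "w \<noteq> 0" "w \<noteq> 1" "w \<notin> \<int>\<^sub>\<le>\<^sub>0" "w + 1 \<notin> \<int>\<^sub>\<le>\<^sub>0" using assms by (auto intro!: not_nonpos_IntsI)
  have p: "of_real ((2 * pi) ^ k) powr (- w) = (2 * of_real pi :: complex) powr (- of_nat k * w)"
  proof -
    have e: "of_real Y powr s = exp (s * of_real (ln Y))" if "Y > 0" for Y and s :: complex
      using that by (simp add: powr_def Ln_of_real)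
    have "ln ((2 * pi) ^ k) = real k * ln (2 * pi)" by (rule ln_realpow)
    then show ?thesis
      using e[of "(2 * pi) ^ k" "- w"] e[of "2 * pi" "- of_nat k * w"] by (simp add: mult_ac)
  qed
  show ?thesis
    unfolding p reflected_kernel_eq[OF w(1,2,4) assms(2,3)] zeta_product_def mellin_kernel_def Gamma_plus1[OF w(3)]
    using w by (simp add: power_mult_distrib mult_ac)
qed

lemma cos_half_pi_eq_0E:
  assumes "cos (of_real pi * w / 2) = (0 :: complex)"
  obtains n :: int where "w = of_int (1 - 2 * n)"
proof -
  from assms obtain n :: int where "of_real pi * w / 2 = complex_of_real (n * pi) + of_real pi / 2"
    by (auto simp: cos_eq_0)
  then have "of_real pi * w = of_real pi * (2 * of_int n + 1)" by (simp add: field_simps)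
  then have "w = of_int (1 - 2 * (- n))" by simp
  then show ?thesis by (rule that)
qed

text \<open>The reflection swaps the arguments 1 - w and 2m + 1 + w of the two zeta factors, so only
  the cosine changes: it is shifted by pi m, which flips its sign for odd \<open>m\<close>.\<close>

lemma reflected_kernel_reflect:
  assumes "odd m"
  shows "reflected_kernel m k (- 2 * of_int m - w) = - reflected_kernel m k w"
proof -
  have "of_real pi * (- 2 * of_int m - w) / 2 = - (of_real (pi * of_int m) + of_real pi * w / 2)"
    by (simp add: field_simps)
  then have "cos (of_real pi * (- 2 * of_int m - w) / 2) = cos (of_real (pi * of_int m) + of_real pi * w / 2)"
    by (simp only: cos_minus)
  also have "\<dots> = - cos (of_real pi * w / 2)"
    unfolding cos_add cos_of_real sin_of_real cos_npi_int sin_npi_int using assms by simp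
  finally have c: "cos (of_real pi * (- 2 * of_int m - w) / 2) = - cos (of_real pi * w / 2)" .
  have e: "1 - (- 2 * of_int m - w) = of_int (2 * m + 1) + w" "of_int (2 * m + 1) + (- 2 * of_int m - w) = 1 - w"
    by simp_all
  show ?thesis unfolding reflected_kernel_def c e by (simp add: power_divide mult_ac)
qed

lemma odd_shift_eq_1_iff: "of_int (2 * m + 1) + w = 1 \<longleftrightarrow> w = - 2 * complex_of_int m"
proof -
  have "1 - of_int (2 * m + 1) = - 2 * complex_of_int m" by simp
  then show ?thesis by (metis add_diff_cancel_left' diff_add_cancel add.commute)
qed

lemma holomorphic_reflected_kernel:
  assumes "\<And>w. w \<in> A \<Longrightarrow> w \<noteq> 0 \<and> w \<noteq> - 2 * of_int m \<and> cos (of_real pi * w / 2) \<noteq> 0"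
  shows "reflected_kernel m k holomorphic_on A"
  unfolding reflected_kernel_def
proof (intro holomorphic_intros)
  fix w assume "w \<in> A"
  from assms[OF this] show "1 - w \<noteq> 1" "cos (of_real pi * w / 2) \<noteq> 0" by auto
  from assms[OF \<open>w \<in> A\<close>] show "of_int (2 * m + 1) + w \<noteq> 1"
    unfolding odd_shift_eq_1_iff by auto
qed auto

lemma exp_growth_reflected_kernel: "exp_growth a b (- (pi / 2)) (reflected_kernel m k)"
proof -
  have "exp_growth a b 0 (\<lambda>w. zeta (1 - w))"
    using exp_growth_reflect[OF exp_growth_zeta[of "1 - b" "1 - a"], of 1] by simp
  moreover have "exp_growth a b 0 (\<lambda>w. zeta (of_int (2 * m + 1) + w))"
    using exp_growth_shift[OF exp_growth_zeta[of "a + of_int (2 * m + 1)" "b + of_int (2 * m + 1)"], of "of_int (2 * m + 1)"] by simp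
  ultimately have "exp_growth a b ((real k * (0 + 0) + real k * 0) + - (pi / 2))
     (\<lambda>w. (zeta (1 - w) * (1 / 2)) ^ k * zeta (of_int (2 * m + 1) + w) ^ k * (1 / cos (of_real pi * w / 2)))"
    by (intro exp_growth_mult exp_growth_power exp_growth_const exp_growth_inverse_cos_half_pi)
  then show ?thesis unfolding reflected_kernel_def by simp
qed

lemma of_int_eq_of_int_if_near:
  assumes "norm (complex_of_int a - of_int b) < 1"
  shows "a = b"
proof -
  have "norm (complex_of_int (a - b)) < 1" using assms by simp
  then have "real_of_int \<bar>a - b\<bar> < 1" by (simp only: norm_of_int)
  then show ?thesis by linarith
qed

section \<open>Residues of the reflected kernel\<close>

text \<open>The nearest dangers are s = 1, s = -1 and s = -2m. The last is a nonzero even integer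
  because \<open>m\<close> is odd.\<close>

lemma zeta_product_holomorphic:
  assumes "odd m"
  shows "zeta_product m k holomorphic_on ball 0 (1/2)"
  unfolding zeta_product_def
proof (intro holomorphic_intros)
  fix s :: complex assume s: "s \<in> ball 0 (1/2)"
  then have "\<bar>Re s\<bar> < 1/2" using abs_Re_le_cmod[of s] by simp
  then show "s + 1 \<notin> \<int>\<^sub>\<le>\<^sub>0" by (intro not_nonpos_IntsI) auto
  show "s \<noteq> 1" using s by auto
  show "of_int (2 * m + 1) + s \<noteq> 1"
  proof
    assume "of_int (2 * m + 1) + s = 1"
    then have "s = of_int (- 2 * m)" unfolding odd_shift_eq_1_iff by simp
    then have "norm (complex_of_int (- 2 * m) - of_int 0) < 1" using s by simp
    then have "- 2 * m = 0" by (rule of_int_eq_of_int_if_near)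
    then show False using assms by simp
  qed
qed auto

lemma residue_reflected_kernel_0:
  assumes "odd m" "k \<ge> 1"
  shows "residue (reflected_kernel m k) 0 = (deriv ^^ (k - 1)) (zeta_product m k) 0 / fact (k - 1)"
    and "residue (reflected_kernel m k) (- 2 * of_int m) = residue (reflected_kernel m k) 0"
proof -
  have k: "Suc (k - 1) = k" using assms by simp
  have eq: "reflected_kernel m k w = zeta_product m k w / w ^ k" if w: "w \<in> ball 0 (1/2)" "w \<noteq> 0" for w
  proof (rule reflected_kernel_eq)
    have "\<bar>Re w\<bar> < 1/2" using w abs_Re_le_cmod[of w] by simp
    then show "w + 1 \<notin> \<int>\<^sub>\<le>\<^sub>0" by (intro not_nonpos_IntsI) auto
    show "cos (of_real pi * w / 2) \<noteq> 0"
    proof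
      assume "cos (of_real pi * w / 2) = 0"
      then obtain n :: int where n: "w = of_int (1 - 2 * n)" by (rule cos_half_pi_eq_0E)
      then have "norm (complex_of_int (1 - 2 * n) - of_int 0) < 1" using w by simp
      then have "1 - 2 * n = 0" by (rule of_int_eq_of_int_if_near)
      then show False by presburger
    qed
    show "w \<noteq> 1" using w by auto
  qed (use w assms in auto)
  define D where "D = (deriv ^^ (k - 1)) (zeta_product m k) 0"
  have "residue (reflected_kernel m k) 0 = residue (\<lambda>w. zeta_product m k w / w ^ Suc (k - 1)) 0"
  proof (rule residue_cong[OF _ refl])
    have "eventually (\<lambda>w. w \<in> ball 0 (1/2) \<and> w \<noteq> 0) (at (0::complex))"
      by (intro eventually_conj eventually_at_in_open' eventually_neq_at_within) auto
    then show "eventually (\<lambda>w. reflected_kernel m k w = zeta_product m k w / w ^ Suc (k - 1)) (at 0)"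
    proof eventually_elim
      case (elim w)
      then show ?case unfolding k using eq by blast
    qed
  qed
  also have "\<dots> = D / fact (k - 1)"
    unfolding D_def by (rule residue_holomorphic_over_power'[OF _ _ zeta_product_holomorphic[OF assms(1)]]) auto
  finally show res0: "residue (reflected_kernel m k) 0 = D / fact (k - 1)" .
  define z0 where "z0 = - 2 * complex_of_int m"
  define f where "f = (\<lambda>w. zeta_product m k (- 1 * w + z0))"
  have hf: "f holomorphic_on ball z0 (1/2)"
    unfolding f_def
    by (rule holomorphic_on_compose_gen[OF _ zeta_product_holomorphic[OF assms(1)], unfolded o_def])
       (auto intro!: holomorphic_intros simp: dist_norm norm_minus_commute)
  have D': "(deriv ^^ (k - 1)) f z0 = (-1) ^ (k - 1) * D"
    unfolding f_def D_def
    using higher_deriv_compose_linear'[OF zeta_product_holomorphic[OF assms(1), of k], of "ball z0 (1/2)" z0 "-1" z0 "k - 1"]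
    by (simp add: dist_norm norm_minus_commute)
  \<comment> \<open>Signs: -1 from the antisymmetry and (-1)^k from turning (z0 - w)^k into (w -
    z0)^k. The (k-1)-th derivative of \<open>f\<close> contributes (-1)^(k-1), so all signs
    cancel.\<close>
  have "residue (reflected_kernel m k) z0 = residue (\<lambda>w. (-1) ^ Suc k * (f w / (w - z0) ^ Suc (k - 1))) z0"
  proof (rule residue_cong[OF _ refl])
    have "eventually (\<lambda>w. w \<in> ball z0 (1/2) \<and> w \<noteq> z0) (at z0)"
      by (intro eventually_conj eventually_at_in_open' eventually_neq_at_within) auto
    then show "eventually (\<lambda>w. reflected_kernel m k w = (-1) ^ Suc k * (f w / (w - z0) ^ Suc (k - 1))) (at z0)"
    proof eventually_elim
      case (elim w)
      define v where "v = z0 - w"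
      have v: "v \<in> ball 0 (1/2)" "v \<noteq> 0" using elim by (auto simp: v_def dist_norm norm_minus_commute)
      have "reflected_kernel m k w = - reflected_kernel m k v"
        using reflected_kernel_reflect[OF assms(1), of k v] by (simp add: v_def z0_def)
      also have "\<dots> = - (zeta_product m k v / v ^ k)" unfolding eq[OF v] ..
      also have "v ^ k = (-1) ^ k * (w - z0) ^ k"
        unfolding v_def by (simp flip: power_mult_distrib)
      also have "zeta_product m k v = f w" by (simp add: f_def v_def)
      finally show ?case unfolding k by (cases "even k") simp_all
    qed
  qed
  also have "\<dots> = (-1) ^ Suc k * residue (\<lambda>w. f w / (w - z0) ^ Suc (k - 1)) z0"
    by (rule residue_lmul[of "ball z0 (1/2)"]) (auto intro!: holomorphic_intros holomorphic_on_subset[OF hf])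
  also have "\<dots> = (-1) ^ Suc k * ((-1) ^ (k - 1) * D / fact (k - 1))"
    using residue_holomorphic_over_power[OF _ _ hf, of z0 "k - 1"] D' by simp
  also have "\<dots> = D / fact (k - 1)"
  proof -
    have "(-1) ^ Suc k * (-1) ^ (k - 1) = (1 :: complex)"
      using assms(2) by (cases k) (auto simp flip: power_mult_distrib)
    then show ?thesis by (simp add: mult.assoc[symmetric])
  qed
  finally show "residue (reflected_kernel m k) (- 2 * of_int m) = residue (reflected_kernel m k) 0"
    unfolding res0 z0_def .
qed

text \<open>A regular numerator over a simple zero of the cosine. A vanishing numerator is allowed
  and gives the value 0, which is how the trivial zeros enter.\<close>

lemma residue_reflected_kernel_odd:
  "residue (reflected_kernel m k) (of_int (1 - 2 * n)) =
     of_real (2 / pi * (- 1) powi (n + 1)) * ((zeta (of_int (2 * n)) / 2) ^ k * zeta (of_int (2 * m + 2 - 2 * n)) ^ k)"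
  (is "_ = ?res")
proof (rule residue_simple')
  define z0 where "z0 = complex_of_int (1 - 2 * n)"
  define N where "N = (\<lambda>w. (zeta (1 - w) / 2) ^ k * zeta (of_int (2 * m + 1) + w) ^ k)"
  define c where "c = (\<lambda>w::complex. cos (of_real pi * w / 2))"
  have z0_int: "z0 \<noteq> of_int (2 * j)" for j
  proof
    assume "z0 = of_int (2 * j)"
    then have "1 - 2 * n = 2 * j" unfolding z0_def by (simp only: of_int_eq_iff)
    then show False by presburger
  qed
  have near: "w \<noteq> 0 \<and> w \<noteq> - 2 * of_int m \<and> cos (of_real pi * w / 2) \<noteq> 0" if w: "w \<in> ball z0 1" "w \<noteq> z0" for w
  proof -
    have ni: "w \<noteq> of_int j" for j
      using of_int_eq_of_int_if_near[of "1 - 2 * n" j] w by (auto simp: z0_def dist_norm)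
    have "cos (of_real pi * w / 2) \<noteq> 0"
    proof
      assume "cos (of_real pi * w / 2) = 0"
      then obtain j :: int where "w = of_int (1 - 2 * j)" by (rule cos_half_pi_eq_0E)
      then show False using ni by blast
    qed
    then show ?thesis using ni[of 0] ni[of "- 2 * m"] by auto
  qed
  show "open (ball z0 1)" by simp
  show "of_int (1 - 2 * n) \<in> ball z0 1" by (simp add: z0_def)
  show "reflected_kernel m k holomorphic_on ball z0 1 - {of_int (1 - 2 * n)}"
    by (rule holomorphic_reflected_kernel) (use near z0_def in auto)
  have c0: "c z0 = 0" unfolding c_def z0_def by (rule cos_odd_half_pi)
  define d where "d = - (of_real pi / 2) * sin (of_real pi * z0 / 2)"
  have "(c has_field_derivative d) (at z0)"
    unfolding c_def d_def by (auto intro!: derivative_eq_intros)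
  then have lim_c: "((\<lambda>w. c w / (w - z0)) \<longlongrightarrow> d) (at z0)"
    unfolding has_field_derivative_iff c0 by simp
  \<comment> \<open>The sine is (-1)^n; written as -(-1)^(n+1) it absorbs the minus sign of the
    derivative of cos.\<close>
  have s: "sin (of_real pi * z0 / 2) = of_real (- ((- 1) powi (n + 1)))"
  proof -
    have e: "of_real pi * z0 / 2 = of_real (pi / 2 - pi * of_int n)" by (simp add: z0_def field_simps)
    have "sin (pi / 2 - pi * of_int n) = (if even n then 1 else -1)"
      by (simp only: sin_diff sin_pi_half cos_pi_half cos_npi_int sin_npi_int)
    also have "\<dots> = - ((- 1) powi (n + 1))" by (simp add: power_int_minus_left)
    finally show ?thesis unfolding e sin_of_real by (rule arg_cong)
  qed
  have e1: "((- 1) powi (n + 1) :: real) * (- 1) powi (n + 1) = 1" by (simp add: power_int_minus_left)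
  have d: "d = of_real (pi / 2 * (- 1) powi (n + 1))" unfolding d_def s by simp
  have d0: "d \<noteq> 0" unfolding d using e1 by auto
  have di: "inverse d = of_real (2 / pi * (- 1) powi (n + 1))"
  proof (rule inverse_unique)
    have "(pi / 2 * (- 1) powi (n + 1)) * (2 / pi * (- 1) powi (n + 1)) = ((- 1) powi (n + 1)) * (- 1) powi (n + 1)"
      by simp
    then show "d * of_real (2 / pi * (- 1) powi (n + 1)) = 1"
      unfolding d of_real_mult[symmetric] e1 by simp
  qed
  have "isCont N z0"
  proof -
    have "N holomorphic_on ball z0 1"
    proof -
      have "1 - w \<noteq> 1" "of_int (2 * m + 1) + w \<noteq> 1" if "w \<in> ball z0 1" for w
      proof -
        have "w \<noteq> 0 \<and> w \<noteq> - 2 * of_int m"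
          using near[OF that] z0_int[of 0] z0_int[of "-m"] by (cases "w = z0") auto
        then show "1 - w \<noteq> 1" "of_int (2 * m + 1) + w \<noteq> 1"
          unfolding odd_shift_eq_1_iff by auto
      qed
      then show ?thesis unfolding N_def by (intro holomorphic_intros) auto
    qed
    then have "continuous_on (ball z0 1) N" by (rule holomorphic_on_imp_continuous_on)
    then show ?thesis by (rule continuous_on_interior) simp
  qed
  then have "((\<lambda>w. N w * inverse (c w / (w - z0))) \<longlongrightarrow> N z0 * inverse d) (at z0)"
    using lim_c d0 by (intro tendsto_mult tendsto_inverse) (auto simp: isCont_def)
  also have "(\<lambda>w. N w * inverse (c w / (w - z0))) = (\<lambda>w. reflected_kernel m k w * (w - z0))"
  proof -
    have "p * inverse (q / r) = p / q * r" for p q r :: complex by simp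
    then show ?thesis unfolding reflected_kernel_def N_def c_def by (rule ext)
  qed
  also have "N z0 * inverse d = ?res"
  proof -
    have e: "1 - z0 = of_int (2 * n)" "of_int (2 * m + 1) + z0 = of_int (2 * m + 2 - 2 * n)" by (simp_all add: z0_def)
    show ?thesis unfolding di N_def e by (rule mult.commute)
  qed
  finally show "((\<lambda>w. reflected_kernel m k w * (w - of_int (1 - 2 * n))) \<longlongrightarrow> ?res) (at (of_int (1 - 2 * n)))"
    by (simp only: z0_def)
qed

section \<open>The contour shift and the final evaluation\<close>

text \<open>The integral over the mirrored line is minus the original one, so the shift computes
  twice the integral. Halving leaves the two equal residues at 0 and -2m as a single one, and half
  of each simple residue.\<close>

lemma integral_reflected_kernel:
  assumes "odd m" "k \<ge> 1" "int M \<ge> \<bar>m\<bar>"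
  defines "c \<equiv> 2 * real M + 2"
  shows "(\<integral>t. reflected_kernel m k (Complex c t) \<partial>lborel) / (2 * of_real pi) =
    residue (reflected_kernel m k) 0 +
    (\<Sum>n\<in>{- int M..m + int M + 1}. residue (reflected_kernel m k) (of_int (1 - 2 * n))) / 2"
proof -
  define R where "R = reflected_kernel m k"
  let ?I = "\<lambda>c. \<integral>t. R (Complex c t) \<partial>lborel"
  let ?S = "\<Sum>n\<in>{- int M..m + int M + 1}. residue R (of_int (1 - 2 * n))"
  define a where "a = - 2 * of_int m - c"
  define z0 where "z0 = - 2 * complex_of_int m"
  \<comment> \<open>Exactly the odd integers strictly between \<open>a\<close> = -2m - 2M - 2 and
    \<open>c\<close> = 2M + 2.\<close>
  define Odd where "Odd = (\<lambda>n. complex_of_int (1 - 2 * n)) ` {- int M..m + int M + 1}"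
  define S where "S = insert 0 (insert z0 Odd)"
  have mM: "\<bar>real_of_int m\<bar> \<le> real M" using assms(3) by linarith
  have m0: "m \<noteq> 0" using assms(1) by auto
  have z0_int: "z0 = of_int (- 2 * m)" by (simp add: z0_def)
  have Odd_even: "of_int (2 * j) \<notin> Odd" for j
  proof
    assume "of_int (2 * j) \<in> Odd"
    then obtain n where "complex_of_int (2 * j) = of_int (1 - 2 * n)" by (auto simp: Odd_def)
    then have "2 * j = 1 - 2 * n" by (simp only: of_int_eq_iff)
    then show False by presburger
  qed
  have notin: "0 \<notin> insert z0 Odd" "z0 \<notin> Odd"
    using Odd_even[of 0] Odd_even[of "- m"] m0 by (auto simp: z0_def)
  have fin: "finite S" "finite Odd" by (auto simp: S_def Odd_def)
  have inS: "a < Re z \<and> Re z < c" if "z \<in> S" for z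
  proof -
    consider "z = 0" | "z = z0" | n where "n \<in> {- int M..m + int M + 1}" "z = of_int (1 - 2 * n)"
      using \<open>z \<in> S\<close> unfolding S_def Odd_def by blast
    then show ?thesis
    proof cases
      case 3
      have "real_of_int n \<ge> - real M" "real_of_int n \<le> of_int m + real M + 1" using 3(1) by auto
      then show ?thesis using 3(2) by (simp add: a_def c_def)
    qed (use mM in \<open>auto simp: z0_def a_def c_def\<close>)
  qed
  have hol: "R holomorphic_on {z. a - 1/2 < Re z \<and> Re z < c + 1/2} - S"
    unfolding R_def
  proof (rule holomorphic_reflected_kernel)
    fix w assume w: "w \<in> {z. a - 1/2 < Re z \<and> Re z < c + 1/2} - S"
    have "cos (of_real pi * w / 2) \<noteq> 0"
    proof
      assume "cos (of_real pi * w / 2) = 0"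
      then obtain n :: int where n: "w = of_int (1 - 2 * n)" by (rule cos_half_pi_eq_0E)
      have "a - 1/2 < 1 - 2 * of_int n" "1 - 2 * of_int n < c + 1/2" using w n by auto
      \<comment> \<open>The margin 1/2 on either side admits no further odd integer; rounding the
        bounds to integers recovers the index range.\<close>
      then have "real_of_int (- 2 * n) < of_int (2 * int M + 2)" "real_of_int (2 * n) < of_int (2 * m + 2 * int M + 4)"
        by (auto simp: a_def c_def)
      then have "- 2 * n < 2 * int M + 2" "2 * n < 2 * m + 2 * int M + 4" by (simp_all only: of_int_less_iff)
      then have "n \<in> {- int M..m + int M + 1}" by simp
      then show False using w n by (auto simp: S_def Odd_def)
    qed
    then show "w \<noteq> 0 \<and> w \<noteq> - 2 * of_int m \<and> cos (of_real pi * w / 2) \<noteq> 0"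
      using w by (auto simp: S_def z0_def)
  qed
  have r: "- (pi / 2) < 0" by simp
  have le: "a - 1/2 < a" "a < c" "c < c + 1/2" using mM by (auto simp: a_def c_def)
  have "?I c - ?I a = 2 * pi * (\<Sum>z\<in>S. residue R z)"
    using exp_growth_reflected_kernel by (intro contour_shift(3)[OF le fin(1) inS hol _ r]) (auto simp: R_def)
  moreover have "?I a = - ?I c"
  proof -
    have "?I c = \<bar>- 1\<bar> *\<^sub>R (\<integral>t. R (Complex c (0 + (- 1) * t)) \<partial>lborel)"
      by (rule lborel_integral_real_affine) simp
    also have "(\<lambda>t. R (Complex c (0 + (- 1) * t))) = (\<lambda>t. - R (Complex a t))"
    proof
      fix t
      have "Complex c (0 + (- 1) * t) = - 2 * of_int m - Complex a t" by (simp add: a_def complex_eq_iff)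
      then show "R (Complex c (0 + (- 1) * t)) = - R (Complex a t)"
        unfolding R_def by (simp only: reflected_kernel_reflect[OF assms(1)])
    qed
    finally show ?thesis by simp
  qed
  moreover have "(\<Sum>z\<in>S. residue R z) = 2 * residue R 0 + ?S"
  proof -
    have "(\<Sum>z\<in>S. residue R z) = residue R 0 + (residue R z0 + (\<Sum>z\<in>Odd. residue R z))"
      using notin fin unfolding S_def by simp
    also have "(\<Sum>z\<in>Odd. residue R z) = ?S"
      unfolding Odd_def by (subst sum.reindex) (auto simp: inj_on_def)
    also have "residue R z0 = residue R 0"
      unfolding R_def z0_def by (rule residue_reflected_kernel_0(2)[OF assms(1,2)])
    finally show ?thesis by simp
  qed
  ultimately have "2 * ?I c =
     2 * pi * (2 * residue R 0 + ?S)"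
    by simp
  then have "?I c =
     pi * (2 * residue R 0 + ?S)"
    by simp
  then show ?thesis unfolding R_def by (simp add: add_divide_distrib)
qed

text \<open>One of the two zeta values is a trivial zero: the first for n < 0, the second for n > m
  + 1.\<close>

lemma residue_reflected_kernel_odd_eq_0:
  assumes "n < 0 \<or> n > m + 1" "k \<ge> 1"
  shows "residue (reflected_kernel m k) (of_int (1 - 2 * n)) = 0"
proof -
  have "zeta (of_int (2 * n)) = 0 \<or> zeta (of_int (2 * m + 2 - 2 * n)) = 0"
    using zeta_even_neg[of n] zeta_even_neg[of "m + 1 - n"] assms(1) by (auto simp: algebra_simps)
  then show ?thesis unfolding residue_reflected_kernel_odd using assms(2) by auto
qed

lemma residue_reflected_kernel_odd_bernoulli:
  assumes "odd m" "n \<in> {0..m + 1}"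
  shows "residue (reflected_kernel m k) (of_int (1 - 2 * n)) / 2 =
    of_real (2 powi (2 * int k * m - int k) * pi powi (2 * int k * m + 2 * int k - 1) *
      ((- 1) powi (n + 1) * (bernoulli (nat (2 * m - 2 * n + 2)) ^ k * bernoulli (nat (2 * n)) ^ k) /
       (fact (nat (2 * m - 2 * n + 2)) * fact (nat (2 * n))) ^ k))"
proof -
  define i j where "i = nat n" and "j = nat (m + 1 - n)"
  have ij: "n = int i" "m = int (i + j) - 1" "nat (2 * n) = 2 * i" "nat (2 * m - 2 * n + 2) = 2 * j"
    "2 * m + 2 - 2 * n = int (2 * j)" "2 * n = int (2 * i)"
    using assms(2) by (auto simp: i_def j_def)
  \<comment> \<open>Since i + j = m + 1 with \<open>m\<close> odd, the signs of the two zeta values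
    multiply to 1.\<close>
  have ev: "even (i + j)" using assms(1) ij(2) by simp
  define B where "B = bernoulli (2 * j) * bernoulli (2 * i) / (fact (2 * j) * fact (2 * i))"
  have zz: "zeta (of_int (2 * n)) / 2 * zeta (of_int (2 * m + 2 - 2 * n)) = of_real ((2 * pi) ^ (2 * (i + j)) / 8 * B)"
  proof -
    define u v where "u = (-1) ^ (i + 1) * bernoulli (2 * i) * (2 * pi) ^ (2 * i) / (2 * fact (2 * i))"
      and "v = (-1) ^ (j + 1) * bernoulli (2 * j) * (2 * pi) ^ (2 * j) / (2 * fact (2 * j))"
    have zeta_u: "zeta (of_int (2 * n)) = of_real u"
      unfolding ij(6) u_def of_int_of_nat_eq by (rule zeta_even)
    have zeta_v: "zeta (of_int (2 * m + 2 - 2 * n)) = of_real v"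
      unfolding ij(5) v_def of_int_of_nat_eq by (rule zeta_even)
    \<comment> \<open>The 8 collects the denominator 2 of each zeta value and the explicit halving
      of the first.\<close>
    have "u / 2 * v = ((-1) ^ (i + 1) * (-1) ^ (j + 1)) * (((2 * pi) ^ (2 * i) * (2 * pi) ^ (2 * j)) / 8 * B)"
      by (simp add: u_def v_def B_def mult_ac)
    also have "((-1) ^ (i + 1) * (-1) ^ (j + 1) :: real) = (-1) ^ (i + j)" by (simp add: power_add)
    also have "\<dots> = 1" using ev by simp
    also have "(2 * pi) ^ (2 * i) * (2 * pi) ^ (2 * j) = (2 * pi) ^ (2 * (i + j))"
      by (simp only: power_add distrib_left)
    finally have "u / 2 * v = (2 * pi) ^ (2 * (i + j)) / 8 * B" by simp
    then have "complex_of_real (u / 2 * v) = of_real ((2 * pi) ^ (2 * (i + j)) / 8 * B)" by (rule arg_cong)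
    then show ?thesis unfolding zeta_u zeta_v by simp
  qed
  have "residue (reflected_kernel m k) (of_int (1 - 2 * n)) / 2 =
     of_real (2 / pi * (- 1) powi (n + 1)) * (zeta (of_int (2 * n)) / 2 * zeta (of_int (2 * m + 2 - 2 * n))) ^ k / 2"
    unfolding residue_reflected_kernel_odd by (simp only: power_mult_distrib)
  also have "\<dots> = of_real (2 / pi * (- 1) powi (n + 1) * ((2 * pi) ^ (2 * (i + j)) / 8 * B) ^ k / 2)"
    unfolding zz by simp
  also have "2 / pi * (- 1) powi (n + 1) * ((2 * pi) ^ (2 * (i + j)) / 8 * B) ^ k / 2 =
     (((2 * pi) ^ (2 * (i + j)) / 8) ^ k / pi) * ((- 1) powi (n + 1) * B ^ k)"
    unfolding power_mult_distrib[of _ B] by simp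
  also have "((2 * pi) ^ (2 * (i + j)) / 8) ^ k / pi = 2 powi (2 * int k * m - int k) * pi powi (2 * int k * m + 2 * int k - 1)"
  proof -
    \<comment> \<open>The exponent of 2 pi is 2k (m + 1); removing 8^k = 2^(3k) and one factor pi
      gives the exponents of the theorem.\<close>
    define p where "p = 2 * (i + j) * k"
    have e1: "2 * int k * m - int k = int p - int (3 * k)" and e2: "2 * int k * m + 2 * int k - 1 = int p - 1"
      unfolding ij(2) p_def by (simp_all add: algebra_simps)
    have f1: "(2 :: real) powi (int p - int q) = 2 ^ p / 2 ^ q" for q
      by (simp add: power_int_diff)
    have f2: "pi powi (int p - 1) = pi ^ p / pi"
      by (simp add: power_int_diff)
    have f3: "(2 :: real) ^ (3 * k) = 8 ^ k" by (simp add: power_mult)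
    have f4: "((2 * pi) ^ (2 * (i + j)) / 8) ^ k = 2 ^ p * pi ^ p / 8 ^ k"
      by (simp add: p_def power_divide power_mult_distrib flip: power_mult)
    show ?thesis unfolding e1 e2 f1 f2 f3 f4 by simp
  qed
  also have "(- 1) powi (n + 1) * B ^ k = (- 1) powi (n + 1) * (bernoulli (2 * j) ^ k * bernoulli (2 * i) ^ k) / (fact (2 * j) * fact (2 * i)) ^ k"
    by (simp add: B_def power_divide power_mult_distrib)
  finally show ?thesis unfolding ij(3,4) .
qed

lemma sums_Psi_zeta_odd:
  fixes m :: int and k :: nat and \<mu> :: real
  assumes "odd m" and "k \<ge> 1" and "\<mu> < 0"
  shows "(\<lambda>n. of_nat (piltz_divisor k (Suc n)) / of_nat (Suc n) powi (2 * m + 1) *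
               Psi \<mu> ((2 * pi) ^ k) k (real (Suc n)))
          sums
          (1 / fact (k - 1) * (deriv ^^ (k - 1)) (zeta_product m k) 0
           + of_real (2 powi (2 * int k * m - int k) * pi powi (2 * int k * m + 2 * int k - 1) *
               (\<Sum>n\<in>{0..m + 1}. (- 1) powi (n + 1) *
                  (bernoulli (nat (2 * m - 2 * n + 2)) ^ k * bernoulli (nat (2 * n)) ^ k) /
                  (fact (nat (2 * m - 2 * n + 2)) * fact (nat (2 * n))) ^ k)))"
    (is "?f sums (?D + ?E)")
proof -
  define M where "M = nat \<bar>m\<bar>"
  have M: "int M \<ge> \<bar>m\<bar>" by (simp add: M_def)
  define c where "c = 2 * real M + 2"
  have c: "c > 1" "c + 2 * of_int m > 0" using M unfolding c_def by linarith+
  have line: "cos (of_real pi * Complex c t / 2) \<noteq> 0" for t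
  proof
    assume "cos (of_real pi * Complex c t / 2) = 0"
    then obtain n :: int where "Complex c t = of_int (1 - 2 * n)" by (rule cos_half_pi_eq_0E)
    then have "real_of_int (2 * int M + 2) = of_int (1 - 2 * n)" by (simp add: complex_eq_iff c_def)
    then have "2 * int M + 2 = 1 - 2 * n" by (simp only: of_int_eq_iff)
    then show False by presburger
  qed
  have "(\<integral>t. mellin_kernel k (Complex c t) * zeta (Complex c t) ^ k * of_real ((2 * pi) ^ k) powr (- Complex c t) *
       zeta (of_int (2 * m + 1) + Complex c t) ^ k \<partial>lborel) = (\<integral>t. reflected_kernel m k (Complex c t) \<partial>lborel)"
    using mellin_kernel_zeta_eq_reflected_kernel[OF _ line assms(2)] c by (intro Bochner_Integration.integral_cong) auto
  then have "?f sums
      (residue (reflected_kernel m k) 0 +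
       (\<Sum>n\<in>{- int M..m + int M + 1}. residue (reflected_kernel m k) (of_int (1 - 2 * n))) / 2)"
    using sums_Psi[OF assms(3) _ assms(2) c, of "(2 * pi) ^ k"]
      integral_reflected_kernel[OF assms(1,2) M, folded c_def] by simp
  \<comment> \<open>Discarding the zero residues makes the result independent of M; for m + 1 < 0
    nothing remains, in accordance with the empty sum.\<close>
  also have "(\<Sum>n\<in>{- int M..m + int M + 1}. residue (reflected_kernel m k) (of_int (1 - 2 * n))) =
      (\<Sum>n\<in>{0..m + 1}. residue (reflected_kernel m k) (of_int (1 - 2 * n)))"
    using residue_reflected_kernel_odd_eq_0[OF _ assms(2), of _ m]
    by (intro sum.mono_neutral_right) auto
  also have "\<dots> / 2 = (\<Sum>n\<in>{0..m + 1}. residue (reflected_kernel m k) (of_int (1 - 2 * n)) / 2)"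
    by (rule sum_divide_distrib)
  also have "\<dots> = ?E"
    unfolding sum_distrib_left of_real_sum
    by (intro sum.cong refl residue_reflected_kernel_odd_bernoulli assms(1))
  also have "residue (reflected_kernel m k) 0 = ?D"
    using residue_reflected_kernel_0(1)[OF assms(1,2)] by simp
  finally show ?thesis .
qed

text \<open>For k = 1 the derivative has order 0 and equals zeta (2m + 1) zeta 0 = - zeta (2m + 1) /
  2, so doubling the identity and moving this term across gives Lerch's form.\<close>

lemma lerch:
  fixes m :: int
  assumes "odd m"
  defines "L \<equiv> \<lambda>n. 1 / (real (Suc n) powi (2 * m + 1) * (exp (2 * pi * real (Suc n)) - 1))"
    and "X \<equiv> \<Sum>j\<in>{0..m + 1}. (- 1) powi (j + 1) *
                 bernoulli (nat (2 * j)) * bernoulli (nat (2 * m + 2 - 2 * j)) /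
                 (fact (nat (2 * j)) * fact (nat (2 * m + 2 - 2 * j)))"
  shows "summable L \<and> zeta (of_int (2 * m + 1)) + of_real (2 * (\<Sum>n. L n)) =
    of_real (2 powi (2 * m) * pi powi (2 * m + 1) * X)"
proof -
  have X': "(\<Sum>n\<in>{0..m + 1}. (- 1) powi (n + 1) *
                  (bernoulli (nat (2 * m - 2 * n + 2)) ^ 1 * bernoulli (nat (2 * n)) ^ 1) /
                  (fact (nat (2 * m - 2 * n + 2)) * fact (nat (2 * n))) ^ 1) = X"
  proof -
    have e: "2 * m - 2 * n + 2 = 2 * m + 2 - 2 * n" for n by simp
    show ?thesis unfolding X_def e by (intro sum.cong refl) (simp only: power_one_right mult_ac)
  qed
  have powers: "2 powi (2 * int 1 * m - int 1) * pi powi (2 * int 1 * m + 2 * int 1 - 1) = 2 powi (2 * m) * pi powi (2 * m + 1) / 2"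
    by (simp add: power_int_diff add.commute)
  have G0: "zeta_product m 1 0 = - zeta (of_int (2 * m + 1)) / 2"
    by (simp add: zeta_product_def zeta_0)
  have L_term: "of_nat (piltz_divisor 1 (Suc n)) / of_nat (Suc n) powi (2 * m + 1) * Psi (-1) ((2 * pi) ^ 1) 1 (real (Suc n)) =
     complex_of_real (L n)" for n
    using Psi_1[of "-1" "2 * pi" "real (Suc n)"] piltz_divisor_1[of "Suc n"]
    by (simp add: L_def del: of_nat_Suc)
  have "(\<lambda>n. complex_of_real (L n)) sums
      (1 / fact (1 - 1) * (deriv ^^ (1 - 1)) (zeta_product m 1) 0 + of_real (2 powi (2 * m) * pi powi (2 * m + 1) / 2 * X))"
    using sums_Psi_zeta_odd[OF assms(1) order_refl, of "-1"] unfolding L_term X' powers by simp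
  then have s: "(\<lambda>n. complex_of_real (L n)) sums
      (- zeta (of_int (2 * m + 1)) / 2 + of_real (2 powi (2 * m) * pi powi (2 * m + 1) / 2 * X))"
    by (simp add: G0[unfolded One_nat_def])
  from sums_Re[OF s] have "summable L" by (simp add: sums_iff)
  then have "(\<lambda>n. complex_of_real (L n)) sums of_real (\<Sum>n. L n)"
    by (intro sums_of_real summable_sums)
  from sums_unique2[OF s this] have "complex_of_real (2 * (\<Sum>n. L n)) = 
      2 * (- zeta (of_int (2 * m + 1)) / 2 + of_real (2 powi (2 * m) * pi powi (2 * m + 1) / 2 * X))"
    by simp
  then have "zeta (of_int (2 * m + 1)) + of_real (2 * (\<Sum>n. L n)) = of_real (2 powi (2 * m) * pi powi (2 * m + 1) * X)"
    by (simp add: distrib_left)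
  with \<open>summable L\<close> show ?thesis by blast
qed

theorem theorem1p7:
  fixes m :: int and k :: nat and \<mu> :: real
  assumes "odd m" and "k \<ge> 1" and "\<mu> < 0"
  shows "((\<lambda>n. of_nat (piltz_divisor k (Suc n)) / of_nat (Suc n) powi (2 * m + 1) *
               Psi \<mu> ((2 * pi) ^ k) k (real (Suc n)))
          sums
          (1 / fact (k - 1) *
             (deriv ^^ (k - 1))
               (\<lambda>s. zeta (of_int (2 * m + 1) + s) ^ k * zeta s ^ k * Gamma (s + 1) ^ k *
                    cos (of_real pi * s / 2) ^ (k - 1) *
                    (2 * of_real pi) powr (- of_nat k * s)) 0
           + of_real (2 powi (2 * int k * m - int k) * pi powi (2 * int k * m + 2 * int k - 1) *
               (\<Sum>n\<in>{0..m + 1}. (- 1) powi (n + 1) *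
                  (bernoulli (nat (2 * m - 2 * n + 2)) ^ k * bernoulli (nat (2 * n)) ^ k) /
                  (fact (nat (2 * m - 2 * n + 2)) * fact (nat (2 * n))) ^ k))))
       \<and>
       (let L = (\<lambda>n. 1 / (real (Suc n) powi (2 * m + 1) * (exp (2 * pi * real (Suc n)) - 1))) in
          summable L \<and>
          zeta (of_int (2 * m + 1)) + of_real (2 * (\<Sum>n. L n)) =
            of_real (2 powi (2 * m) * pi powi (2 * m + 1) *
              (\<Sum>j\<in>{0..m + 1}. (- 1) powi (j + 1) *
                 bernoulli (nat (2 * j)) * bernoulli (nat (2 * m + 2 - 2 * j)) /
                 (fact (nat (2 * j)) * fact (nat (2 * m + 2 - 2 * j))))))"
  using sums_Psi_zeta_odd[OF assms, unfolded zeta_product_def[abs_def]] lerch[OF assms(1)]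
  unfolding Let_def by (rule conjI)

end
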